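(* Let $\psi\in\mathcal{D}$, let $\varphi$ be an analytic self-map of the unit disk $\mathbb{D}$ and let $g$ be analytic on $\mathbb{D}$. Then the Volterra-composition operator $V_{\varphi}^{g}: AL_{\psi}^{2}(\mathbb{D})\rightarrow B_{\psi}(\mathbb{D})$ is bounded if and only if $$\sup_{z\in\mathbb{D}}e^{\psi(\varphi(z))-2\psi(z)}\sqrt{\Delta\psi(\varphi(z))}\,|g'(z)|<\infty.$$
   Context: $\mathbb{D}$ is the open unit disk and $dA$ the normalized area measure on it. For a real function $\psi\in C^{2}(\mathbb{D})$ with $\Delta\psi>0$ ($\Delta$ the Laplacian), put $\tau(z)=(\Delta\psi(z))^{-1/2}$. We write $\psi\in\mathcal{D}$ if: (1) there is $C_1>0$ with $|\tau(z)-\tau(\xi)|\le C_1|z-\xi|$ for all $z,\xi\in\mathbb{D}$; (2) there is $C_2>0$ with $\tau(z)\le C_2(1-|z|)$ for $z\in\mathbb{D}$; (3) there are constants $0<C_3<1$ and $a>0$ with $\tau(z)\le\tau(\xi)+C_3(1-|z|)$ whenever $|z-\xi|>a\tau(\xi)$. The weighted Bergman space $AL^{2}_{\psi}(\mathbb{D})$ is the space of analytic $f$ on $\mathbb{D}$ with $\|f\|_{L^2_\psi}=(\int_{\mathbb{D}}|f|^{2}e^{-2\psi}dA)^{1/2}<\infty$. The Bloch-type space $B_{\psi}(\mathbb{D})$ consists of analytic $f$ with $\sup_{z\in\mathbb{D}}e^{-2\psi(z)}|f'(z)|<\infty$, normed by $\|f\|_{B_\psi}=|f(0)|+\sup_{z\in\mathbb{D}}e^{-2\psi(z)}|f'(z)|$.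 The Volterra-composition operator is $V_{\varphi}^{g}f(z)=\int_{0}^{z}f(\varphi(t))g'(t)\,dt$, so $(V_\varphi^g f)'=(f\circ\varphi)g'$. Standing assumption of the paper: $H^\infty_\psi(\mathbb{D})=\{f \text{ analytic}: e^{-\psi}f\in L^\infty\}$ and the set of polynomials are dense in $AL^2_\psi(\mathbb{D})$. *)

theory Defs
  imports "HOL-Complex_Analysis.Complex_Analysis" "HOL-Computational_Algebra.Polynomial"
begin

abbreviation unit_disk :: "complex set" where
  "unit_disk \<equiv> ball 0 1"

definition dx :: "(complex \<Rightarrow> real) \<Rightarrow> complex \<Rightarrow> real" where
  "dx f z = deriv (\<lambda>t::real. f (z + complex_of_real t)) 0"

definition dy :: "(complex \<Rightarrow> real) \<Rightarrow> complex \<Rightarrow> real" where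
  "dy f z = deriv (\<lambda>t::real. f (z + \<i> * complex_of_real t)) 0"

definition laplacian :: "(complex \<Rightarrow> real) \<Rightarrow> complex \<Rightarrow> real" where
  "laplacian f z = dx (dx f) z + dy (dy f) z"

definition C2_on :: "complex set \<Rightarrow> (complex \<Rightarrow> real) \<Rightarrow> bool" where
  "C2_on S f \<longleftrightarrow> (\<exists>(D1 :: complex \<Rightarrow> (complex \<Rightarrow>\<^sub>L real))
                       (D2 :: complex \<Rightarrow> (complex \<Rightarrow>\<^sub>L (complex \<Rightarrow>\<^sub>L real))).
      (\<forall>z\<in>S. (f has_derivative blinfun_apply (D1 z)) (at z)) \<and>
      (\<forall>z\<in>S. (D1 has_derivative blinfun_apply (D2 z)) (at z)) \<and>
      continuous_on S D2)"

definition tau :: "(complex \<Rightarrow> real) \<Rightarrow> complex \<Rightarrow> real" where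
  "tau \<psi> z = 1 / sqrt (laplacian \<psi> z)"

definition class_D :: "(complex \<Rightarrow> real) \<Rightarrow> bool" where
  "class_D \<psi> \<longleftrightarrow>
     C2_on unit_disk \<psi> \<and> (\<forall>z\<in>unit_disk. laplacian \<psi> z > 0) \<and>
     (\<exists>C1>0. \<forall>z\<in>unit_disk. \<forall>\<xi>\<in>unit_disk. \<bar>tau \<psi> z - tau \<psi> \<xi>\<bar> \<le> C1 * cmod (z - \<xi>)) \<and>
     (\<exists>C2>0. \<forall>z\<in>unit_disk. tau \<psi> z \<le> C2 * (1 - cmod z)) \<and>
     (\<exists>C3 a. 0 < C3 \<and> C3 < 1 \<and> a > 0 \<and>
        (\<forall>z\<in>unit_disk. \<forall>\<xi>\<in>unit_disk. cmod (z - \<xi>) > a * tau \<psi> \<xi> \<longrightarrow>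
            tau \<psi> z \<le> tau \<psi> \<xi> + C3 * (1 - cmod z)))"

text \<open>Weighted integral with respect to normalized area measure dA = dxdy/pi.\<close>
definition L2_int :: "(complex \<Rightarrow> real) \<Rightarrow> (complex \<Rightarrow> complex) \<Rightarrow> ennreal" where
  "L2_int \<psi> f = ennreal (1 / pi) *
     (\<integral>\<^sup>+ z. indicator unit_disk z * ennreal ((cmod (f z))\<^sup>2 * exp (- 2 * \<psi> z)) \<partial>lborel)"

definition L2_norm :: "(complex \<Rightarrow> real) \<Rightarrow> (complex \<Rightarrow> complex) \<Rightarrow> real" where
  "L2_norm \<psi> f = sqrt (enn2real (L2_int \<psi> f))"

definition AL2 :: "(complex \<Rightarrow> real) \<Rightarrow> (complex \<Rightarrow> complex) set" where
  "AL2 \<psi> = {f. f holomorphic_on unit_disk \<and> L2_int \<psi> f < \<infinity>}"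

definition Hinf :: "(complex \<Rightarrow> real) \<Rightarrow> (complex \<Rightarrow> complex) set" where
  "Hinf \<psi> = {f. f holomorphic_on unit_disk \<and>
                 bounded ((\<lambda>z. exp (- \<psi> z) * cmod (f z)) ` unit_disk)}"

definition Bloch :: "(complex \<Rightarrow> real) \<Rightarrow> (complex \<Rightarrow> complex) set" where
  "Bloch \<psi> = {f. f holomorphic_on unit_disk \<and>
                 bounded ((\<lambda>z. exp (- 2 * \<psi> z) * cmod (deriv f z)) ` unit_disk)}"

definition Bloch_norm :: "(complex \<Rightarrow> real) \<Rightarrow> (complex \<Rightarrow> complex) \<Rightarrow> real" where
  "Bloch_norm \<psi> f = cmod (f 0) + (SUP z\<in>unit_disk. exp (- 2 * \<psi> z) * cmod (deriv f z))"

definition volterra_comp ::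
  "(complex \<Rightarrow> complex) \<Rightarrow> (complex \<Rightarrow> complex) \<Rightarrow> (complex \<Rightarrow> complex) \<Rightarrow> complex \<Rightarrow> complex" where
  "volterra_comp \<phi> g f z = contour_integral (linepath 0 z) (\<lambda>t. f (\<phi> t) * deriv g t)"

definition bounded_AL2_Bloch ::
  "(complex \<Rightarrow> real) \<Rightarrow> ((complex \<Rightarrow> complex) \<Rightarrow> (complex \<Rightarrow> complex)) \<Rightarrow> bool" where
  "bounded_AL2_Bloch \<psi> V \<longleftrightarrow>
     (\<exists>C. \<forall>f\<in>AL2 \<psi>. V f \<in> Bloch \<psi> \<and> Bloch_norm \<psi> (V f) \<le> C * L2_norm \<psi> f)"

definition standing_density :: "(complex \<Rightarrow> real) \<Rightarrow> bool" where
  "standing_density \<psi> \<longleftrightarrow>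
     (\<forall>f\<in>AL2 \<psi>. \<forall>\<epsilon>>0. \<exists>h\<in>Hinf \<psi>. h \<in> AL2 \<psi> \<and> L2_norm \<psi> (\<lambda>z. f z - h z) < \<epsilon>) \<and>
     (\<forall>f\<in>AL2 \<psi>. \<forall>\<epsilon>>0. \<exists>p::complex poly. poly p \<in> AL2 \<psi> \<and>
                                L2_norm \<psi> (\<lambda>z. f z - poly p z) < \<epsilon>)"

end

theory Submission
  imports Defs
begin

text \<open>
  Boundedness means that the evaluation functionals \<open>f \<mapsto> f (\<phi> z)\<close> on \<open>AL2 \<psi>\<close>, multiplied by
  \<open>exp (- 2 * \<psi> z) * cmod (deriv g z)\<close>, are uniformly bounded, so one needs two-sided bounds
  for the norm of evaluation at \<open>w\<close>, of order \<open>exp (\<psi> w) / tau \<psi> w\<close>. After the rescaling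
  \<open>z = w + tau \<psi> w * \<zeta>\<close> both follow from one integral identity for \<open>\<integral> k |b|\<^sup>2 exp \<Phi>\<close>.

  Upper bound: with \<open>b = f\<close> holomorphic and \<open>k\<close> a truncated logarithm the identity is a sub-mean value
  inequality, since \<open>\<Delta>\<psi>\<close> is bounded on a disc of fixed radius.

  Lower bound: by duality the squared norm of evaluation at \<open>0\<close> is the minimum of \<open>\<integral> |\<gamma>|\<^sup>2 exp (2\<psi>)\<close> over
  \<open>\<gamma> = g0 + \<partial>\<close>-bar\<open> \<beta>\<close> with \<open>\<beta>\<close> a test function and \<open>g0\<close> a bump of fixed mass; by Weyl's lemma the minimal
  \<open>\<gamma>\<close> is the conjugate of a holomorphic function times \<open>exp (- 2\<psi>)\<close>, which is the extremal function. The
  minimum is bounded below by the identity with weight \<open>2\<psi> - 2\<kappa> (log (1 + |\<zeta>|\<^sup>2))\<^sup>2\<close>; it is still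
  subharmonic because the Lipschitz bound on \<open>tau\<close> gives \<open>\<Delta>\<psi> \<ge> (1 + C |\<zeta>|)\<^sup>-\<^sup>2\<close>, and it absorbs a factor
  \<open>|\<zeta>|\<^sup>2\<close> at infinity.
\<close>

text \<open>The constants must not depend on \<open>w\<close>, although the rescaled domains do and
  the lower bound on the Laplacian decays at infinity. No weight with a pole is used: the value at
  the origin comes from a concentrating part of the Laplacian of the twist \<open>k\<close>, as in
  extension theorems of Ohsawa-Takegoshi type. The minimum is linked to such a pointwise estimate as
  follows. Let \<chi> be a cut-off with \<chi>(0) = 1 and let \<open>g0\<close> be minus its dbar
  derivative divided by \<zeta>. Then b = \<chi> - \<zeta> * \<beta> satisfies b(0) = 1, and its
  dbar derivative is -\<zeta> * \<gamma> with \<gamma> = g0 + dbar \<beta>. So a bound of |b(0)|^2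
  by the integral of |dbar b / \<zeta>|^2 exp(2\<psi>) is exactly a lower bound for the minimum.
  Since 1/(pi * \<zeta>) is the fundamental solution of dbar, \<open>g0\<close> has mass pi, and the
  minimum is pi^2 times the squared norm of evaluation. It need not be attained by a continuous
  function of compact support, so the minimiser enters only as a limit functional. Only two-sided
  comparability matters, so numerical factors are given away freely.\<close>

section \<open>Wirtinger derivatives and integration by parts\<close>

text \<open>\<open>p\<close> and \<open>q\<close> are the Wirtinger derivatives \<open>\<partial>u\<close> and \<open>\<partial>\<close>-bar \<open>u\<close> of \<open>u\<close> at \<open>z\<close>.\<close>
definition wirtinger :: "(complex \<Rightarrow> complex) \<Rightarrow> complex \<Rightarrow> complex \<Rightarrow> complex \<Rightarrow> bool" where
  "wirtinger u p q z \<longleftrightarrow> (u has_derivative (\<lambda>h. p * h + q * cnj h)) (at z)"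

lemma wirtinger_const [simp]: "wirtinger (\<lambda>_. c) 0 0 z"
  by (simp add: wirtinger_def)

lemma wirtinger_ident: "wirtinger (\<lambda>z. z) 1 0 z"
  by (simp add: wirtinger_def)

lemma wirtinger_add: "wirtinger u p q z \<Longrightarrow> wirtinger v p' q' z \<Longrightarrow> wirtinger (\<lambda>z. u z + v z) (p + p') (q + q') z"
  unfolding wirtinger_def by (drule (1) has_derivative_add) (simp add: algebra_simps)

lemma wirtinger_diff: "wirtinger u p q z \<Longrightarrow> wirtinger v p' q' z \<Longrightarrow> wirtinger (\<lambda>z. u z - v z) (p - p') (q - q') z"
  unfolding wirtinger_def by (drule (1) has_derivative_diff) (simp add: algebra_simps)

lemma wirtinger_mult:
  "wirtinger u p q z \<Longrightarrow> wirtinger v p' q' z \<Longrightarrow> wirtinger (\<lambda>z. u z * v z) (p * v z + u z * p') (q * v z + u z * q') z"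
  unfolding wirtinger_def by (drule (1) has_derivative_mult) (simp add: algebra_simps)

lemma wirtinger_cnj: "wirtinger u p q z \<Longrightarrow> wirtinger (\<lambda>z. cnj (u z)) (cnj q) (cnj p) z"
  unfolding wirtinger_def by (drule has_derivative_cnj) (simp add: algebra_simps)

lemma wirtinger_field_derivative: "(f has_field_derivative f') (at z) \<Longrightarrow> wirtinger f f' 0 z"
  by (simp add: wirtinger_def has_field_derivative_def)

text \<open>Because the inner function is real, the imaginary part of
  \<open>p * h + q * cnj h\<close> is the differential of the zero function. The differential is
  thus real, and the real chain rule can be read back as a complex one.\<close>

lemma wirtinger_compose_real:
  fixes r :: "complex \<Rightarrow> real"
  assumes "wirtinger (\<lambda>z. of_real (r z)) p q z" "(f has_real_derivative d) (at (r z))"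
  shows "wirtinger (\<lambda>z. of_real (f (r z))) (of_real d * p) (of_real d * q) z"
proof -
  have "(r has_derivative (\<lambda>h. Re (p * h + q * cnj h))) (at z)"
    using has_derivative_Re[OF assms(1)[unfolded wirtinger_def]] by simp
  from has_derivative_of_real[OF has_derivative_compose[OF this assms(2)[unfolded has_field_derivative_def]]]
  have *: "((\<lambda>z. complex_of_real (f (r z))) has_derivative
     (\<lambda>h. complex_of_real (d * Re (p * h + q * cnj h)))) (at z)" .
  have "((\<lambda>z. Im (complex_of_real (r z))) has_derivative (\<lambda>h. Im (p * h + q * cnj h))) (at z)"
    by (rule has_derivative_Im[OF assms(1)[unfolded wirtinger_def]])
  moreover have "((\<lambda>z. Im (complex_of_real (r z))) has_derivative (\<lambda>h. 0)) (at z)"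
    by simp
  ultimately have "(\<lambda>h. Im (p * h + q * cnj h)) = (\<lambda>h. 0)"
    by (rule has_derivative_unique)
  then have "complex_of_real (d * Re (p * h + q * cnj h)) = of_real d * (p * h + q * cnj h)" for h
    by (metis (mono_tags, lifting) complex_eq_iff complex_is_Real_iff of_real_Re of_real_mult)
  with * show ?thesis
    by (simp add: wirtinger_def algebra_simps)
qed

lemma wirtinger_translate: "wirtinger u p q (z + a) \<Longrightarrow> wirtinger (\<lambda>z. u (z + a)) p q z"
  unfolding wirtinger_def
  by (rule has_derivative_compose[of "\<lambda>z. z + a" "\<lambda>h. h" z UNIV u, simplified])
     (auto intro!: derivative_eq_intros)

lemma wirtinger_isCont: "wirtinger u p q z \<Longrightarrow> isCont u z"
  unfolding wirtinger_def by (rule has_derivative_continuous)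

lemma wirtinger_continuous_on: "(\<And>z. z \<in> S \<Longrightarrow> wirtinger u (p z) (q z) z) \<Longrightarrow> continuous_on S u"
  by (meson continuous_at_imp_continuous_on wirtinger_isCont)

lemma wirtinger_unique:
  assumes "wirtinger u p q z" "wirtinger u p' q' z"
  shows "p = p'" "q = q'"
proof -
  have *: "(\<lambda>h. p * h + q * cnj h) = (\<lambda>h. p' * h + q' * cnj h)"
    using assms unfolding wirtinger_def by (rule has_derivative_unique)
  have "p + q = p' + q'" using fun_cong[OF *, of 1] by simp
  moreover have "\<i> * (p - q) = \<i> * (p' - q')" using fun_cong[OF *, of \<i>] by (simp add: algebra_simps)
  then have "p - q = p' - q'" by simp
  ultimately show "p = p'" "q = q'" by algebra+
qed

lemma wirtinger_transform_open:
  "wirtinger u p q z \<Longrightarrow> open S \<Longrightarrow> z \<in> S \<Longrightarrow> (\<And>y. y \<in> S \<Longrightarrow> u y = v y) \<Longrightarrow> wirtinger v p q z"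
  unfolding wirtinger_def by (rule has_derivative_transform_within_open)

lemma wirtinger_cong: "wirtinger u p q z \<Longrightarrow> p = p' \<Longrightarrow> q = q' \<Longrightarrow> wirtinger u p' q' z"
  by simp

lemma wirtinger_norm_square: "wirtinger (\<lambda>z. of_real ((cmod z)^2)) (cnj z) z z"
proof -
  have "wirtinger (\<lambda>z. z * cnj z) (1 * cnj z + z * cnj 0) (0 * cnj z + z * cnj 1) z"
    by (intro wirtinger_mult wirtinger_ident wirtinger_cnj)
  then show ?thesis unfolding complex_norm_square by simp
qed

section \<open>Integration by parts for compactly supported functions\<close>

definition compact_support :: "complex set \<Rightarrow> (complex \<Rightarrow> complex) \<Rightarrow> bool" where
  "compact_support S u \<longleftrightarrow> (\<exists>K. compact K \<and> K \<subseteq> S \<and> (\<forall>z. z \<notin> K \<longrightarrow> u z = 0))"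

lemma integrable_continuous_compact_support:
  fixes u :: "complex \<Rightarrow> 'a::{banach, second_countable_topology}"
  assumes "continuous_on K u" "compact K" "\<And>z. z \<notin> K \<Longrightarrow> u z = 0"
  shows "integrable lborel u"
proof -
  have "integrable lborel (\<lambda>z. indicator K z *\<^sub>R u z)"
    using assms by (intro borel_integrable_compact)
  moreover have "(\<lambda>z. indicator K z *\<^sub>R u z) = u"
    using assms(3) by (force simp: indicator_def)
  ultimately show ?thesis by simp
qed

lemma integral_translate:
  fixes u :: "complex \<Rightarrow> complex"
  assumes [measurable]: "u \<in> borel_measurable borel"
  shows "(LINT z|lborel. u (z + a)) = (LINT z|lborel. u z)"
proof -
  have "(LINT z|lborel. u z) = (LINT z|distr lborel borel ((+) a). u z)"
    by (simp add: lborel_distr_plus)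
  also have "\<dots> = (LINT z|lborel. u (a + z))"
    by (subst integral_distr) auto
  finally show ?thesis by (simp add: add.commute)
qed

lemma bounded_continuous_compact_support:
  fixes u :: "complex \<Rightarrow> 'a::real_normed_vector"
  assumes "continuous_on UNIV u" "compact K" "\<And>z. z \<notin> K \<Longrightarrow> u z = 0"
  obtains B where "B \<ge> 0" "\<And>z. norm (u z) \<le> B"
proof -
  have "bounded (u ` K)"
    using assms by (intro compact_imp_bounded compact_continuous_image) (auto intro: continuous_on_subset)
  then obtain B where B: "\<And>z. z \<in> K \<Longrightarrow> norm (u z) \<le> B" 
    by (auto simp: bounded_iff)
  have "norm (u z) \<le> max B 0" for z
    using B[of z] assms(3)[of z] by (cases "z \<in> K") auto
  then show ?thesis using that[of "max B 0"] by auto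
qed

lemma norm_wirtinger_diff_le:
  assumes "convex S" "\<And>z. z \<in> S \<Longrightarrow> wirtinger u (p z) (q z) z" 
    and "\<And>z. z \<in> S \<Longrightarrow> cmod (p z) \<le> B" "\<And>z. z \<in> S \<Longrightarrow> cmod (q z) \<le> B'"
    and "x \<in> S" "y \<in> S"
  shows "cmod (u x - u y) \<le> (B + B') * cmod (x - y)"
proof (rule differentiable_bound[where f' = "\<lambda>z h. p z * h + q z * cnj h" and S = S])
  show "(u has_derivative (\<lambda>h. p z * h + q z * cnj h)) (at z within S)" if "z \<in> S" for z
    using assms(2)[OF that] unfolding wirtinger_def by (rule has_derivative_at_withinI)
  show "onorm (\<lambda>h. p z * h + q z * cnj h) \<le> B + B'" if "z \<in> S" for z
  proof (rule onorm_le)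
    fix h
    have "cmod (p z * h + q z * cnj h) \<le> cmod (p z) * cmod h + cmod (q z) * cmod h"
      using norm_triangle_ineq[of "p z * h" "q z * cnj h"] by (simp add: norm_mult)
    also have "\<dots> \<le> (B + B') * cmod h"
      unfolding distrib_right using assms(3,4)[OF that] by (intro add_mono mult_right_mono) auto
    finally show "cmod (p z * h + q z * cnj h) \<le> (B + B') * cmod h" .
  qed
qed (use assms in auto)

text \<open>By translation invariance of Lebesgue measure the difference quotients of
  \<open>u\<close> in direction \<open>d\<close> have integral zero; dominated convergence passes
  this on to the directional derivative.\<close>

lemma integral_wirtinger_direction:
  assumes der: "\<And>z. wirtinger u (p z) (q z) z"
    and cont: "continuous_on UNIV p" "continuous_on UNIV q"
    and K: "compact K" "\<And>z. z \<notin> K \<Longrightarrow> u z = 0" "\<And>z. z \<notin> K \<Longrightarrow> p z = 0" "\<And>z. z \<notin> K \<Longrightarrow> q z = 0"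
    and d: "cmod d = 1"
  shows "(LINT z|lborel. p z * d + q z * cnj d) = 0"
proof -
  obtain B where B: "B \<ge> 0" "\<And>z. norm (p z) \<le> B" 
    using bounded_continuous_compact_support[OF cont(1) K(1,3)] by blast
  obtain B' where B': "B' \<ge> 0" "\<And>z. norm (q z) \<le> B'" 
    using bounded_continuous_compact_support[OF cont(2) K(1,4)] by blast
  have contu: "continuous_on UNIV u"
    by (rule wirtinger_continuous_on[OF der])
  then have [measurable]: "u \<in> borel_measurable borel"
    by (rule borel_measurable_continuous_onI)
  define h where "h n = d * of_real (inverse (real (Suc n)))" for n
  have norm_h: "cmod (h n) = inverse (real (Suc n))" for n
    unfolding h_def norm_mult d norm_of_real by simp
  have h0: "h n \<noteq> 0" "cmod (h n) \<le> 1" for n 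
  proof -
    have "cmod (h n) > 0" unfolding norm_h by simp
    then show "h n \<noteq> 0" by auto
    show "cmod (h n) \<le> 1" unfolding norm_h by (simp add: inverse_eq_divide)
  qed
  have hlim: "h \<longlonglongrightarrow> 0" unfolding h_def
    by (rule tendsto_mult_right_zero)
       (use LIMSEQ_inverse_real_of_nat in \<open>simp only: tendsto_of_real_iff[where 'a=complex, symmetric] of_real_0\<close>)
  have hn: "h n = d * of_real (cmod (h n))" for n
    unfolding norm_h by (simp add: h_def)
  define s where "s n z = (u (z + h n) - u z) / of_real (cmod (h n))" for n z
  have intu: "integrable lborel u"
    using contu K by (intro integrable_continuous_compact_support[of K]) (auto intro: continuous_on_subset)
  have intu': "integrable lborel (\<lambda>z. u (z + a))" for a
  proof (rule integrable_continuous_compact_support)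
    show "compact ((\<lambda>z. z - a) ` K)" using K by (intro compact_continuous_image continuous_intros)
    show "continuous_on ((\<lambda>z. z - a) ` K) (\<lambda>z. u (z + a))"
      by (intro continuous_on_compose2[OF contu] continuous_intros) auto
    show "u (z + a) = 0" if "z \<notin> (\<lambda>z. z - a) ` K" for z
    proof (rule K(2))
      show "z + a \<notin> K" using that by (metis add_diff_cancel_right' image_eqI)
    qed
  qed
  have s0: "(LINT z|lborel. s n z) = 0" for n
    unfolding s_def using intu intu' by (simp add: integral_translate)
  obtain e where e: "e > 0" "\<And>z. z \<in> K \<Longrightarrow> cmod z \<le> e"
    using compact_imp_bounded[OF K(1)] unfolding bounded_pos by blast
  \<comment> \<open>The increments \<open>h n\<close> have modulus at most 1, so all difference
    quotients are supported in this one ball.\<close>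
  define K' where "K' = cball (0::complex) (e + 1)"
  have "(\<lambda>n. LINT z|lborel. s n z) \<longlonglongrightarrow> (LINT z|lborel. p z * d + q z * cnj d)"
  proof (rule integral_dominated_convergence[where w = "\<lambda>z. indicator K' z *\<^sub>R (B + B')"])
    show "integrable lborel (\<lambda>z. indicator K' z *\<^sub>R (B + B'))"
      by (rule borel_integrable_compact) (auto simp: K'_def)
    have "(\<lambda>n. s n z) \<longlonglongrightarrow> p z * d + q z * cnj d" for z
    proof -
      have "((\<lambda>k. cmod (u (z + k) - u z - (p z * k + q z * cnj k)) / cmod k) \<longlongrightarrow> 0) (at 0)"
        using der[of z] unfolding wirtinger_def has_derivative_at by simp
      moreover have "filterlim h (at 0) sequentially"
        using h0 hlim by (auto simp: filterlim_at)
      ultimately have "(\<lambda>n. cmod (u (z + h n) - u z - (p z * h n + q z * cnj (h n))) / cmod (h n)) \<longlonglongrightarrow> 0"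
        by (rule filterlim_compose)
      moreover have "cmod (u (z + h n) - u z - (p z * h n + q z * cnj (h n))) / cmod (h n)
          = cmod (s n z - (p z * d + q z * cnj d))" for n
      proof -
        define r where "r = cmod (h n)"
        have r: "r > 0" "h n = d * of_real r" using h0 hn unfolding r_def by auto
        have "s n z - (p z * d + q z * cnj d) = (u (z + h n) - u z - (p z * h n + q z * cnj (h n))) / of_real r"
          using r(1) d by (simp add: s_def r(2) norm_mult field_simps)
        then show ?thesis using r(1) d by (simp add: norm_divide norm_mult r_def[symmetric])
      qed
      ultimately have "(\<lambda>n. cmod (s n z - (p z * d + q z * cnj d))) \<longlonglongrightarrow> 0" by simp
      then show ?thesis using Lim_null tendsto_norm_zero_iff by blast
    qed
    then show "AE z in lborel. (\<lambda>n. s n z) \<longlonglongrightarrow> p z * d + q z * cnj d" by simp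
    have "norm (s n z) \<le> indicator K' z *\<^sub>R (B + B')" for n z
    proof (cases "z \<in> K'")
      case True
      have "cmod (u (z + h n) - u z) \<le> (B + B') * cmod (z + h n - z)"
        by (rule norm_wirtinger_diff_le[of UNIV u p q]) (use der B B' in auto)
      then show ?thesis using True h0 by (simp add: s_def norm_divide field_simps)
    next
      case False
      then have "e + 1 < cmod z" by (simp add: K'_def)
      moreover from this have "e < cmod (z + h n)"
        using norm_triangle_ineq4[of "z + h n" "h n"] h0[of n] by simp
      ultimately have "z \<notin> K" "z + h n \<notin> K" using e by force+
      then show ?thesis using K False by (simp add: s_def)
    qed
    then show "AE z in lborel. norm (s n z) \<le> indicator K' z *\<^sub>R (B + B')" for n by simp
    show "(\<lambda>z. p z * d + q z * cnj d) \<in> borel_measurable lborel"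
      using cont[THEN borel_measurable_continuous_onI] by simp
    show "s n \<in> borel_measurable lborel" for n unfolding s_def by measurable
  qed
  then show ?thesis by (simp add: s0 LIMSEQ_const_iff)
qed

text \<open>The directions \<open>1\<close> and \<open>\<i>\<close> give the vanishing of the
  integrals of \<open>p + q\<close> and of \<open>p - q\<close>.\<close>

lemma integral_wirtinger_eq_0:
  assumes der: "\<And>z. wirtinger u (p z) (q z) z"
    and cont: "continuous_on UNIV p" "continuous_on UNIV q"
    and K: "compact K" "\<And>z. z \<notin> K \<Longrightarrow> u z = 0" "\<And>z. z \<notin> K \<Longrightarrow> p z = 0" "\<And>z. z \<notin> K \<Longrightarrow> q z = 0"
  shows "(LINT z|lborel. p z) = 0" "(LINT z|lborel. q z) = 0"
proof -
  have int: "integrable lborel p" "integrable lborel q"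
    using cont K by (auto intro!: integrable_continuous_compact_support[of K] intro: continuous_on_subset)
  have 1: "(LINT z|lborel. p z) + (LINT z|lborel. q z) = 0"
    using integral_wirtinger_direction[OF der cont K, of 1] int by simp
  have "(LINT z|lborel. p z) * \<i> - (LINT z|lborel. q z) * \<i> = 0"
    using integral_wirtinger_direction[OF der cont K, of \<i>] int by simp
  then have 2: "(LINT z|lborel. p z) = (LINT z|lborel. q z)"
    by (simp add: algebra_simps)
  show "(LINT z|lborel. p z) = 0" "(LINT z|lborel. q z) = 0" using 1 2 by auto
qed

text \<open>Extension by zero reduces this to the whole plane: \<open>u\<close> vanishes on the open
  set \<open>S - K\<close>, hence so do its derivatives, and the extension is differentiable across
  the boundary of \<open>K\<close>.\<close>

lemma integral_wirtinger_on_eq_0: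
  assumes der: "\<And>z. z \<in> S \<Longrightarrow> wirtinger u (p z) (q z) z" and "open S"
    and cont: "continuous_on S p" "continuous_on S q"
    and K: "compact K" "K \<subseteq> S" "\<And>z. z \<in> S - K \<Longrightarrow> u z = 0"
  shows "(LINT z|lborel. indicator K z * p z) = 0" "(LINT z|lborel. indicator K z * q z) = 0"
proof -
  have 0: "p z = 0 \<and> q z = 0" if "z \<in> S - K" for z
  proof -
    have "wirtinger (\<lambda>_. 0) (p z) (q z) z"
      using that K \<open>open S\<close> by (intro wirtinger_transform_open[OF der, of z "S - K"]) (auto intro: open_Diff compact_imp_closed)
    from wirtinger_unique[OF this wirtinger_const] show ?thesis by simp
  qed
  have cl: "closed K" using K by (simp add: compact_imp_closed)
  have cont': "continuous_on UNIV (\<lambda>z. indicator K z * f z)"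
    if f: "continuous_on S f" "\<And>z. z \<in> S - K \<Longrightarrow> f z = 0" for f :: "complex \<Rightarrow> complex"
  proof -
    have "continuous_on S (\<lambda>z. indicator K z * f z)"
      using f by (subst continuous_on_cong[OF refl, of _ _ f]) (auto simp: indicator_def)
    moreover have "continuous_on (- K) (\<lambda>z. indicator K z * f z)"
      by (subst continuous_on_cong[OF refl, of _ _ "\<lambda>_. 0"]) auto
    ultimately have "continuous_on (S \<union> - K) (\<lambda>z. indicator K z * f z)"
      using \<open>open S\<close> cl by (intro continuous_on_open_Un) auto
    moreover have "S \<union> - K = UNIV" using K by auto
    ultimately show ?thesis by simp
  qed
  have der': "wirtinger (\<lambda>z. indicator K z * u z) (indicator K z * p z) (indicator K z * q z) z" for z
  proof (cases "z \<in> S")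
    case True
    have "wirtinger (\<lambda>z. indicator K z * u z) (p z) (q z) z"
      by (rule wirtinger_transform_open[OF der[OF True] \<open>open S\<close> True]) (use K in \<open>auto simp: indicator_def\<close>)
    then show ?thesis using True 0 by (auto simp: indicator_def)
  next
    case False
    then have "z \<in> - K" using K by auto
    have "wirtinger (\<lambda>z. indicator K z * u z) 0 0 z"
      by (rule wirtinger_transform_open[OF wirtinger_const, of "- K"]) (use \<open>z \<in> - K\<close> cl in auto)
    then show ?thesis using \<open>z \<in> - K\<close> by simp
  qed
  show "(LINT z|lborel. indicator K z * p z) = 0" "(LINT z|lborel. indicator K z * q z) = 0"
    by (rule integral_wirtinger_eq_0[OF der' cont' cont' K(1)]; use cont 0 in auto)+
qed

section \<open>Twice continuously differentiable functions in Wirtinger form\<close>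

text \<open>Here \<open>s\<close> is the mixed derivative, a quarter of the Laplacian. For real functions the symmetry of
  second derivatives is not part of \<open>C2r\<close>, so that only \<open>Re s\<close> is a quarter of the Laplacian.\<close>
definition C2w :: "complex set \<Rightarrow> (complex \<Rightarrow> complex) \<Rightarrow> (complex \<Rightarrow> complex) \<Rightarrow> (complex \<Rightarrow> complex) \<Rightarrow>
    (complex \<Rightarrow> complex) \<Rightarrow> bool" where
  "C2w S u p q s \<longleftrightarrow> (\<exists>p1 q2. (\<forall>z\<in>S. wirtinger u (p z) (q z) z \<and> wirtinger p (p1 z) (s z) z \<and> wirtinger q (s z) (q2 z) z) \<and>
      continuous_on S p1 \<and> continuous_on S s \<and> continuous_on S q2)"

definition C2r :: "complex set \<Rightarrow> (complex \<Rightarrow> real) \<Rightarrow> (complex \<Rightarrow> complex) \<Rightarrow> (complex \<Rightarrow> complex) \<Rightarrow> bool" where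
  "C2r S u p s \<longleftrightarrow> (\<exists>p1. (\<forall>z\<in>S. wirtinger (\<lambda>z. of_real (u z)) (p z) (cnj (p z)) z \<and> wirtinger p (p1 z) (s z) z) \<and>
      continuous_on S p1 \<and> continuous_on S s)"

lemma C2w_wirtinger:
  assumes "C2w S u p q s" "z \<in> S"
  shows "wirtinger u (p z) (q z) z"
  using assms by (auto simp: C2w_def)

lemma C2w_continuous_on:
  assumes "C2w S u p q s"
  shows "continuous_on S u" "continuous_on S p" "continuous_on S q" "continuous_on S s"
proof -
  from assms obtain p1 q2 where 
    *: "\<And>z. z \<in> S \<Longrightarrow> wirtinger u (p z) (q z) z" "\<And>z. z \<in> S \<Longrightarrow> wirtinger p (p1 z) (s z) z" 
       "\<And>z. z \<in> S \<Longrightarrow> wirtinger q (s z) (q2 z) z" and c: "continuous_on S s"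
    unfolding C2w_def by blast
  show "continuous_on S u" "continuous_on S p" "continuous_on S q"
    using *[THEN wirtinger_isCont] by (auto intro!: continuous_at_imp_continuous_on)
  show "continuous_on S s" by fact
qed

lemma C2r_continuous_on:
  assumes "C2r S u p s"
  shows "continuous_on S u" "continuous_on S p" "continuous_on S s"
proof -
  from assms obtain p1 where 
    *: "\<And>z. z \<in> S \<Longrightarrow> wirtinger (\<lambda>z. of_real (u z)) (p z) (cnj (p z)) z" "\<And>z. z \<in> S \<Longrightarrow> wirtinger p (p1 z) (s z) z" 
       and c: "continuous_on S s"
    unfolding C2r_def by blast
  have "continuous_on S (\<lambda>z. Re (of_real (u z)))"
    by (intro continuous_intros wirtinger_continuous_on[OF *(1)])
  then show "continuous_on S u" by simp
  show "continuous_on S p"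
    using *(2)[THEN wirtinger_isCont] by (auto intro!: continuous_at_imp_continuous_on)
  show "continuous_on S s" by fact
qed

lemma C2w_subset: "C2w S u p q s \<Longrightarrow> T \<subseteq> S \<Longrightarrow> C2w T u p q s"
  unfolding C2w_def by (meson continuous_on_subset subsetD)

lemma C2w_add:
  assumes "C2w S u p q s" "C2w S u' p' q' s'"
  shows "C2w S (\<lambda>z. u z + u' z) (\<lambda>z. p z + p' z) (\<lambda>z. q z + q' z) (\<lambda>z. s z + s' z)"
proof -
  from assms(1) obtain p1 q2 where
    1: "\<And>z. z \<in> S \<Longrightarrow> wirtinger u (p z) (q z) z" "\<And>z. z \<in> S \<Longrightarrow> wirtinger p (p1 z) (s z) z"
       "\<And>z. z \<in> S \<Longrightarrow> wirtinger q (s z) (q2 z) z" "continuous_on S p1" "continuous_on S s" "continuous_on S q2"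
    unfolding C2w_def by blast
  from assms(2) obtain p1' q2' where
    2: "\<And>z. z \<in> S \<Longrightarrow> wirtinger u' (p' z) (q' z) z" "\<And>z. z \<in> S \<Longrightarrow> wirtinger p' (p1' z) (s' z) z"
       "\<And>z. z \<in> S \<Longrightarrow> wirtinger q' (s' z) (q2' z) z" "continuous_on S p1'" "continuous_on S s'" "continuous_on S q2'"
    unfolding C2w_def by blast
  show ?thesis unfolding C2w_def
    by (rule exI[of _ "\<lambda>z. p1 z + p1' z"], rule exI[of _ "\<lambda>z. q2 z + q2' z"], intro conjI ballI)
       (auto intro!: wirtinger_add 1 2 continuous_intros)
qed

lemma C2w_mult:
  assumes "C2w S u p q s" "C2w S u' p' q' s'"
  shows "C2w S (\<lambda>z. u z * u' z) (\<lambda>z. p z * u' z + u z * p' z) (\<lambda>z. q z * u' z + u z * q' z)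
    (\<lambda>z. s z * u' z + p z * q' z + q z * p' z + u z * s' z)"
proof -
  note c = C2w_continuous_on[OF assms(1)] C2w_continuous_on[OF assms(2)]
  from assms(1) obtain p1 q2 where
    1: "\<And>z. z \<in> S \<Longrightarrow> wirtinger u (p z) (q z) z" "\<And>z. z \<in> S \<Longrightarrow> wirtinger p (p1 z) (s z) z"
       "\<And>z. z \<in> S \<Longrightarrow> wirtinger q (s z) (q2 z) z" "continuous_on S p1" "continuous_on S s" "continuous_on S q2"
    unfolding C2w_def by blast
  from assms(2) obtain p1' q2' where
    2: "\<And>z. z \<in> S \<Longrightarrow> wirtinger u' (p' z) (q' z) z" "\<And>z. z \<in> S \<Longrightarrow> wirtinger p' (p1' z) (s' z) z"
       "\<And>z. z \<in> S \<Longrightarrow> wirtinger q' (s' z) (q2' z) z" "continuous_on S p1'" "continuous_on S s'" "continuous_on S q2'"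
    unfolding C2w_def by blast
  show ?thesis unfolding C2w_def
  proof (rule exI[of _ "\<lambda>z. p1 z * u' z + 2 * p z * p' z + u z * p1' z"],
      rule exI[of _ "\<lambda>z. q2 z * u' z + 2 * q z * q' z + u z * q2' z"], intro conjI ballI)
    fix z assume z: "z \<in> S"
    show "wirtinger (\<lambda>z. u z * u' z) (p z * u' z + u z * p' z) (q z * u' z + u z * q' z) z"
      using z by (intro wirtinger_mult 1 2)
    show "wirtinger (\<lambda>z. p z * u' z + u z * p' z) (p1 z * u' z + 2 * p z * p' z + u z * p1' z)
        (s z * u' z + p z * q' z + q z * p' z + u z * s' z) z"
      by (rule wirtinger_cong[OF wirtinger_add[OF wirtinger_mult[OF 1(2) 2(1)] wirtinger_mult[OF 1(1) 2(2)]]]) 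
         (use z in \<open>auto simp: algebra_simps\<close>)
    show "wirtinger (\<lambda>z. q z * u' z + u z * q' z) (s z * u' z + p z * q' z + q z * p' z + u z * s' z)
        (q2 z * u' z + 2 * q z * q' z + u z * q2' z) z"
      by (rule wirtinger_cong[OF wirtinger_add[OF wirtinger_mult[OF 1(3) 2(1)] wirtinger_mult[OF 1(1) 2(3)]]]) 
         (use z in \<open>auto simp: algebra_simps\<close>)
  qed (intro continuous_intros 1 2 c)+
qed

lemma C2w_const: "C2w S (\<lambda>_. c) (\<lambda>_. 0) (\<lambda>_. 0) (\<lambda>_. 0)"
  unfolding C2w_def by (intro exI[of _ "\<lambda>_. 0"]) simp

lemma C2w_ident: "C2w S (\<lambda>z. z) (\<lambda>_. 1) (\<lambda>_. 0) (\<lambda>_. 0)"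
  unfolding C2w_def by (intro exI[of _ "\<lambda>_. 0"]) (simp add: wirtinger_ident)

lemma C2w_cnj_ident: "C2w S cnj (\<lambda>_. 0) (\<lambda>_. 1) (\<lambda>_. 0)"
  unfolding C2w_def using wirtinger_cnj[OF wirtinger_ident] by (intro exI[of _ "\<lambda>_. 0"]) simp

lemma C2w_holomorphic:
  assumes "f holomorphic_on S" "open S"
  shows "C2w S f (deriv f) (\<lambda>_. 0) (\<lambda>_. 0)"
proof -
  have "deriv f holomorphic_on S" using assms by (rule holomorphic_deriv)
  moreover from this have "deriv (deriv f) holomorphic_on S" using assms by (intro holomorphic_deriv)
  ultimately have *: "(\<forall>z\<in>S. wirtinger f (deriv f z) 0 z \<and> wirtinger (deriv f) (deriv (deriv f) z) 0 z \<and> wirtinger (\<lambda>_. 0) 0 0 z) \<and>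
      continuous_on S (deriv (deriv f)) \<and> continuous_on S (\<lambda>_. 0::complex) \<and> continuous_on S (\<lambda>_. 0::complex)"
    using assms by (auto intro!: wirtinger_field_derivative holomorphic_derivI holomorphic_on_imp_continuous_on)
  show ?thesis unfolding C2w_def
    by (rule exI[of _ "deriv (deriv f)"], rule exI[of _ "\<lambda>_. 0"]) (rule *)
qed

text \<open>The derivatives of \<open>cnj (p z)\<close> are \<open>cnj (s z)\<close> and
  \<open>cnj (p1 z)\<close>. Reality of \<open>s\<close> turns the first into \<open>s\<close>
  itself, which is the equality of the two mixed derivatives demanded by \<open>C2w\<close>.\<close>

lemma C2r_imp_C2w:
  assumes "C2r S u p s" "\<And>z. z \<in> S \<Longrightarrow> s z \<in> \<real>"
  shows "C2w S (\<lambda>z. of_real (u z)) p (\<lambda>z. cnj (p z)) s"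
proof -
  from assms(1) obtain p1 where
    1: "\<And>z. z \<in> S \<Longrightarrow> wirtinger (\<lambda>z. of_real (u z)) (p z) (cnj (p z)) z" "\<And>z. z \<in> S \<Longrightarrow> wirtinger p (p1 z) (s z) z"
       "continuous_on S p1" "continuous_on S s"
    unfolding C2r_def by blast
  have "wirtinger (\<lambda>z. cnj (p z)) (s z) (cnj (p1 z)) z" if "z \<in> S" for z
    using wirtinger_cnj[OF 1(2)[OF that]] assms(2)[OF that] by (simp add: Reals_cnj_iff)
  note 2 = this
  show ?thesis unfolding C2w_def
    by (rule exI[of _ p1], rule exI[of _ "\<lambda>z. cnj (p1 z)"]) (auto intro!: continuous_intros 1 2)
qed

lemma C2r_add:
  assumes "C2r S u p s" "C2r S u' p' s'"
  shows "C2r S (\<lambda>z. u z + u' z) (\<lambda>z. p z + p' z) (\<lambda>z. s z + s' z)"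
proof -
  from assms(1) obtain p1 where
    1: "\<And>z. z \<in> S \<Longrightarrow> wirtinger (\<lambda>z. of_real (u z)) (p z) (cnj (p z)) z" "\<And>z. z \<in> S \<Longrightarrow> wirtinger p (p1 z) (s z) z"
       "continuous_on S p1" "continuous_on S s"
    unfolding C2r_def by blast
  from assms(2) obtain p1' where
    2: "\<And>z. z \<in> S \<Longrightarrow> wirtinger (\<lambda>z. of_real (u' z)) (p' z) (cnj (p' z)) z" "\<And>z. z \<in> S \<Longrightarrow> wirtinger p' (p1' z) (s' z) z"
       "continuous_on S p1'" "continuous_on S s'"
    unfolding C2r_def by blast
  show ?thesis unfolding C2r_def of_real_add complex_cnj_add
    by (intro exI[of _ "\<lambda>z. p1 z + p1' z"] conjI ballI)
       (auto intro!: wirtinger_add 1 2 continuous_intros)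
qed

lemma C2r_cmult:
  assumes "C2r S u p s"
  shows "C2r S (\<lambda>z. c * u z) (\<lambda>z. of_real c * p z) (\<lambda>z. of_real c * s z)"
proof -
  from assms(1) obtain p1 where
    1: "\<And>z. z \<in> S \<Longrightarrow> wirtinger (\<lambda>z. of_real (u z)) (p z) (cnj (p z)) z" "\<And>z. z \<in> S \<Longrightarrow> wirtinger p (p1 z) (s z) z"
       "continuous_on S p1" "continuous_on S s"
    unfolding C2r_def by blast
  show ?thesis unfolding C2r_def of_real_mult
    by (intro exI[of _ "\<lambda>z. of_real c * p1 z"] conjI ballI)
       (auto intro!: 1 continuous_intros wirtinger_cong[OF wirtinger_mult[OF wirtinger_const 1(1)]] 
          wirtinger_cong[OF wirtinger_mult[OF wirtinger_const 1(2)]])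
qed

lemma C2r_norm_square: "C2r S (\<lambda>z. (cmod z)\<^sup>2) cnj (\<lambda>_. 1)"
  unfolding C2r_def 
  by (intro exI[of _ "\<lambda>_. 0"]) (use wirtinger_norm_square wirtinger_cnj[OF wirtinger_ident] in auto)

text \<open>The main use is \<open>u z = (cmod z)^2\<close>: with \<open>t\<close> denoting this
  square, the mixed derivative of a radial function becomes \<open>f2 t * t + f1 t\<close>.\<close>

lemma C2r_compose:
  fixes f f1 f2 :: "real \<Rightarrow> real"
  assumes u: "C2r S u p s"
    and f: "\<And>z. z \<in> S \<Longrightarrow> (f has_real_derivative f1 (u z)) (at (u z))"
      "\<And>z. z \<in> S \<Longrightarrow> (f1 has_real_derivative f2 (u z)) (at (u z))"
      "continuous_on (u ` S) f2"
  shows "C2r S (\<lambda>z. f (u z)) (\<lambda>z. of_real (f1 (u z)) * p z)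
    (\<lambda>z. of_real (f2 (u z) * (cmod (p z))^2) + of_real (f1 (u z)) * s z)"
proof -
  from u obtain p1 where
    1: "\<And>z. z \<in> S \<Longrightarrow> wirtinger (\<lambda>z. of_real (u z)) (p z) (cnj (p z)) z" "\<And>z. z \<in> S \<Longrightarrow> wirtinger p (p1 z) (s z) z"
       "continuous_on S p1" "continuous_on S s"
    unfolding C2r_def by blast
  note c = C2r_continuous_on[OF u]
  have d2: "wirtinger (\<lambda>z. of_real (f1 (u z))) (of_real (f2 (u z)) * p z) (of_real (f2 (u z)) * cnj (p z)) z"
    if "z \<in> S" for z
    using wirtinger_compose_real[OF 1(1)[OF that] f(2)[OF that]] .
  have c1: "continuous_on S (\<lambda>z. complex_of_real (f1 (u z)))"
    by (rule wirtinger_continuous_on[OF d2])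
  have c2: "continuous_on S (\<lambda>z. f2 (u z))"
    by (rule continuous_on_compose2[OF f(3) c(1)]) auto
  show ?thesis unfolding C2r_def
  proof (intro exI[of _ "\<lambda>z. of_real (f2 (u z)) * p z * p z + of_real (f1 (u z)) * p1 z"] conjI ballI)
    fix z assume z: "z \<in> S"
    show "wirtinger (\<lambda>z. of_real (f (u z))) (of_real (f1 (u z)) * p z) (cnj (of_real (f1 (u z)) * p z)) z"
      using wirtinger_compose_real[OF 1(1)[OF z] f(1)[OF z]] by simp
    show "wirtinger (\<lambda>z. of_real (f1 (u z)) * p z) (of_real (f2 (u z)) * p z * p z + of_real (f1 (u z)) * p1 z)
       (of_real (f2 (u z) * (cmod (p z))^2) + of_real (f1 (u z)) * s z) z"
      by (rule wirtinger_cong[OF wirtinger_mult[OF d2 1(2)]])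
         (use z in \<open>auto simp: complex_norm_square[unfolded of_real_power] algebra_simps\<close>)
  qed (intro continuous_intros 1 c c1 c2)+
qed

section \<open>The twisted Bochner-Kodaira identity\<close>

text \<open>With \<open>w = exp \<Phi>\<close> and \<open>D = p + b * P\<close>, integrate the divergence
  \<open>\<partial>(k * cnj b * q * w) - \<partial>\<close>-bar\<open> (k * cnj b * D * w) + \<partial>(cnj R * |b|\<^sup>2 * w)\<close>; the mixed derivatives of \<open>b\<close> cancel.\<close>
lemma twisted_identity:
  assumes S: "open S" and b: "C2w S b p q s" and \<Phi>: "C2r S \<Phi> P \<sigma>" and k: "C2r S k R \<kappa>"
    and K: "compact K" "K \<subseteq> S" and supp: "(\<forall>z\<in>S - K. b z = 0) \<or> (\<forall>z\<in>S - K. k z = 0)"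
  shows "(LINT z|lborel. indicator K z * (exp (\<Phi> z) *
     (k z * ((cmod (q z))^2 - (cmod (p z + b z * P z))^2 - (cmod (b z))^2 * Re (\<sigma> z))
      + Re (\<kappa> z) * (cmod (b z))^2 + 2 * Re (R z * cnj (b z) * q z)))) = 0"
    (is "(LINT z|lborel. indicator K z * ?g z) = 0")
proof -
  from b obtain p1 q2 where
    b1: "\<And>z. z \<in> S \<Longrightarrow> wirtinger b (p z) (q z) z" "\<And>z. z \<in> S \<Longrightarrow> wirtinger p (p1 z) (s z) z"
       "\<And>z. z \<in> S \<Longrightarrow> wirtinger q (s z) (q2 z) z" "continuous_on S p1" "continuous_on S s" "continuous_on S q2"
    unfolding C2w_def by blast
  from \<Phi> obtain P1 where
    P1: "\<And>z. z \<in> S \<Longrightarrow> wirtinger (\<lambda>z. of_real (\<Phi> z)) (P z) (cnj (P z)) z" "\<And>z. z \<in> S \<Longrightarrow> wirtinger P (P1 z) (\<sigma> z) z"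
       "continuous_on S P1" "continuous_on S \<sigma>"
    unfolding C2r_def by blast
  from k obtain R1 where
    R1: "\<And>z. z \<in> S \<Longrightarrow> wirtinger (\<lambda>z. of_real (k z)) (R z) (cnj (R z)) z" "\<And>z. z \<in> S \<Longrightarrow> wirtinger R (R1 z) (\<kappa> z) z"
       "continuous_on S R1" "continuous_on S \<kappa>"
    unfolding C2r_def by blast
  \<comment> \<open>The third vector field contains the derivative of \<open>k\<close> but not
    \<open>k\<close>, so its support is controlled through \<open>R\<close>.\<close>
  have R0: "R z = 0" if "z \<in> S - K" "\<forall>z\<in>S - K. k z = 0" for z
  proof -
    have "wirtinger (\<lambda>_. 0) (R z) (cnj (R z)) z"
      by (rule wirtinger_transform_open[OF R1(1), of z "S - K"])
         (use that K S in \<open>auto intro: open_Diff compact_imp_closed\<close>)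
    from wirtinger_unique[OF this wirtinger_const] show ?thesis by simp
  qed
  define w where "w z = complex_of_real (exp (\<Phi> z))" for z
  define kk where "kk z = complex_of_real (k z)" for z
  have w: "wirtinger w (w z * P z) (w z * cnj (P z)) z" if "z \<in> S" for z
    unfolding w_def by (rule wirtinger_compose_real[OF P1(1)[OF that]]) (auto intro!: derivative_eq_intros)
  have kk: "wirtinger kk (R z) (cnj (R z)) z" if "z \<in> S" for z
    unfolding kk_def using R1(1)[OF that] .
  note cb = C2w_continuous_on[OF b] 
  note c = C2r_continuous_on(2)[OF \<Phi>] C2r_continuous_on(1,2)[OF k]
  have cw: "continuous_on S w" "continuous_on S kk"
    using wirtinger_continuous_on[OF w] wirtinger_continuous_on[OF kk] by auto
  note cont = cb c cw b1(4-6) P1(3,4) R1(3,4)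
  define D where "D z = p z + b z * P z" for z
  define E1 where "E1 z = kk z * cnj (b z) * q z * w z" for z
  define E2 where "E2 z = kk z * cnj (b z) * D z * w z" for z
  define E3 where "E3 z = cnj (R z) * b z * cnj (b z) * w z" for z
  define F1 where "F1 z = ((R z * cnj (b z) + kk z * cnj (q z)) * q z + kk z * cnj (b z) * s z) * w z + 
     kk z * cnj (b z) * q z * (w z * P z)" for z
  define F2 where "F2 z = ((cnj (R z) * cnj (b z) + kk z * cnj (p z)) * D z + kk z * cnj (b z) * 
     (s z + (q z * P z + b z * \<sigma> z))) * w z + kk z * cnj (b z) * D z * (w z * cnj (P z))" for z
  define F3 where "F3 z = ((cnj (\<kappa> z) * b z + cnj (R z) * p z) * cnj (b z) + cnj (R z) * b z * cnj (q z)) * w z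
     + cnj (R z) * b z * cnj (b z) * (w z * P z)" for z
  have i1: "(LINT z|lborel. indicator K z * F1 z) = 0"
  proof (rule integral_wirtinger_on_eq_0(1)[OF _ S])
    fix z assume z: "z \<in> S"
    show "wirtinger E1 (F1 z) (((cnj (R z) * cnj (b z) + kk z * cnj (p z)) * q z + kk z * cnj (b z) * q2 z) * w z + 
       kk z * cnj (b z) * q z * (w z * cnj (P z))) z"
      unfolding E1_def F1_def using z by (intro wirtinger_mult kk wirtinger_cnj b1 w)
  qed (use K supp in \<open>auto simp: F1_def E1_def kk_def intro!: continuous_intros cont\<close>)
  have i2: "(LINT z|lborel. indicator K z * F2 z) = 0"
  proof (rule integral_wirtinger_on_eq_0(2)[OF _ S])
    fix z assume z: "z \<in> S"
    show "wirtinger E2 (((R z * cnj (b z) + kk z * cnj (q z)) * D z + kk z * cnj (b z) * 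
      (p1 z + (p z * P z + b z * P1 z))) * w z + kk z * cnj (b z) * D z * (w z * P z)) (F2 z) z"
      unfolding E2_def F2_def D_def using z by (intro wirtinger_mult wirtinger_add kk wirtinger_cnj b1 w P1)
  qed (use K supp in \<open>auto simp: F2_def D_def E2_def kk_def intro!: continuous_intros cont\<close>)
  have i3: "(LINT z|lborel. indicator K z * F3 z) = 0"
  proof (rule integral_wirtinger_on_eq_0(1)[OF _ S])
    fix z assume z: "z \<in> S"
    show "wirtinger E3 (F3 z) (((cnj (R1 z) * b z + cnj (R z) * q z) * cnj (b z) + cnj (R z) * b z * cnj (p z)) * w z
     + cnj (R z) * b z * cnj (b z) * (w z * cnj (P z))) z"
      unfolding E3_def F3_def using z by (intro wirtinger_mult kk wirtinger_cnj b1 w R1)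
  qed (use K supp R0 in \<open>auto simp: F3_def E3_def intro!: continuous_intros cont\<close>)
  have int: "integrable lborel (\<lambda>z. indicator K z * F z)" 
    if "continuous_on S F" for F :: "complex \<Rightarrow> complex"
  proof -
    have "integrable lborel (\<lambda>z. indicator K z *\<^sub>R F z)"
      using K that by (intro borel_integrable_compact) (auto intro: continuous_on_subset)
    moreover have "(\<lambda>z. indicator K z *\<^sub>R F z) = (\<lambda>z. indicator K z * F z)"
      by (auto simp: fun_eq_iff indicator_def)
    ultimately show ?thesis by simp
  qed
  have cF: "continuous_on S F1" "continuous_on S F2" "continuous_on S F3"
    unfolding F1_def[abs_def] F2_def[abs_def] F3_def[abs_def] D_def by (intro continuous_intros cont)+
  have "(LINT z|lborel. indicator K z * F1 z - indicator K z * F2 z + indicator K z * F3 z) = 0"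
    using i1 i2 i3 cF[THEN int] by simp
  then have "(LINT z|lborel. Re (indicator K z * F1 z - indicator K z * F2 z + indicator K z * F3 z)) = 0"
    using cF[THEN int] by (subst integral_Re) auto
  moreover have "Re (indicator K z * F1 z - indicator K z * F2 z + indicator K z * F3 z) = indicator K z * ?g z" for z
  proof -
    have "F1 z - F2 z + F3 z = w z * (kk z * (q z * cnj (q z) - D z * cnj (D z) - b z * cnj (b z) * \<sigma> z) + 
      cnj (\<kappa> z) * (b z * cnj (b z)) + (R z * cnj (b z) * q z + cnj (R z * cnj (b z) * q z)))"
      unfolding F1_def F2_def F3_def D_def by (simp add: algebra_simps)
    also have "\<dots> = of_real (exp (\<Phi> z)) * (of_real (k z) * (of_real ((cmod (q z))^2) - of_real ((cmod (D z))^2) - of_real ((cmod (b z))^2) * \<sigma> z) + 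
      cnj (\<kappa> z) * of_real ((cmod (b z))^2) + of_real (2 * Re (R z * cnj (b z) * q z)))"
      unfolding complex_norm_square w_def kk_def complex_add_cnj by simp
    finally have *: "Re (F1 z - F2 z + F3 z) = ?g z"
      by (simp add: D_def)
    show ?thesis using * by (cases "z \<in> K") (auto simp: indicator_def)
  qed
  ultimately show ?thesis by simp
qed

section \<open>Point estimates\<close>

lemma has_real_derivative_0_squeeze:
  fixes f F :: "real \<Rightarrow> real"
  assumes "(F has_real_derivative 0) (at a)" "\<And>y. \<bar>f y - f a\<bar> \<le> \<bar>F y - F a\<bar>"
  shows "(f has_real_derivative 0) (at a)"
proof -
  have "((\<lambda>y. (F y - F a) / (y - a)) \<longlongrightarrow> 0) (at a)"
    using assms(1) by (simp add: has_field_derivative_iff)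
  then have *: "((\<lambda>y. \<bar>(F y - F a) / (y - a)\<bar>) \<longlongrightarrow> 0) (at a)"
    by (rule tendsto_rabs_zero)
  have "((\<lambda>y. (f y - f a) / (y - a)) \<longlongrightarrow> 0) (at a)"
    by (rule Lim_null_comparison[OF _ *]) (use assms(2) in \<open>auto simp: divide_right_mono\<close>)
  then show ?thesis by (simp add: has_field_derivative_iff)
qed

text \<open>At the cut both \<open>F\<close> and its derivative vanish, so the truncated function is
  squeezed by \<open>F\<close> and has derivative zero there. Applied repeatedly, this makes
  truncations as smooth as the order of the zero permits.\<close>

lemma has_real_derivative_cut:
  fixes F F' :: "real \<Rightarrow> real"
  assumes "x \<le> a \<Longrightarrow> (F has_real_derivative F' x) (at x)" "F a = 0" "F' a = 0"
  shows "((\<lambda>x. if x < a then F x else 0) has_real_derivative (if x < a then F' x else 0)) (at x)"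
proof (cases x a rule: linorder_cases)
  case less
  have "((\<lambda>x. if x < a then F x else 0) has_real_derivative F' x) (at x)"
    by (rule has_field_derivative_transform_within_open[where S = "{..<a}" and f = F])
       (use assms less in auto)
  then show ?thesis using less by simp
next
  case equal
  have "((\<lambda>x. if x < a then F x else 0) has_real_derivative 0) (at x)"
    by (rule has_real_derivative_0_squeeze[of F]) (use assms equal in auto)
  then show ?thesis using equal by simp
next
  case greater
  have "((\<lambda>x. if x < a then F x else 0) has_real_derivative 0) (at x)"
    by (rule has_field_derivative_transform_within_open[where S = "{a<..}" and f = "\<lambda>_. 0"])
       (use greater in auto)
  then show ?thesis using greater by simp
qed

lemma has_real_derivative_max_0_power:
  assumes "n \<ge> 1"
  shows "((\<lambda>x. max 0 x ^ Suc n) has_real_derivative real (Suc n) * max 0 x ^ n) (at x)"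
proof (cases x "0::real" rule: linorder_cases)
  case less
  have "((\<lambda>x. max 0 x ^ Suc n) has_real_derivative 0) (at x)"
    by (rule has_field_derivative_transform_within_open[where S = "{..<0}" and f = "\<lambda>_. 0"])
       (use less in auto)
  then show ?thesis using less assms by (cases n) auto
next
  case equal
  have "((\<lambda>x. max 0 x ^ Suc n) has_real_derivative 0) (at 0)"
    by (rule has_real_derivative_0_squeeze[of "\<lambda>x. x ^ Suc n"])
       (use assms in \<open>auto intro!: derivative_eq_intros simp: abs_mult power_abs max_def intro!: mult_nonpos_nonneg\<close>)
  then show ?thesis using equal assms by (cases n) auto
next
  case greater
  have "((\<lambda>x. max 0 x ^ Suc n) has_real_derivative real (Suc n) * x ^ n) (at x)"
    by (rule has_field_derivative_transform_within_open[where S = "{0<..}" and f = "\<lambda>x. x ^ Suc n"])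
       (use greater in \<open>auto intro!: derivative_eq_intros simp del: power_Suc\<close>)
  then show ?thesis using greater by simp
qed

lemma measure_ball_complex: "r \<ge> 0 \<Longrightarrow> measure lborel (ball (z::complex) r) = pi * r^2"
  by (simp add: content_ball unit_ball_vol_2)

text \<open>The kernel \<open>\<epsilon> / (\<epsilon> + (cmod z)^2)^2\<close> has mass
  \<open>pi\<close> and concentrates at the origin. Only the disc of radius
  \<open>sqrt \<epsilon>\<close> is kept, where the kernel is at least
  \<open>1 / (4 * \<epsilon>)\<close>; this gives \<open>pi / 4\<close> instead of \<open>pi\<close>
  and avoids computing a limit of integrals.\<close>

lemma value_le_of_concentrating_integrals:
  fixes v :: "complex \<Rightarrow> real"
  assumes v: "\<And>z. v z \<ge> 0" "isCont v 0" and "e > 0"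
    and int: "\<And>\<epsilon>. 0 < \<epsilon> \<Longrightarrow> \<epsilon> < e \<Longrightarrow> integrable lborel (\<lambda>z. v z * (\<epsilon> / (\<epsilon> + (cmod z)^2)^2))"
    and le: "\<And>\<epsilon>. 0 < \<epsilon> \<Longrightarrow> \<epsilon> < e \<Longrightarrow> (LINT z|lborel. v z * (\<epsilon> / (\<epsilon> + (cmod z)^2)^2)) \<le> X"
  shows "pi / 4 * v 0 \<le> X"
proof (rule field_le_epsilon)
  fix \<eta> :: real assume \<eta>: "\<eta> > 0"
  obtain d where d: "d > 0" "\<And>z. cmod z < d \<Longrightarrow> \<bar>v z - v 0\<bar> < \<eta>"
    using v(2) \<eta> unfolding continuous_at_eps_delta by (fastforce simp: dist_norm)
  define \<epsilon> where "\<epsilon> = min (d^2) (e / 2)"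
  have \<epsilon>: "0 < \<epsilon>" "\<epsilon> < e" "\<epsilon> \<le> d^2" using d \<open>e > 0\<close> by (auto simp: \<epsilon>_def)
  define Bl where "Bl = ball (0::complex) (sqrt \<epsilon>)"
  have "pi / 4 * (v 0 - \<eta>) = (LINT z|lborel. indicator Bl z * ((v 0 - \<eta>) / (4 * \<epsilon>)))"
    using \<epsilon> by (simp add: Bl_def measure_ball_complex)
  also have "\<dots> \<le> (LINT z|lborel. v z * (\<epsilon> / (\<epsilon> + (cmod z)^2)^2))"
  proof (rule integral_mono)
    show "integrable lborel (\<lambda>z. indicator Bl z * ((v 0 - \<eta>) / (4 * \<epsilon>)))"
      by (intro integrable_mult_left integrable_real_indicator)
         (auto simp: Bl_def intro!: emeasure_bounded_finite[unfolded infinity_ennreal_def])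
    fix z :: complex
    show "indicator Bl z * ((v 0 - \<eta>) / (4 * \<epsilon>)) \<le> v z * (\<epsilon> / (\<epsilon> + (cmod z)^2)^2)"
    proof (cases "z \<in> Bl")
      case True
      then have *: "cmod z < sqrt \<epsilon>" by (simp add: Bl_def)
      then have t: "(cmod z)^2 \<le> \<epsilon>"
        using \<epsilon> by (metis less_eq_real_def norm_ge_zero real_le_rsqrt real_sqrt_le_iff real_sqrt_abs abs_norm_cancel)
      have "sqrt \<epsilon> \<le> d" using \<epsilon> d by (simp add: real_le_lsqrt)
      then have "v 0 - \<eta> \<le> v z" using d(2)[of z] * by (simp add: abs_if split: if_splits)
      have "1 / (4 * \<epsilon>) = \<epsilon> / (\<epsilon> + \<epsilon>)^2" using \<epsilon> by (simp add: field_simps power2_eq_square)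
      also have "\<dots> \<le> \<epsilon> / (\<epsilon> + (cmod z)^2)^2"
        using \<epsilon> t by (intro divide_left_mono power_mono mult_pos_pos zero_less_power add_pos_nonneg) auto
      finally have "1 / (4 * \<epsilon>) \<le> \<epsilon> / (\<epsilon> + (cmod z)^2)^2" .
      then have "v z * (1 / (4 * \<epsilon>)) \<le> v z * (\<epsilon> / (\<epsilon> + (cmod z)^2)^2)"
        using v by (intro mult_left_mono)
      moreover have "(v 0 - \<eta>) * (1 / (4 * \<epsilon>)) \<le> v z * (1 / (4 * \<epsilon>))"
        using \<open>v 0 - \<eta> \<le> v z\<close> \<epsilon> by (intro mult_right_mono) auto
      ultimately show ?thesis using True by simp
    next
      case False
      then show ?thesis using v \<epsilon> by simp
    qed
  qed (use int \<epsilon> in auto)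
  also have "\<dots> \<le> X" using le \<epsilon> by auto
  finally have "pi / 4 * v 0 \<le> X + pi / 4 * \<eta>" by (simp add: algebra_simps)
  also have "pi / 4 * \<eta> \<le> \<eta>" using pi_less_4 \<eta> by (simp add: field_simps)
  finally show "pi / 4 * v 0 \<le> X + \<eta>" by simp
qed

lemma integrable_indicator_mult:
  fixes f :: "complex \<Rightarrow> real"
  assumes "continuous_on K f" "compact K"
  shows "integrable lborel (\<lambda>z. indicator K z * f z)"
  using borel_integrable_compact[OF assms(2,1)] by simp

lemma integrable_concentrating:
  fixes u :: "complex \<Rightarrow> real"
  assumes "continuous_on K u" "compact K" "\<epsilon> > 0"
  shows "integrable lborel (\<lambda>z. indicator K z * u z * (\<epsilon> / (\<epsilon> + (cmod z)^2)^2))"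
proof -
  have "\<epsilon> + (cmod z)^2 > 0" for z :: complex
    using assms(3) by (simp add: add_pos_nonneg)
  then have "\<epsilon> + (cmod z)^2 \<noteq> 0" for z by (metis less_irrefl)
  then show ?thesis unfolding mult.assoc
    using assms by (intro integrable_indicator_mult continuous_intros) auto
qed

text \<open>Adding \<open>2 * \<bar>M\<bar> * (cmod z)^2\<close> to \<open>- 2 * \<psi>\<close>
  makes the exponent subharmonic on the disc, at the price of the factor
  \<open>exp (2 * \<bar>M\<bar> * \<delta>^2)\<close>. For holomorphic \<open>f\<close> the dbar
  derivative in the twisted identity is zero, so every term carrying \<open>k\<close> is nonpositive
  and the integral of \<open>Re (\<kappa> z) * (cmod (f z))^2\<close> against the weight is
  nonnegative. The negative concentrating part of \<open>\<kappa>\<close> then yields the value at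
  the origin, its bounded part the area integral.\<close>

lemma weighted_mean_value:
  assumes S: "open S" "cball 0 \<delta> \<subseteq> S" and \<delta>: "\<delta> > 0" and f: "f holomorphic_on S"
    and \<psi>: "C2r S \<psi> P \<sigma>" and M: "\<And>z. z \<in> cball 0 \<delta> \<Longrightarrow> Re (\<sigma> z) \<le> M" 
  shows "pi / 8 * ((cmod (f 0))^2 * exp (- 2 * \<psi> 0)) \<le> 2 / \<delta>^2 * exp (2 * \<bar>M\<bar> * \<delta>^2) *
     (LINT z|lborel. indicator (cball 0 \<delta>) z * ((cmod (f z))^2 * exp (- 2 * \<psi> z)))"
proof -
  define K where "K = cball (0::complex) \<delta>"
  have K: "compact K" "K \<subseteq> S" using S by (auto simp: K_def)
  define \<Phi> where "\<Phi> z = -2 * \<psi> z + 2 * \<bar>M\<bar> * (cmod z)^2" for z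
  define P' where "P' z = of_real (- 2) * P z + of_real (2 * \<bar>M\<bar>) * cnj z" for z
  define \<sigma>' where "\<sigma>' z = of_real (- 2) * \<sigma> z + of_real (2 * \<bar>M\<bar>) * 1" for z
  have \<Phi>: "C2r S \<Phi> P' \<sigma>'"
    unfolding \<Phi>_def P'_def \<sigma>'_def by (intro C2r_add C2r_cmult \<psi> C2r_norm_square)
  have c\<Phi>: "continuous_on S \<Phi>" by (rule C2r_continuous_on[OF \<Phi>])
  have cf: "continuous_on S f" using f by (rule holomorphic_on_imp_continuous_on)
  define J where "J = (LINT z|lborel. indicator K z * ((cmod (f z))^2 * exp (\<Phi> z)))"
  have intJ: "integrable lborel (\<lambda>z. indicator K z * ((cmod (f z))^2 * exp (\<Phi> z)))"
    using K by (intro integrable_indicator_mult continuous_intros continuous_on_subset[OF cf] continuous_on_subset[OF c\<Phi>])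
  \<comment> \<open>The last factor is a lower bound for the coefficient of the concentrating kernel
    in the Laplacian of \<open>k\<close>. Its value 1/2 at the origin is the reason for
    \<open>pi / 8\<close>.\<close>
  define v where "v z = indicator K z * ((cmod (f z))^2 * exp (\<Phi> z) * ((\<delta>^2 - (cmod z)^2) / (2 * \<delta>^2)))" for z
  have intv: "integrable lborel (\<lambda>z. v z * (e / (e + (cmod z)^2)^2))" if "e > 0" for e
    unfolding v_def using \<delta> K
    by (intro integrable_concentrating[OF _ _ that] continuous_intros continuous_on_subset[OF cf] continuous_on_subset[OF c\<Phi>]) auto
  have main: "(LINT z|lborel. v z * (e / (e + (cmod z)^2)^2)) \<le> 2 / \<delta>^2 * J" if e: "0 < e" "e < \<delta>\<^sup>2" for e
  proof -
    define y where "y = \<delta>^2 + e"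
    have y: "y > 0" using e \<delta> by (simp add: y_def add_pos_pos)
    \<comment> \<open>This is the tail, from the cubic term on, of the expansion of
      \<open>- ln x\<close> in powers of \<open>1 - x\<close>. The cubic zero at
      \<open>x = 1\<close> keeps the truncation twice continuously differentiable.\<close>
    define h where "h x = (if x < 1 then - ln x - (1 - x) - (1 - x)^2 / 2 else 0)" for x :: real
    define h1 where "h1 x = (if x < 1 then - ((1 - x)^2 / x) else 0)" for x :: real
    define h2 where "h2 x = (if x < 1 then (1 - x) * (1 + x) / x^2 else 0)" for x :: real
    have h1: "(h has_real_derivative h1 x) (at x)" if "x > 0" for x
      unfolding h_def[abs_def] h1_def
    proof (rule has_real_derivative_cut)
      show "((\<lambda>x. - ln x - (1 - x) - (1 - x)^2 / 2) has_real_derivative - ((1 - x)^2 / x)) (at x)"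
        using that by (auto intro!: derivative_eq_intros simp: field_simps power2_eq_square)
    qed auto
    have h2: "(h1 has_real_derivative h2 x) (at x)" if "x > 0" for x
      unfolding h1_def[abs_def] h2_def
    proof (rule has_real_derivative_cut)
      show "((\<lambda>x. - ((1 - x)^2 / x)) has_real_derivative ((1 - x) * (1 + x) / x^2)) (at x)"
        using that by (auto intro!: derivative_eq_intros simp: field_simps power2_eq_square)
    qed auto
    have h2': "h2 x = max 0 (1 - x) * (1 + x) / x^2" for x
      by (auto simp: h2_def)
    have h_nonneg: "h x \<ge> 0" if "x > 0" for x
    proof (cases "x < 1")
      case True
      have "h 1 \<le> h x"
      proof (rule DERIV_nonpos_imp_nonincreasing[of x 1 h])
        fix t assume "x \<le> t" "t \<le> 1"
        moreover from this that have "h1 t \<le> 0" by (simp add: h1_def)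
        ultimately show "\<exists>d. (h has_real_derivative d) (at t) \<and> d \<le> 0"
          using h1[of t] that by fastforce
      qed (use True in simp)
      then show ?thesis by (simp add: h_def)
    qed (simp add: h_def)
    \<comment> \<open>Division by \<open>y\<close> places the zero of the profile at
      \<open>cmod z = \<delta>\<close>; the shift by \<open>e\<close> regularises the logarithmic
      pole at the origin.\<close>
    define xx where "xx t = (t + e) / y" for t
    define g where "g t = h (xx t)" for t
    define g1 where "g1 t = h1 (xx t) / y" for t
    define g2 where "g2 t = h2 (xx t) / y^2" for t
    have xx: "xx t > 0" if "t \<ge> 0" for t using that e y by (simp add: xx_def)
    have dxx: "(xx has_real_derivative 1 / y) (at t)" for t
      unfolding xx_def[abs_def] using y by (auto intro!: derivative_eq_intros)
    have g1: "(g has_real_derivative g1 t) (at t)" if "t \<ge> 0" for t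
      unfolding g_def[abs_def] g1_def using DERIV_chain2[OF h1[OF xx[OF that]] dxx] by simp
    have g2: "(g1 has_real_derivative g2 t) (at t)" if "t \<ge> 0" for t
      unfolding g1_def[abs_def] g2_def using DERIV_cdivide[OF DERIV_chain2[OF h2[OF xx[OF that]] dxx], of y] y
      by (simp add: power2_eq_square divide_divide_eq_left')
    have g2c: "continuous_on {0..} g2"
      unfolding g2_def[abs_def] h2' xx_def by (intro continuous_intros) (use e y in auto)
    define k where "k z = g ((cmod z)^2)" for z :: complex
    define R where "R z = of_real (g1 ((cmod z)^2)) * cnj z" for z
    define \<kappa> where "\<kappa> z = complex_of_real (g2 ((cmod z)^2) * (cmod (cnj z))^2) + of_real (g1 ((cmod z)^2)) * 1" for z
    have k: "C2r S k R \<kappa>"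
      unfolding k_def R_def \<kappa>_def
      by (rule C2r_compose[OF C2r_norm_square]) (auto intro!: g1 g2 continuous_on_subset[OF g2c])
    define I where "I z = exp (\<Phi> z) * (k z * ((cmod (0::complex))^2 - 
        (cmod (deriv f z + f z * P' z))^2 - (cmod (f z))^2 * Re (\<sigma>' z)) +
        Re (\<kappa> z) * (cmod (f z))^2 + 2 * Re (R z * cnj (f z) * 0))" for z
    have I0: "(LINT z|lborel. indicator K z * I z) = 0"
      unfolding I_def
    proof (rule twisted_identity[OF S(1) C2w_holomorphic[OF f S(1)] \<Phi> k K])
      have "g ((cmod z)^2) = 0" if "z \<in> S - K" for z
      proof -
        have "\<delta> \<le> cmod z" using that by (simp add: K_def)
        then have "\<delta>\<^sup>2 \<le> (cmod z)\<^sup>2" using \<delta> by (intro power_mono) auto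
        then have "xx ((cmod z)^2) \<ge> 1" using y by (simp add: xx_def y_def)
        then show ?thesis by (simp add: g_def h_def)
      qed
      then show "(\<forall>z\<in>S - K. f z = 0) \<or> (\<forall>z\<in>S - K. k z = 0)" by (simp add: k_def)
    qed
    have cI: "continuous_on S I"
      unfolding I_def[abs_def]
      by (intro continuous_intros C2w_continuous_on[OF C2w_holomorphic[OF f S(1)]] C2r_continuous_on[OF \<Phi>] 
        C2r_continuous_on[OF k])
    have "(LINT z|lborel. v z * (e / (e + (cmod z)^2)^2)) = 
       (LINT z|lborel. v z * (e / (e + (cmod z)^2)^2)) + (LINT z|lborel. indicator K z * I z)"
      using I0 by simp
    also have "\<dots> = (LINT z|lborel. v z * (e / (e + (cmod z)^2)^2) + indicator K z * I z)"
      using K by (intro Bochner_Integration.integral_add[symmetric] intv integrable_indicator_mult continuous_on_subset[OF cI] e)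
    also have "\<dots> \<le> (LINT z|lborel. 2 / \<delta>^2 * (indicator K z * ((cmod (f z))^2 * exp (\<Phi> z))))"
    proof (rule integral_mono)
      show "integrable lborel (\<lambda>z. v z * (e / (e + (cmod z)^2)^2) + indicator K z * I z)"
        using K by (intro Bochner_Integration.integrable_add intv integrable_indicator_mult continuous_on_subset[OF cI] e)
      show "integrable lborel (\<lambda>z. 2 / \<delta>^2 * (indicator K z * ((cmod (f z))^2 * exp (\<Phi> z))))"
        using intJ by simp
      fix z :: complex
      show "v z * (e / (e + (cmod z)^2)^2) + indicator K z * I z \<le> 2 / \<delta>^2 * (indicator K z * ((cmod (f z))^2 * exp (\<Phi> z)))"
      proof (cases "z \<in> K")
        case True
        define t where "t = (cmod z)^2"
        have t: "0 \<le> t" "t \<le> \<delta>^2" using True \<delta> by (auto simp: t_def K_def intro: power_mono)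
        define W where "W = (cmod (f z))^2 * exp (\<Phi> z)"
        have W: "W \<ge> 0" by (simp add: W_def)
        have gn: "g t \<ge> 0" unfolding g_def using h_nonneg xx t by auto
        have "Re (\<sigma> z) \<le> \<bar>M\<bar>" using M[of z] True by (simp add: K_def)
        then have S0: "Re (\<sigma>' z) \<ge> 0" by (simp add: \<sigma>'_def)
        \<comment> \<open>The left side is a quarter of the Laplacian of \<open>k\<close>. The
          regularised pole contributes the concentrating kernel with negative sign, the truncation a
          bounded amount; \<open>e < \<delta>\<^sup>2\<close> enters through
          \<open>y \<le> 2 * \<delta>^2\<close>.\<close>
        have kap: "g2 t * t + g1 t \<le> 2 / \<delta>^2 - (\<delta>^2 - t) / (2 * \<delta>^2) * (e / (e + t)^2)"
        proof -
          define x where "x = xx t"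
          have x: "0 < x" "x \<le> 1" "t + e = x * y" using xx t y by (auto simp: x_def xx_def y_def)
          have te: "t + e > 0" using t e by simp
          have 1: "g2 t = (1 - x) * (1 + x) / (t + e)^2" "g1 t = - ((1 - x)^2 / (t + e))"
            using x by (auto simp: g2_def g1_def h2_def h1_def x_def[symmetric] power_mult_distrib)
          have 2: "g2 t * t + g1 t = (1 - x) * (- (e / (t + e)^2) + (2 * t + e) / (y * (t + e)))"
          proof -
            have "g2 t * t + g1 t = (1 - x) * (- e + x * (2 * t + e)) / (t + e)^2"
              unfolding 1 using te by (simp add: divide_simps) (simp add: power2_eq_square algebra_simps)
            also have "x * (2 * t + e) = (2 * t + e) * (t + e) / y" using x(3) y by (simp add: field_simps)
            finally have e1: "g2 t * t + g1 t = (1 - x) * ((- e + (2 * t + e) * (t + e) / y) / (t + e)^2)"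
              by simp
            have e2: "(- e + a * u / y) / u^2 = - (e / u^2) + a / (y * u)" if "u > 0" for a u :: real
              using that y by (simp add: field_simps power2_eq_square)
            show ?thesis unfolding e1 e2[OF te] ..
          qed
          have "(1 - x) * ((2 * t + e) / (y * (t + e))) \<le> 1 * (2 / \<delta>^2)"
          proof (rule mult_mono)
            have "(2 * t + e) / (y * (t + e)) \<le> (2 * (t + e)) / (y * (t + e))"
              using t e y te by (intro divide_right_mono) auto
            also have "\<dots> = 2 / y" using te by (simp only: mult_divide_mult_cancel_right)
            also have "\<dots> \<le> 2 / \<delta>^2" using \<delta> e y by (intro divide_left_mono) (auto simp: y_def)
            finally show "(2 * t + e) / (y * (t + e)) \<le> 2 / \<delta>^2" .
          qed (use x t e y te in auto)
          moreover have "(\<delta>^2 - t) / (2 * \<delta>^2) \<le> 1 - x"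
          proof -
            have "1 - x = (\<delta>^2 - t) / y" using y by (simp add: x_def xx_def y_def field_simps)
            also have "\<dots> \<ge> (\<delta>^2 - t) / (2 * \<delta>^2)" 
              using t e \<delta> y by (intro divide_left_mono) (auto simp: y_def)
            finally show ?thesis .
          qed
          then have "(\<delta>^2 - t) / (2 * \<delta>^2) * (e / (e + t)^2) \<le> (1 - x) * (e / (e + t)^2)"
            using e by (intro mult_right_mono) auto
          ultimately show ?thesis unfolding 2 by (simp add: algebra_simps)
        qed
        define E where "E = exp (\<Phi> z)"
        define F where "F = (cmod (f z))^2"
        define Dd where "Dd = (cmod (deriv f z + f z * P' z))^2"
        define Sg where "Sg = Re (\<sigma>' z)"
        have pos: "E \<ge> 0" "F \<ge> 0" "Dd \<ge> 0" "Sg \<ge> 0" using S0 by (auto simp: E_def F_def Dd_def Sg_def)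
        have "I z = E * (g t * (0 - Dd - F * Sg) + (g2 t * t + g1 t) * F)"
          unfolding I_def E_def Dd_def F_def Sg_def t_def k_def \<kappa>_def by simp
        also have "\<dots> \<le> E * (0 + (2 / \<delta>^2 - (\<delta>^2 - t) / (2 * \<delta>^2) * (e / (e + t)^2)) * F)"
        proof (intro mult_left_mono add_mono mult_right_mono kap)
          show "g t * (0 - Dd - F * Sg) \<le> 0"
          proof (rule mult_nonneg_nonpos[OF gn])
            have "0 \<le> F * Sg" using pos by simp
            then show "0 - Dd - F * Sg \<le> 0" using pos by linarith
          qed
        qed (use pos in auto)
        also have "\<dots> = 2 / \<delta>^2 * (F * E) - F * E * ((\<delta>^2 - t) / (2 * \<delta>^2)) * (e / (e + t)^2)"
        proof -
          have "E * (0 + (a - b * c) * F) = a * (F * E) - F * E * b * c" for a b c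
            by (simp add: algebra_simps)
          then show ?thesis .
        qed
        finally have "I z \<le> 2 / \<delta>^2 * (F * E) - F * E * ((\<delta>^2 - t) / (2 * \<delta>^2)) * (e / (e + t)^2)" .
        then show ?thesis using True by (simp add: v_def t_def[symmetric] E_def[symmetric] F_def[symmetric])
      qed (simp add: v_def)
    qed
    also have "\<dots> = 2 / \<delta>^2 * J" unfolding J_def by simp
    finally show ?thesis .
  qed
  have "pi / 4 * v 0 \<le> 2 / \<delta>^2 * J"
  proof (rule value_le_of_concentrating_integrals[of v "\<delta>\<^sup>2"])
    show "v z \<ge> 0" for z using \<delta> by (auto simp: v_def K_def indicator_def intro!: mult_nonneg_nonneg divide_nonneg_pos power_mono)
    have "isCont (\<lambda>z. (cmod (f z))\<^sup>2 * exp (\<Phi> z) * ((\<delta>^2 - (cmod z)^2) / (2 * \<delta>^2))) 0"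
    proof -
      have "continuous_on S (\<lambda>z. (cmod (f z))\<^sup>2 * exp (\<Phi> z) * ((\<delta>^2 - (cmod z)^2) / (2 * \<delta>^2)))"
        using \<delta> by (intro continuous_intros cf c\<Phi>) auto
      moreover have "0 \<in> S" using S \<delta> by auto
      ultimately show ?thesis using S(1) continuous_on_eq_continuous_at by blast
    qed
    moreover have "eventually (\<lambda>z. z \<in> ball 0 \<delta>) (nhds (0::complex))"
      using \<delta> by (intro eventually_nhds_in_open) auto
    then have "eventually (\<lambda>z. v z = (cmod (f z))^2 * exp (\<Phi> z) * ((\<delta>^2 - (cmod z)^2) / (2 * \<delta>^2))) (nhds 0)"
      by eventually_elim (simp add: v_def K_def)
    ultimately show "isCont v 0" by (subst isCont_cong)
  qed (use \<delta> intv main in auto)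
  moreover have "v 0 = (cmod (f 0))^2 * exp (- 2 * \<psi> 0) / 2"
    using \<delta> by (simp add: v_def K_def \<Phi>_def)
  ultimately have le1: "pi / 8 * ((cmod (f 0))^2 * exp (- 2 * \<psi> 0)) \<le> 2 / \<delta>^2 * J" by simp
  have "J \<le> (LINT z|lborel. exp (2 * \<bar>M\<bar> * \<delta>^2) * (indicator (cball 0 \<delta>) z * ((cmod (f z))^2 * exp (- 2 * \<psi> z))))"
    unfolding J_def
  proof (rule integral_mono[OF intJ])
    have "continuous_on K (\<lambda>z. (cmod (f z))\<^sup>2 * exp (- 2 * \<psi> z))"
      using K by (intro continuous_intros continuous_on_subset[OF cf] continuous_on_subset[OF C2r_continuous_on(1)[OF \<psi>]])
    then show "integrable lborel (\<lambda>z. exp (2 * \<bar>M\<bar> * \<delta>^2) * (indicator (cball 0 \<delta>) z * ((cmod (f z))^2 * exp (- 2 * \<psi> z))))"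
      using K(1) unfolding K_def[symmetric] by (intro integrable_mult_right integrable_indicator_mult)
    fix z :: complex
    show "indicator K z * ((cmod (f z))^2 * exp (\<Phi> z)) \<le> exp (2 * \<bar>M\<bar> * \<delta>^2) * (indicator (cball 0 \<delta>) z * ((cmod (f z))^2 * exp (- 2 * \<psi> z)))"
    proof (cases "z \<in> K")
      case True
      then have "(cmod z)^2 \<le> \<delta>^2" using \<delta> by (auto simp: K_def intro: power_mono)
      then have "2 * \<bar>M\<bar> * (cmod z)^2 \<le> 2 * \<bar>M\<bar> * \<delta>^2" by (intro mult_left_mono) auto
      then have "exp (\<Phi> z) \<le> exp (- 2 * \<psi> z) * exp (2 * \<bar>M\<bar> * \<delta>^2)"
        by (simp add: \<Phi>_def flip: exp_add)
      then have "(cmod (f z))^2 * exp (\<Phi> z) \<le> (cmod (f z))\<^sup>2 * (exp (- 2 * \<psi> z) * exp (2 * \<bar>M\<bar> * \<delta>^2))"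
        by (intro mult_left_mono) auto
      then show ?thesis using True by (simp add: K_def mult_ac)
    qed (simp add: K_def)
  qed
  then have "2 / \<delta>^2 * J \<le> 2 / \<delta>^2 * (LINT z|lborel. exp (2 * \<bar>M\<bar> * \<delta>^2) * (indicator (cball 0 \<delta>) z * ((cmod (f z))^2 * exp (- 2 * \<psi> z))))"
    using \<delta> by (intro mult_left_mono) auto
  with le1 show ?thesis unfolding Bochner_Integration.integral_mult_right_zero mult.assoc by linarith
qed

text \<open>The identity is used with \<open>k = 6 C\<^sup>2 + log ((1 + |z|\<^sup>2) / (e + |z|\<^sup>2)) / 2\<close>: the constant lets
  \<open>k \<Delta>\<Phi>\<close> absorb the cross term, and \<open>- \<Delta>k\<close> contains an approximate point mass at the origin.\<close>
lemma pole_estimate: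
  fixes C :: real
  assumes C: "C \<ge> 1" and S: "open S" "0 \<in> S"
    and \<psi>: "C2r S \<psi> P \<sigma>" and \<sigma>: "\<And>z. z \<in> S \<Longrightarrow> Re (\<sigma> z) \<ge> 1 / (4 * (1 + C * cmod z)^2)"
    and b: "C2w S b p q s" and K: "compact K" "K \<subseteq> S" "\<And>z. z \<in> S - K \<Longrightarrow> b z = 0"
    and \<gamma>: "continuous_on S \<gamma>" "\<And>z. z \<in> S \<Longrightarrow> q z = z * \<gamma> z"
  shows "pi / 8 * ((cmod (b 0))^2 * exp (2 * \<psi> 0)) \<le> (6 * C^2 + 3 / 2) * exp (8 * C^2) *
     (LINT z|lborel. indicator K z * ((cmod (\<gamma> z))^2 * exp (2 * \<psi> z)))"
proof -
  define B where "B = (6 * C^2 + 3 / 2) * exp (8 * C^2)"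
  \<comment> \<open>With \<open>t\<close> for the squared modulus,
    \<open>2 * Re (\<sigma> z)\<close> is at least \<open>1 / (4 * C^2 * (1 + t))\<close>, and a
    quarter of the Laplacian of the squared logarithm is at most \<open>4 / (1 + t)\<close>. Hence
    \<open>8 * kp = 1 / (8 * C^2)\<close> spends half of the available positivity.\<close>
  define kp where "kp = 1 / (64 * C^2)"
  have C0: "C\<^sup>2 \<ge> 1" using C by simp
  have kp: "kp > 0" using C by (simp add: kp_def)
  have t1: "1 + (cmod z)^2 > 0" for z by (simp add: add_pos_nonneg)
  \<comment> \<open>The square is essential: \<open>exp (- 2 * kp * l t)\<close> decays faster than
    any power of \<open>1 + t\<close> however small \<open>kp\<close> is, whereas
    \<open>ln (1 + t)\<close> itself with this factor would give only the power
    \<open>- 2 * kp\<close>.\<close>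
  define l where "l t = (ln (1 + t))^2" for t :: real
  define l1 where "l1 t = 2 * ln (1 + t) / (1 + t)" for t :: real
  define l2 where "l2 t = (2 - 2 * ln (1 + t)) / (1 + t)^2" for t :: real
  have l1: "(l has_real_derivative l1 t) (at t)" if "t \<ge> 0" for t
    unfolding l_def[abs_def] l1_def using that by (auto intro!: derivative_eq_intros)
  have l2: "(l1 has_real_derivative l2 t) (at t)" if "t \<ge> 0" for t
    unfolding l1_def[abs_def] l2_def using that 
    by (auto intro!: derivative_eq_intros simp: divide_simps) (simp add: power2_eq_square algebra_simps)
  have l2c: "continuous_on {0..} l2"
    unfolding l2_def[abs_def] by (intro continuous_intros) auto
  define LP where "LP z = of_real (l1 ((cmod z)^2)) * cnj z" for z
  define LS where "LS z = complex_of_real (l2 ((cmod z)^2) * (cmod (cnj z))^2) + of_real (l1 ((cmod z)^2)) * 1" for z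
  have L: "C2r S (\<lambda>z. l ((cmod z)^2)) LP LS"
    unfolding LP_def LS_def
    by (rule C2r_compose[OF C2r_norm_square]) (auto intro!: l1 l2 continuous_on_subset[OF l2c])
  define \<Phi> where "\<Phi> z = 2 * \<psi> z + (- 2 * kp) * l ((cmod z)^2)" for z
  define P' where "P' z = of_real 2 * P z + of_real (- 2 * kp) * LP z" for z
  define \<sigma>' where "\<sigma>' z = of_real 2 * \<sigma> z + of_real (- 2 * kp) * LS z" for z
  have \<Phi>: "C2r S \<Phi> P' \<sigma>'"
    unfolding \<Phi>_def P'_def \<sigma>'_def by (intro C2r_add C2r_cmult \<psi> L)
  have c\<Phi>: "continuous_on S \<Phi>" by (rule C2r_continuous_on[OF \<Phi>])
  note cb = C2w_continuous_on[OF b]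
  define J where "J = (LINT z|lborel. indicator K z * ((cmod (\<gamma> z))^2 * exp (2 * \<psi> z)))"
  have intJ: "integrable lborel (\<lambda>z. indicator K z * ((cmod (\<gamma> z))^2 * exp (2 * \<psi> z)))"
    using K by (intro integrable_indicator_mult continuous_intros continuous_on_subset[OF \<gamma>(1)]
       continuous_on_subset[OF C2r_continuous_on(1)[OF \<psi>]])
  define v where "v z = indicator K z * ((cmod (b z))^2 * exp (\<Phi> z))" for z
  have intv: "integrable lborel (\<lambda>z. v z * (e / (e + (cmod z)^2)^2))" if "e > 0" for e
    unfolding v_def using K
    by (intro integrable_concentrating[OF _ _ that] continuous_intros continuous_on_subset[OF cb(1)] continuous_on_subset[OF c\<Phi>]) auto
  have main: "(LINT z|lborel. v z * (e / (e + (cmod z)^2)^2)) \<le> 2 * B * J" if e: "0 < e" "e < 1" for e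
  proof -
    \<comment> \<open>Once \<open>Re (\<sigma>' z) \<ge> 1 / (8 * C^2 * (1 + t))\<close> is known,
      the constant \<open>6 * C^2\<close> produces the coefficient 3/4. It pays for 1/2 from the
      positive part of the Laplacian of \<open>k\<close> and 1/4 from the cross term.\<close>
    define g where "g t = 6 * C^2 + (ln (1 + t) - ln (e + t)) / 2" for t
    define g1 where "g1 t = (1 / (1 + t) - 1 / (e + t)) / 2" for t
    define g2 where "g2 t = (1 / (e + t)^2 - 1 / (1 + t)^2) / 2" for t
    have g1: "(g has_real_derivative g1 t) (at t)" if "t \<ge> 0" for t
      unfolding g_def[abs_def] g1_def using that e
      by (auto intro!: derivative_eq_intros)
    have g2: "(g1 has_real_derivative g2 t) (at t)" if "t \<ge> 0" for t
      unfolding g1_def[abs_def] g2_def using that e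
      by (auto intro!: derivative_eq_intros simp: power2_eq_square)
    have g2c: "continuous_on {0..} g2"
      unfolding g2_def[abs_def] by (intro continuous_intros) (use e in auto)
    define k where "k z = g ((cmod z)^2)" for z :: complex
    define R where "R z = of_real (g1 ((cmod z)^2)) * cnj z" for z
    define \<kappa> where "\<kappa> z = complex_of_real (g2 ((cmod z)^2) * (cmod (cnj z))^2) + of_real (g1 ((cmod z)^2)) * 1" for z
    have k: "C2r S k R \<kappa>"
      unfolding k_def R_def \<kappa>_def
      by (rule C2r_compose[OF C2r_norm_square]) (auto intro!: g1 g2 continuous_on_subset[OF g2c])
    define I where "I z = exp (\<Phi> z) * (k z * ((cmod (q z))^2 - 
        (cmod (p z + b z * P' z))^2 - (cmod (b z))^2 * Re (\<sigma>' z)) +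
        Re (\<kappa> z) * (cmod (b z))^2 + 2 * Re (R z * cnj (b z) * q z))" for z
    have I0: "(LINT z|lborel. indicator K z * I z) = 0"
      unfolding I_def
      by (rule twisted_identity[OF S(1) b \<Phi> k K(1,2)]) (use K(3) in auto)
    have cI: "continuous_on S I"
      unfolding I_def[abs_def]
      by (intro continuous_intros cb C2r_continuous_on[OF \<Phi>] C2r_continuous_on[OF k])
    have "(LINT z|lborel. v z * (e / (e + (cmod z)^2)^2)) = 
       (LINT z|lborel. v z * (e / (e + (cmod z)^2)^2)) + 2 * (LINT z|lborel. indicator K z * I z)"
      using I0 by simp
    also have "\<dots> = (LINT z|lborel. v z * (e / (e + (cmod z)^2)^2)) + (LINT z|lborel. 2 * (indicator K z * I z))"
      by simp
    also have "\<dots> = (LINT z|lborel. v z * (e / (e + (cmod z)^2)^2) + 2 * (indicator K z * I z))"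
      using K by (intro Bochner_Integration.integral_add[symmetric] integrable_mult_right intv integrable_indicator_mult continuous_on_subset[OF cI] e)
    also have "\<dots> \<le> (LINT z|lborel. 2 * B * (indicator K z * ((cmod (\<gamma> z))^2 * exp (2 * \<psi> z))))"
    proof (rule integral_mono)
      show "integrable lborel (\<lambda>z. v z * (e / (e + (cmod z)^2)^2) + 2 * (indicator K z * I z))"
        using K by (intro Bochner_Integration.integrable_add intv integrable_mult_right integrable_indicator_mult continuous_on_subset[OF cI] e)
      show "integrable lborel (\<lambda>z. 2 * B * (indicator K z * ((cmod (\<gamma> z))^2 * exp (2 * \<psi> z))))"
        using intJ by simp
      fix z :: complex
      show "v z * (e / (e + (cmod z)^2)^2) + 2 * (indicator K z * I z) \<le> 2 * B * (indicator K z * ((cmod (\<gamma> z))^2 * exp (2 * \<psi> z)))"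
      proof (cases "z \<in> K")
        case True
        then have zS: "z \<in> S" using K by auto
        define t where "t = (cmod z)^2"
        have t: "0 \<le> t" by (simp add: t_def)
        have te: "e + t > 0" using t e by simp
        define Lg where "Lg = ln (1 + t)"
        have Lg: "0 \<le> Lg" "Lg \<le> t" using t ln_add_one_self_le_self[of t] by (auto simp: Lg_def)
        have kA: "k z \<ge> 6 * C^2"
        proof -
          have "ln (e + t) \<le> ln (1 + t)" using te e by simp
          then show ?thesis by (simp add: k_def g_def t_def[symmetric])
        qed
        \<comment> \<open>The logarithmic pole of \<open>k\<close> does no harm in
          \<open>k z * (cmod (q z))^2\<close>, because \<open>q\<close> carries a factor
          \<open>z\<close> and \<open>t * ln ((1 + t) / (e + t))\<close> is at most 1 uniformly in
          \<open>e\<close>. The additional 1 on the left is reserved for the cross term.\<close>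
        have kt: "k z * t + 1 \<le> (6 * C^2 + 3 / 2) * (1 + t)"
        proof -
          have "ln (1 + t) - ln (e + t) = ln ((1 + t) / (e + t))"
            using t te by (subst ln_div) auto
          also have "\<dots> \<le> (1 + t) / (e + t) - 1"
            using t te by (intro ln_le_minus_one) auto
          also have "\<dots> = (1 - e) / (e + t)" using te by (simp add: field_simps)
          finally have "(ln (1 + t) - ln (e + t)) * t \<le> (1 - e) / (e + t) * t"
            using t by (rule mult_right_mono)
          also have "\<dots> = (1 - e) * (t / (e + t))" by simp
          also have "\<dots> \<le> 1 * 1" using t e te by (intro mult_mono) auto
          finally have "k z * t \<le> 6 * C^2 * t + 1 / 2"
            by (simp add: k_def g_def t_def[symmetric] algebra_simps)
          then show ?thesis
            using t C0 by (simp add: distrib_left distrib_right)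
        qed
        \<comment> \<open>Completing the square: \<open>Lg - Lg^2 / (32 * C^2)\<close> is largest at
          \<open>Lg = 16 * C^2\<close>, with value \<open>8 * C^2\<close>.\<close>
        have eL: "exp (- 2 * kp * l t) * (1 + t) \<le> exp (8 * C^2)"
        proof -
          have "exp (- 2 * kp * l t) * (1 + t) = exp (- 2 * kp * Lg^2 + Lg)"
            using t by (subst exp_add) (simp add: l_def Lg_def)
          also have "- 2 * kp * Lg^2 + Lg \<le> 8 * C^2"
          proof -
            have "0 \<le> (Lg - 16 * C^2)\<^sup>2 / (32 * C^2)" by simp
            also have "\<dots> = Lg^2 / (32 * C^2) - Lg + 8 * C^2"
              using C by (simp add: power2_diff field_simps power2_eq_square)
            also have "Lg\<^sup>2 / (32 * C^2) = 2 * kp * Lg^2" by (simp add: kp_def)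
            finally show ?thesis by simp
          qed
          finally show ?thesis by simp
        qed
        have Rz: "(cmod (R z))^2 * t \<le> (1 / 4) / (1 + t)^2"
        proof -
          have "\<bar>g1 t\<bar> * t \<le> (1 / 2) / (1 + t)"
          proof -
            have "g1 t = - ((1 - e) / (2 * ((1 + t) * (e + t))))"
              unfolding g1_def using t te by (simp add: divide_simps) 
            then have "\<bar>g1 t\<bar> * t = (1 - e) * (t / (e + t)) * ((1 / 2) / (1 + t))"
              using t te e by (simp add: abs_mult)
            also have "\<dots> \<le> 1 * 1 * ((1 / 2) / (1 + t))"
              using t te e by (intro mult_mono) auto
            finally show ?thesis by simp
          qed
          then have "(\<bar>g1 t\<bar> * t)^2 \<le> ((1 / 2) / (1 + t))\<^sup>2" using t by (intro power_mono) auto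
          moreover have "(cmod (R z))^2 * t = (\<bar>g1 t\<bar> * t)^2"
            by (simp add: R_def norm_mult t_def power_mult_distrib power2_eq_square)
          moreover have "((1 / 2) / (1 + t))^2 = (1 / 4) / (1 + t)^2"
            unfolding power_divide by simp
          ultimately show ?thesis by metis
        qed
        have kap: "Re (\<kappa> z) = (1 / 2) / (1 + t)^2 - (1 / 2) * (e / (e + t)^2)"
        proof -
          have *: "t / u^2 - 1 / u = (t - u) / u^2" if "u > 0" for u
            using that by (simp add: field_simps power2_eq_square)
          have "Re (\<kappa> z) = g2 t * t + g1 t" by (simp add: \<kappa>_def t_def)
          also have "\<dots> = ((t / (e + t)^2 - 1 / (e + t)) - (t / (1 + t)^2 - 1 / (1 + t))) / 2"
            unfolding g2_def g1_def by (simp add: field_simps)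
          also have "\<dots> = ((t - (e + t)) / (e + t)^2 - (t - (1 + t)) / (1 + t)^2) / 2"
            using *[OF te] *[of "1 + t"] t by simp
          finally show ?thesis by (simp add: field_simps)
        qed
        have Sg: "6 * C^2 * Re (\<sigma>' z) \<ge> (3 / 4) / (1 + t)^2"
        proof -
          have "(1 + C * cmod z)^2 \<le> 2 * (1 + C^2 * t)"
            using sum_squares_bound[of 1 "C * cmod z"] by (simp add: t_def power2_sum power_mult_distrib)
          also have "\<dots> \<le> 2 * C^2 * (1 + t)" using C0 by (simp add: algebra_simps)
          finally have le: "(1 + C * cmod z)^2 \<le> 2 * C^2 * (1 + t)" .
          have pos: "(1 + C * cmod z)^2 > 0" using C by (intro zero_less_power add_pos_nonneg) auto
          have "1 / (4 * (1 + C * cmod z)^2) \<ge> 1 / (4 * (2 * C^2 * (1 + t)))"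
          proof -
            have "1 / (4 * b) \<le> 1 / (4 * a)" if "a \<le> b" "a > 0" for a b :: real
              using that by (simp add: frac_le)
            then show ?thesis using le pos by blast
          qed
          then have s1: "Re (\<sigma> z) \<ge> 1 / (8 * C^2 * (1 + t))" using \<sigma>[OF zS] by simp
          have *: "a / u^2 * t + b / u = (a * t + b * u) / u^2" if "u > 0" for a b u :: real
            using that by (simp add: field_simps power2_eq_square)
          have "Re (LS z) = l2 t * t + l1 t" by (simp add: LS_def t_def)
          also have "\<dots> = ((2 - 2 * Lg) * t + 2 * Lg * (1 + t)) / (1 + t)^2"
            using *[of "1 + t"] t by (simp add: l1_def l2_def Lg_def)
          also have "\<dots> = (2 * t + 2 * Lg) / (1 + t)^2" by (simp add: algebra_simps)
          also have "\<dots> \<le> (4 * (1 + t)) / (1 + t)^2" using Lg t by (intro divide_right_mono) auto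
          also have "\<dots> = 4 / (1 + t)" 
          proof -
            have "(4 * u) / u^2 = 4 / u" for u :: real by (simp add: power2_eq_square)
            then show ?thesis .
          qed
          finally have "2 * kp * Re (LS z) \<le> 2 * kp * (4 / (1 + t))" using kp by (intro mult_left_mono) auto
          also have "\<dots> = 1 / (8 * C^2 * (1 + t))" by (simp add: kp_def)
          finally have "Re (\<sigma>' z) \<ge> 1 / (8 * C^2 * (1 + t))"
            using s1 by (simp add: \<sigma>'_def)
          then have "6 * C^2 * Re (\<sigma>' z) \<ge> 6 * C^2 * (1 / (8 * C^2 * (1 + t)))"
            by (intro mult_left_mono) auto
          also have "6 * C^2 * (1 / (8 * C^2 * (1 + t))) = (3 / 4) / (1 + t)"
          proof -
            have gen: "6 * a * (1 / (8 * a * u)) = (3 / 4) / u" if "a \<noteq> 0" for a u :: real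
              using that by simp
            show ?thesis by (rule gen) (use C in simp)
          qed
          finally have "6 * C^2 * Re (\<sigma>' z) \<ge> (3 / 4) / (1 + t)" .
          moreover have "(3 / 4) / (1 + t)^2 \<le> (3 / 4) / (1 + t)"
            using t by (intro divide_left_mono) (auto simp: power2_eq_square)
          ultimately show ?thesis by simp
        qed
        then have Sn: "Re (\<sigma>' z) \<ge> 0"
          by (smt (verit) C0 divide_nonneg_nonneg mult_pos_neg zero_le_power2)
        define E where "E = exp (\<Phi> z)"
        define G where "G = (cmod (\<gamma> z))^2"
        define F where "F = (cmod (b z))^2"
        define Dd where "Dd = (cmod (p z + b z * P' z))^2"
        define X where "X = 1 / (1 + t)^2"
        define Y where "Y = e / (e + t)^2"
        have pos: "E \<ge> 0" "F \<ge> 0" "Dd \<ge> 0" "G \<ge> 0" by (auto simp: E_def F_def Dd_def G_def)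
        \<comment> \<open>The factor \<open>z\<close> of \<open>q\<close> compensates the growth of
          \<open>R\<close> near the origin, so \<open>cmod (R z) * cmod z\<close> is bounded
          uniformly in \<open>e\<close> and the inequality between the means can split the
          product.\<close>
        have cross: "2 * Re (R z * cnj (b z) * q z) \<le> F * ((1 / 4) * X) + G"
        proof -
          have "Re (R z * cnj (b z) * q z) \<le> cmod (R z * cnj (b z) * q z)" by (rule complex_Re_le_cmod)
          also have "\<dots> = (cmod (R z) * cmod z * cmod (b z)) * cmod (\<gamma> z)"
            by (simp add: \<gamma>(2)[OF zS] norm_mult)
          finally have "2 * Re (R z * cnj (b z) * q z) \<le> 2 * (cmod (R z) * cmod z * cmod (b z)) * cmod (\<gamma> z)" by simp
          also have "\<dots> \<le> (cmod (R z) * cmod z * cmod (b z))\<^sup>2 + (cmod (\<gamma> z))^2" by (rule sum_squares_bound)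
          also have "(cmod (R z) * cmod z * cmod (b z))^2 = F * ((cmod (R z))^2 * t)"
            by (simp add: F_def t_def power_mult_distrib)
          also have "\<dots> \<le> F * ((1 / 4) * X)" using Rz pos by (intro mult_left_mono) (auto simp: X_def)
          finally show ?thesis by (simp add: G_def)
        qed
        have qz: "(cmod (q z))^2 = t * G" by (simp add: \<gamma>(2)[OF zS] norm_mult power_mult_distrib t_def G_def)
        have kpos: "k z \<ge> 0" using kA C0 by linarith
        have kS: "k z * Re (\<sigma>' z) \<ge> (3 / 4) * X"
        proof -
          have "6 * C^2 * Re (\<sigma>' z) \<le> k z * Re (\<sigma>' z)" using kA Sn by (rule mult_right_mono)
          then show ?thesis using Sg by (simp add: X_def)
        qed
        have "k z * (t * G - Dd - F * Re (\<sigma>' z)) + Re (\<kappa> z) * F + 2 * Re (R z * cnj (b z) * q z)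
           \<le> (k z * t + 1) * G - F * (k z * Re (\<sigma>' z)) + (X / 2 - Y / 2) * F + F * (X / 4)"
          using cross mult_nonneg_nonneg[OF kpos pos(3)] by (simp add: kap X_def Y_def algebra_simps)
        also have "\<dots> \<le> (k z * t + 1) * G - Y / 2 * F"
          using mult_left_mono[OF kS pos(2)] by (simp add: algebra_simps)
        also have "\<dots> \<le> (6 * C^2 + 3 / 2) * (1 + t) * G - Y / 2 * F"
          using mult_right_mono[OF kt pos(4)] by simp
        finally have "E * (k z * (t * G - Dd - F * Re (\<sigma>' z)) + Re (\<kappa> z) * F + 2 * Re (R z * cnj (b z) * q z))
           \<le> E * ((6 * C^2 + 3 / 2) * (1 + t) * G - Y / 2 * F)" using pos by (intro mult_left_mono)
        then have "I z \<le> E * ((6 * C^2 + 3 / 2) * (1 + t) * G - Y / 2 * F)"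
          by (simp add: I_def E_def F_def Dd_def qz)
        also have "\<dots> = (exp (- 2 * kp * l t) * (1 + t)) * ((6 * C^2 + 3 / 2) * G * exp (2 * \<psi> z)) - E * F * Y / 2"
          by (simp add: E_def \<Phi>_def t_def[symmetric] exp_add exp_diff exp_minus field_simps)
        also have "\<dots> \<le> exp (8 * C^2) * ((6 * C^2 + 3 / 2) * G * exp (2 * \<psi> z)) - E * F * Y / 2"
          using eL pos by (intro diff_right_mono mult_right_mono) auto
        also have "\<dots> = B * (G * exp (2 * \<psi> z)) - E * F * Y / 2" by (simp add: B_def)
        finally have "2 * I z \<le> 2 * B * (G * exp (2 * \<psi> z)) - E * F * Y" by simp
        then show ?thesis using True by (simp add: v_def E_def F_def G_def Y_def t_def mult_ac)
      qed (simp add: v_def)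
    qed
    also have "\<dots> = 2 * B * J" unfolding J_def by simp
    finally show ?thesis .
  qed
  have "pi / 4 * v 0 \<le> 2 * B * J"
  proof (rule value_le_of_concentrating_integrals[of v 1])
    show "v z \<ge> 0" for z by (simp add: v_def)
    have "isCont (\<lambda>z. (cmod (b z))\<^sup>2 * exp (\<Phi> z)) 0"
    proof -
      have "continuous_on S (\<lambda>z. (cmod (b z))\<^sup>2 * exp (\<Phi> z))"
        by (intro continuous_intros cb c\<Phi>)
      then show ?thesis using S continuous_on_eq_continuous_at by blast
    qed
    moreover have "eventually (\<lambda>z. z \<in> S) (nhds (0::complex))"
      using S by (intro eventually_nhds_in_open) auto
    then have "eventually (\<lambda>z. v z = (cmod (b z))^2 * exp (\<Phi> z)) (nhds 0)"
      by eventually_elim (use K in \<open>auto simp: v_def indicator_def\<close>)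
    ultimately show "isCont v 0" by (subst isCont_cong)
  qed (use intv main in auto)
  moreover have "v 0 = (cmod (b 0))^2 * exp (2 * \<psi> 0)"
    using S K by (auto simp: v_def indicator_def \<Phi>_def l_def)
  ultimately show ?thesis unfolding J_def B_def by (simp add: mult.assoc)
qed

section \<open>Minimisation in a weighted space\<close>

definition Cc :: "complex set \<Rightarrow> (complex \<Rightarrow> complex) set" where
  "Cc S = {u. continuous_on UNIV u \<and> compact_support S u}"

lemma compact_support_cong:
  "compact_support S u \<Longrightarrow> (\<And>z. u z = 0 \<Longrightarrow> v z = 0) \<Longrightarrow> compact_support S v"
  unfolding compact_support_def by metis

lemma compact_support_combination:
  assumes "compact_support S u" "compact_support S v"
  shows "compact_support S (\<lambda>z. u z + c * v z)"
proof -
  from assms obtain K L where "compact K" "K \<subseteq> S" "\<And>z. z \<notin> K \<Longrightarrow> u z = 0"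
    "compact L" "L \<subseteq> S" "\<And>z. z \<notin> L \<Longrightarrow> v z = 0" unfolding compact_support_def by metis
  then show ?thesis unfolding compact_support_def
    by (intro exI[of _ "K \<union> L"]) (auto intro: compact_Un)
qed

lemma Cc_combination: "u \<in> Cc S \<Longrightarrow> v \<in> Cc S \<Longrightarrow> (\<lambda>z. u z + c * v z) \<in> Cc S"
  unfolding Cc_def by (auto intro!: continuous_intros compact_support_combination)

lemma Cc_mult: "continuous_on UNIV u \<Longrightarrow> v \<in> Cc S \<Longrightarrow> (\<lambda>z. u z * v z) \<in> Cc S"
  unfolding Cc_def by (auto intro!: continuous_intros intro: compact_support_cong)

locale weighted_space =
  fixes S :: "complex set" and W :: "complex \<Rightarrow> real"
  assumes open_S: "open S" and cont_W: "continuous_on S W" and W_pos: "\<And>z. z \<in> S \<Longrightarrow> W z > 0"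
begin

definition ip :: "(complex \<Rightarrow> complex) \<Rightarrow> (complex \<Rightarrow> complex) \<Rightarrow> complex" where
  "ip u v = (LINT z|lborel. u z * cnj (v z) * of_real (W z))"

definition sq_norm :: "(complex \<Rightarrow> complex) \<Rightarrow> real" where
  "sq_norm u = (LINT z|lborel. (cmod (u z))\<^sup>2 * W z)"

lemma ip_integrable:
  assumes "u \<in> Cc S" "v \<in> Cc S"
  shows "integrable lborel (\<lambda>z. u z * cnj (v z) * of_real (W z))"
proof -
  from assms(1) obtain K where K: "compact K" "K \<subseteq> S" "\<And>z. z \<notin> K \<Longrightarrow> u z = 0"
    unfolding Cc_def compact_support_def by blast
  show ?thesis
    by (rule integrable_continuous_compact_support[OF _ K(1)])
       (use assms K in \<open>auto simp: Cc_def intro!: continuous_intros intro: continuous_on_subset continuous_on_subset[OF cont_W]\<close>)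
qed

lemma sq_norm_integrable:
  assumes "u \<in> Cc S"
  shows "integrable lborel (\<lambda>z. (cmod (u z))\<^sup>2 * W z)"
proof -
  have "integrable lborel (\<lambda>z. Re (u z * cnj (u z) * of_real (W z)))"
    by (rule integrable_Re[OF ip_integrable[OF assms assms]])
  also have "(\<lambda>z. Re (u z * cnj (u z) * of_real (W z))) = (\<lambda>z. (cmod (u z))\<^sup>2 * W z)"
    by (simp flip: complex_norm_square of_real_mult)
  finally show ?thesis .
qed

lemma ip_self: "ip u u = of_real (sq_norm u)"
proof -
  have "ip u u = (LINT z|lborel. complex_of_real ((cmod (u z))^2 * W z))"
    unfolding ip_def by (simp flip: complex_norm_square)
  then show ?thesis unfolding sq_norm_def by (simp only: integral_complex_of_real)
qed

lemma ip_cnj: "ip v u = cnj (ip u v)"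
proof -
  have "cnj (ip u v) = (LINT z|lborel. cnj (u z * cnj (v z) * of_real (W z)))"
    unfolding ip_def by (rule Bochner_Integration.integral_cnj[symmetric])
  then show ?thesis unfolding ip_def by (simp add: mult_ac)
qed

lemma ip_combination_left:
  assumes "u \<in> Cc S" "v \<in> Cc S" "w \<in> Cc S"
  shows "ip (\<lambda>z. u z + c * v z) w = ip u w + c * ip v w"
  unfolding ip_def distrib_right mult.assoc
  using ip_integrable[OF assms(1,3)] ip_integrable[OF assms(2,3)] by (simp add: mult.assoc)

lemma ip_combination_right:
  assumes "u \<in> Cc S" "v \<in> Cc S" "w \<in> Cc S"
  shows "ip w (\<lambda>z. u z + c * v z) = ip w u + cnj c * ip w v"
  using ip_combination_left[OF assms, of c] ip_cnj complex_cnj_add complex_cnj_mult by metis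

lemma sq_norm_nonneg: "u \<in> Cc S \<Longrightarrow> sq_norm u \<ge> 0"
  unfolding sq_norm_def
proof (rule Bochner_Integration.integral_nonneg)
  fix z assume "u \<in> Cc S"
  then have "u z = 0 \<or> z \<in> S" unfolding Cc_def compact_support_def by blast
  then show "0 \<le> (cmod (u z))\<^sup>2 * W z" using W_pos[of z] by auto
qed

lemma sq_norm_combination:
  assumes "u \<in> Cc S" "v \<in> Cc S"
  shows "sq_norm (\<lambda>z. u z + c * v z) = sq_norm u + 2 * Re (cnj c * ip u v) + (cmod c)^2 * sq_norm v"
proof -
  note uv = Cc_combination[OF assms, of c]
  have "of_real (sq_norm (\<lambda>z. u z + c * v z)) = ip u u + (cnj c * ip u v + c * ip v u) + c * cnj c * ip v v"
    unfolding ip_self[symmetric] ip_combination_left[OF assms uv] 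
      ip_combination_right[OF assms assms(1)] ip_combination_right[OF assms assms(2)]
    by (simp add: algebra_simps)
  also have "c * ip v u = cnj (cnj c * ip u v)" by (simp add: ip_cnj[of v u])
  also have "cnj c * ip u v + cnj (cnj c * ip u v) = of_real (2 * Re (cnj c * ip u v))"
    by (rule complex_add_cnj)
  also have "c * cnj c = of_real ((cmod c)^2)" by (rule complex_norm_square[symmetric])
  finally have "complex_of_real (sq_norm (\<lambda>z. u z + c * v z)) = 
     of_real (sq_norm u + 2 * Re (cnj c * ip u v) + (cmod c)^2 * sq_norm v)"
    unfolding ip_self by simp
  then show ?thesis unfolding of_real_eq_iff .
qed

text \<open>Testing minimality with the coefficient \<open>- l * ip u v\<close> gives a quadratic
  inequality in the real number \<open>l\<close>, in which \<open>l = 1 / sq_norm v\<close> is the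
  best choice. If \<open>sq_norm v\<close> is zero, the inequality is linear in \<open>l\<close> and
  forces the pairing to vanish.\<close>

lemma near_minimizer_orthogonal:
  assumes "u \<in> Cc S" "v \<in> Cc S" and min: "\<And>c. m \<le> sq_norm (\<lambda>z. u z + c * v z)" and e: "sq_norm u \<le> m + e"
  shows "(cmod (ip u v))^2 \<le> e * sq_norm v"
proof -
  define A where "A = (cmod (ip u v))^2"
  have A0: "A \<ge> 0" by (simp add: A_def)
  have *: "2 * l * A \<le> e + l^2 * A * sq_norm v" for l :: real
  proof -
    have "m \<le> sq_norm (\<lambda>z. u z + (- of_real l * ip u v) * v z)" by (rule min)
    also have "\<dots> = sq_norm u + 2 * Re (cnj (- of_real l * ip u v) * ip u v) + (cmod (- of_real l * ip u v))^2 * sq_norm v"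
      by (rule sq_norm_combination[OF assms(1,2)])
    also have "cnj (- of_real l * ip u v) * ip u v = - of_real (l * A)"
      using complex_norm_square[of "ip u v"] by (simp add: A_def mult_ac)
    also have "(cmod (- of_real l * ip u v))^2 = l^2 * A"
      by (simp add: norm_mult A_def power_mult_distrib)
    finally show ?thesis using e by simp
  qed
  show ?thesis
  proof (cases "sq_norm v = 0")
    case True
    have "A = 0"
    proof (rule ccontr)
      assume "A \<noteq> 0"
      then show False using *[of "(e + 1) / (2 * A)"] True by simp
    qed
    then show ?thesis using True by (simp add: A_def)
  next
    case False
    then have pos: "sq_norm v > 0" using sq_norm_nonneg[OF assms(2)] by simp
    have "2 * (1 / sq_norm v) * A \<le> e + (1 / sq_norm v)^2 * A * sq_norm v" by (rule *)
    then have "A / sq_norm v \<le> e" using pos by (simp add: power2_eq_square)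
    then show ?thesis using pos by (simp add: A_def field_simps)
  qed
qed

text \<open>This is near-minimality with \<open>m = 0\<close> and \<open>e = sq_norm u\<close>,
  where the lower bound is mere nonnegativity.\<close>

lemma ip_Cauchy_Schwarz:
  assumes "u \<in> Cc S" "v \<in> Cc S"
  shows "(cmod (ip u v))^2 \<le> sq_norm u * sq_norm v"
  using near_minimizer_orthogonal[OF assms, of 0 "sq_norm u"] sq_norm_nonneg[OF Cc_combination[OF assms]] by simp

lemma ip_Cauchy_Schwarz_sqrt:
  assumes "u \<in> Cc S" "v \<in> Cc S"
  shows "cmod (ip u v) \<le> sqrt (sq_norm u) * sqrt (sq_norm v)"
  using real_sqrt_le_mono[OF ip_Cauchy_Schwarz[OF assms]] by (simp add: real_sqrt_mult)

text \<open>\<open>Cc S\<close> is not complete, so the infimum need not be attained. Members of a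
  minimising sequence are almost orthogonal to \<open>N\<close>, and their differences lie in
  \<open>N\<close>; hence the sequence is Cauchy and its pairings converge. \<open>\<Lambda>\<close>
  stands for the pairing with the ideal minimiser: orthogonality to \<open>N\<close> becomes
  \<open>\<Lambda> n = 0\<close>, and \<open>\<Lambda> g0\<close> is the squared norm of the
  minimiser.\<close>

lemma minimizing_functional:
  assumes N: "N \<subseteq> Cc S" "N \<noteq> {}" "\<And>u v c. u \<in> N \<Longrightarrow> v \<in> N \<Longrightarrow> (\<lambda>z. u z + c * v z) \<in> N" and g0: "g0 \<in> Cc S"
    and m: "m = (INF n\<in>N. sq_norm (\<lambda>z. g0 z + n z))"
  obtains \<Lambda> \<gamma> where 
    "\<And>j::nat. \<gamma> j \<in> Cc S" "(\<lambda>j. sq_norm (\<gamma> j)) \<longlonglongrightarrow> m" "\<And>g. g \<in> Cc S \<Longrightarrow> (\<lambda>j. ip g (\<gamma> j)) \<longlonglongrightarrow> \<Lambda> g"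
    "\<And>n. n \<in> N \<Longrightarrow> \<Lambda> n = 0" "\<Lambda> g0 = of_real m"
proof -
  have CcN: "(\<lambda>z. g0 z + n z) \<in> Cc S" if "n \<in> N" for n
    using Cc_combination[OF g0, of n 1] N that by auto
  have bdd: "bdd_below ((\<lambda>n. sq_norm (\<lambda>z. g0 z + n z)) ` N)"
    by (rule bdd_belowI[of _ 0]) (auto intro!: sq_norm_nonneg CcN)
  have mle: "m \<le> sq_norm (\<lambda>z. g0 z + n z)" if "n \<in> N" for n
    unfolding m using bdd that by (rule cINF_lower)
  have m0: "m \<ge> 0" unfolding m using N(2) by (intro cINF_greatest sq_norm_nonneg CcN)
  define r where "r j = inverse (real (Suc j))" for j
  have r: "r j > 0" "r j \<le> 1" for j by (auto simp: r_def field_simps)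
  have r_lim: "r \<longlonglongrightarrow> 0" unfolding r_def by (rule LIMSEQ_inverse_real_of_nat)
  have "\<exists>n\<in>N. sq_norm (\<lambda>z. g0 z + n z) \<le> m + (r j)^2" for j
  proof (rule ccontr)
    assume "\<not> ?thesis"
    then have "m + (r j)^2 \<le> m" using N(2) by (subst (2) m) (intro cINF_greatest, auto)
    then show False using r(1)[of j] by simp
  qed
  then obtain n where n: "\<And>j. n j \<in> N" "\<And>j. sq_norm (\<lambda>z. g0 z + n j z) \<le> m + (r j)^2" by metis
  define \<gamma> where "\<gamma> j = (\<lambda>z. g0 z + n j z)" for j
  have \<gamma>: "\<gamma> j \<in> Cc S" "sq_norm (\<gamma> j) \<le> m + (r j)^2" "m \<le> sq_norm (\<gamma> j)" for j
    using CcN n mle by (auto simp: \<gamma>_def)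
  have orth: "cmod (ip (\<gamma> j) u) \<le> r j * sqrt (sq_norm u)" if "u \<in> N" for j u
  proof -
    have "(cmod (ip (\<gamma> j) u))^2 \<le> (r j)\<^sup>2 * sq_norm u"
    proof (rule near_minimizer_orthogonal[OF \<gamma>(1) _ _ \<gamma>(2)])
      fix c
      have "m \<le> sq_norm (\<lambda>z. g0 z + (n j z + c * u z))" using that n N(3) by (intro mle) auto
      then show "m \<le> sq_norm (\<lambda>z. \<gamma> j z + c * u z)" by (simp add: \<gamma>_def add.assoc)
    qed (use that N in auto)
    then have "sqrt ((cmod (ip (\<gamma> j) u))^2) \<le> sqrt ((r j)^2 * sq_norm u)" by (rule real_sqrt_le_mono)
    then show ?thesis using r(1)[of j] by (simp add: real_sqrt_mult)
  qed
  \<comment> \<open>The squared norm of the difference \<open>d\<close> is its pairing with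
    \<open>\<gamma> j\<close> minus its pairing with \<open>\<gamma> k\<close>; both are small by
    \<open>orth\<close>, since \<open>d\<close> lies in \<open>N\<close>. Choosing the tolerance
    \<open>(r j)^2\<close> above makes this bound linear in \<open>r\<close>.\<close>
  have diff: "sqrt (sq_norm (\<lambda>z. \<gamma> j z + (-1) * \<gamma> k z)) \<le> r j + r k" for j k
  proof -
    define d where "d = (\<lambda>z. n j z + (-1) * n k z)"
    have d: "d \<in> N" "d \<in> Cc S" unfolding d_def using N n by blast+
    have eq: "(\<lambda>z. \<gamma> j z + (-1) * \<gamma> k z) = d" by (auto simp: \<gamma>_def d_def)
    have "ip d d = ip (\<gamma> j) d + (-1) * ip (\<gamma> k) d"
      by (subst (1) eq[symmetric]) (rule ip_combination_left[OF \<gamma>(1) \<gamma>(1) d(2)])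
    then have "sq_norm d = Re (ip (\<gamma> j) d + (-1) * ip (\<gamma> k) d)" unfolding ip_self by (metis Re_complex_of_real)
    also have "\<dots> \<le> cmod (ip (\<gamma> j) d + (-1) * ip (\<gamma> k) d)" by (rule complex_Re_le_cmod)
    also have "\<dots> \<le> cmod (ip (\<gamma> j) d) + cmod (ip (\<gamma> k) d)"
      using norm_triangle_ineq4[of "ip (\<gamma> j) d" "ip (\<gamma> k) d"] by simp
    also have "\<dots> \<le> (r j + r k) * sqrt (sq_norm d)"
      using orth[OF d(1), of j] orth[OF d(1), of k] by (simp add: distrib_right)
    finally have le: "sqrt (sq_norm d) * sqrt (sq_norm d) \<le> (r j + r k) * sqrt (sq_norm d)"
      using sq_norm_nonneg[OF d(2)] by simp
    have "sqrt (sq_norm d) \<le> r j + r k"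
    proof (cases "sq_norm d = 0")
      case True
      then show ?thesis using r(1)[of j] r(1)[of k] by simp
    next
      case False
      then show ?thesis using mult_right_le_imp_le[OF le] sq_norm_nonneg[OF d(2)] by simp
    qed
    then show ?thesis unfolding eq .
  qed
  have ipdiff: "cmod (ip g (\<gamma> j) - ip g (\<gamma> k)) \<le> sqrt (sq_norm g) * (r j + r k)" if "g \<in> Cc S" for g j k
  proof -
    have "ip g (\<gamma> j) - ip g (\<gamma> k) = ip g (\<lambda>z. \<gamma> j z + (-1) * \<gamma> k z)"
      using ip_combination_right[OF \<gamma>(1) \<gamma>(1) that, of j "-1" k] by simp
    also have "cmod \<dots> \<le> sqrt (sq_norm g) * sqrt (sq_norm (\<lambda>z. \<gamma> j z + (-1) * \<gamma> k z))"
      by (rule ip_Cauchy_Schwarz_sqrt[OF that Cc_combination[OF \<gamma>(1) \<gamma>(1)]])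
    also have "\<dots> \<le> sqrt (sq_norm g) * (r j + r k)"
      using diff sq_norm_nonneg[OF that] by (intro mult_left_mono) auto
    finally show ?thesis .
  qed
  have conv: "convergent (\<lambda>j. ip g (\<gamma> j))" if g: "g \<in> Cc S" for g
  proof (rule Cauchy_convergent, rule metric_CauchyI)
    fix e :: real assume e: "e > 0"
    have "(\<lambda>j. sqrt (sq_norm g) * r j) \<longlonglongrightarrow> 0" by (rule tendsto_mult_right_zero[OF r_lim])
    then have "eventually (\<lambda>j. sqrt (sq_norm g) * r j < e / 2) sequentially"
      using e by (intro order_tendstoD) auto
    then obtain M where M: "\<And>j. j \<ge> M \<Longrightarrow> sqrt (sq_norm g) * r j < e / 2"
      by (auto simp: eventually_sequentially)
    have "dist (ip g (\<gamma> j)) (ip g (\<gamma> k)) < e" if "j \<ge> M" "k \<ge> M" for j k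
      using ipdiff[OF g, of j k] M[OF that(1)] M[OF that(2)] by (simp add: dist_norm distrib_left)
    then show "\<exists>M. \<forall>j\<ge>M. \<forall>k\<ge>M. dist (ip g (\<gamma> j)) (ip g (\<gamma> k)) < e" by blast
  qed
  define \<Lambda> where "\<Lambda> g = lim (\<lambda>j. ip g (\<gamma> j))" for g
  have \<Lambda>: "(\<lambda>j. ip g (\<gamma> j)) \<longlonglongrightarrow> \<Lambda> g" if "g \<in> Cc S" for g
    unfolding \<Lambda>_def using conv[OF that] by (simp add: convergent_LIMSEQ_iff)
  have sq_lim: "(\<lambda>j. sq_norm (\<gamma> j)) \<longlonglongrightarrow> m"
  proof (rule tendsto_sandwich[of "\<lambda>_. m" _ _ "\<lambda>j. m + (r j)^2"])
    show "(\<lambda>j. m + (r j)^2) \<longlonglongrightarrow> m" using tendsto_add[OF tendsto_const[of m] tendsto_power[OF r_lim, of 2]] by simp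
  qed (use \<gamma> in auto)
  have \<Lambda>N: "\<Lambda> u = 0" if "u \<in> N" for u
  proof -
    have "(\<lambda>j. ip u (\<gamma> j)) \<longlonglongrightarrow> 0"
    proof (rule Lim_null_comparison)
      show "(\<lambda>j. r j * sqrt (sq_norm u)) \<longlonglongrightarrow> 0" by (rule tendsto_mult_left_zero[OF r_lim])
      show "eventually (\<lambda>j. norm (ip u (\<gamma> j)) \<le> r j * sqrt (sq_norm u)) sequentially"
        using orth[OF that] ip_cnj[of u] by simp
    qed
    then show ?thesis using LIMSEQ_unique[OF \<Lambda>[of u]] that N by auto
  qed
  have \<Lambda>g0: "\<Lambda> g0 = of_real m"
  proof -
    \<comment> \<open>\<open>\<gamma> k\<close> and \<open>g0\<close> differ by an element of
      \<open>N\<close>, so \<open>\<Lambda> g0\<close> may be computed on \<open>\<gamma> k\<close>,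
      whose pairing with \<open>\<gamma> j\<close> is close to
      \<open>sq_norm (\<gamma> j)\<close>.\<close>
    have eq: "\<Lambda> (\<gamma> k) = \<Lambda> g0" for k
    proof -
      have nk: "n k \<in> Cc S" using n N by auto
      have "(\<lambda>j. ip g0 (\<gamma> j) + 1 * ip (n k) (\<gamma> j)) \<longlonglongrightarrow> \<Lambda> g0 + 1 * \<Lambda> (n k)"
        by (intro tendsto_intros \<Lambda> g0 nk)
      also have "(\<lambda>j. ip g0 (\<gamma> j) + 1 * ip (n k) (\<gamma> j)) = (\<lambda>j. ip (\<gamma> k) (\<gamma> j))"
        using ip_combination_left[OF g0 nk \<gamma>(1), of 1] by (simp add: \<gamma>_def)
      finally show ?thesis using LIMSEQ_unique[OF \<Lambda>[OF \<gamma>(1)]] \<Lambda>N[OF n(1)] by fastforce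
    qed
    have bound: "cmod (\<Lambda> g0 - of_real m) \<le> sqrt (m + 1) * r k" for k
    proof -
      have "(\<lambda>j. cmod (ip (\<gamma> k) (\<gamma> j) - of_real (sq_norm (\<gamma> j)))) \<longlonglongrightarrow> cmod (\<Lambda> (\<gamma> k) - of_real m)"
        by (intro tendsto_intros \<Lambda> \<gamma> sq_lim)
      moreover have "(\<lambda>j. sqrt (m + 1) * (r k + r j)) \<longlonglongrightarrow> sqrt (m + 1) * (r k + 0)"
        by (intro tendsto_intros r_lim)
      moreover have "cmod (ip (\<gamma> k) (\<gamma> j) - of_real (sq_norm (\<gamma> j))) \<le> sqrt (m + 1) * (r k + r j)" for j
      proof -
        have "cmod (ip (\<gamma> k) (\<gamma> j) - of_real (sq_norm (\<gamma> j))) = cmod (cnj (ip (\<gamma> j) (\<gamma> k) - ip (\<gamma> j) (\<gamma> j)))"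
          unfolding complex_cnj_diff ip_cnj[of "\<gamma> k" "\<gamma> j"] ip_self by simp
        also have "\<dots> \<le> sqrt (sq_norm (\<gamma> j)) * (r k + r j)"
          unfolding complex_mod_cnj by (rule ipdiff[OF \<gamma>(1)])
        also have "sq_norm (\<gamma> j) \<le> m + 1"
          using \<gamma>(2)[of j] r[of j] power_le_one[of "r j" 2] by linarith
        then have "sqrt (sq_norm (\<gamma> j)) * (r k + r j) \<le> sqrt (m + 1) * (r k + r j)"
          using r(1)[of j] r(1)[of k] by (intro mult_right_mono) auto
        finally show ?thesis .
      qed
      ultimately show ?thesis unfolding eq using LIMSEQ_le by fastforce
    qed
    have "(\<lambda>k. sqrt (m + 1) * r k) \<longlonglongrightarrow> sqrt (m + 1) * 0" by (intro tendsto_intros r_lim)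
    then have "cmod (\<Lambda> g0 - of_real m) \<le> sqrt (m + 1) * 0"
      using bound by (intro LIMSEQ_le_const) auto
    then show ?thesis by simp
  qed
  show ?thesis using that[of \<gamma> \<Lambda>] \<gamma>(1) sq_lim \<Lambda> \<Lambda>N \<Lambda>g0 by blast
qed

end

section \<open>Radial test functions and the space of dbar derivatives\<close>

lemma C2r_norm_square_diff: "C2r S (\<lambda>z. (cmod (z - a))\<^sup>2) (\<lambda>z. cnj (z - a)) (\<lambda>_. 1)"
proof -
  have "wirtinger (\<lambda>z. of_real ((cmod (z - a))^2)) (cnj (z - a)) (cnj (cnj (z - a))) z" for z
    using wirtinger_translate[of "\<lambda>z. of_real ((cmod z)^2)" "cnj (z - a)" "z - a" z "-a"] wirtinger_norm_square[of "z - a"] by simp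
  moreover have "wirtinger (\<lambda>z. cnj (z - a)) 0 1 z" for z
    using wirtinger_cnj[OF wirtinger_diff[OF wirtinger_ident wirtinger_const]] by simp
  ultimately show ?thesis unfolding C2r_def by (intro exI[of _ "\<lambda>_. 0"]) simp
qed

lemma C2w_radial:
  fixes f f1 f2 :: "real \<Rightarrow> real"
  assumes "\<And>t. (f has_real_derivative f1 t) (at t)" "\<And>t. (f1 has_real_derivative f2 t) (at t)" "continuous_on UNIV f2"
  shows "C2w S (\<lambda>z. of_real (f ((cmod (z - a))^2))) (\<lambda>z. of_real (f1 ((cmod (z - a))^2)) * cnj (z - a)) 
    (\<lambda>z. of_real (f1 ((cmod (z - a))^2)) * (z - a))
    (\<lambda>z. of_real (f2 ((cmod (z - a))^2) * (cmod (cnj (z - a)))^2) + of_real (f1 ((cmod (z - a))^2)) * 1)"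
  using C2r_imp_C2w[OF C2r_compose[OF C2r_norm_square_diff, of S f f1 a f2]] assms
  by (auto intro: continuous_on_subset)

lemma C2w_translate:
  assumes "C2w UNIV u p q s"
  shows "C2w UNIV (\<lambda>z. u (z + a)) (\<lambda>z. p (z + a)) (\<lambda>z. q (z + a)) (\<lambda>z. s (z + a))"
proof -
  from assms obtain p1 q2 where
    1: "\<And>z. wirtinger u (p z) (q z) z" "\<And>z. wirtinger p (p1 z) (s z) z"
       "\<And>z. wirtinger q (s z) (q2 z) z" "continuous_on UNIV p1" "continuous_on UNIV s" "continuous_on UNIV q2"
    unfolding C2w_def by blast
  show ?thesis unfolding C2w_def
    by (rule exI[of _ "\<lambda>z. p1 (z + a)"], rule exI[of _ "\<lambda>z. q2 (z + a)"], intro conjI ballI)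
       (auto intro!: wirtinger_translate 1 continuous_on_compose2[OF 1(4)] continuous_on_compose2[OF 1(5)] 
          continuous_on_compose2[OF 1(6)] continuous_intros)
qed

lemma wirtinger_vanishing:
  assumes "\<And>z. wirtinger u (p z) (q z) z" "closed K" "\<And>z. z \<notin> K \<Longrightarrow> u z = 0" "z \<notin> K"
  shows "p z = 0" "q z = 0"
proof -
  have "wirtinger (\<lambda>_. 0) (p z) (q z) z"
    by (rule wirtinger_transform_open[OF assms(1), where S = "- K"]) (use assms in auto)
  from wirtinger_unique[OF this wirtinger_const] show "p z = 0" "q z = 0" by auto
qed

text \<open>Compact support bounds the second derivatives globally, so the first derivatives are
  Lipschitz. The mean value inequality for \<open>u\<close> minus its linear part, on the ball of
  radius \<open>cmod h\<close>, then gives a remainder uniform in \<open>z\<close>; this uniformity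
  allows a bounded functional to be applied to it.\<close>

lemma C2w_second_order:
  assumes u: "C2w UNIV u p q s" and K: "compact K" "\<And>z. z \<notin> K \<Longrightarrow> u z = 0"
  obtains L where "L \<ge> 0" "\<And>z h. cmod (u (z + h) - u z - p z * h - q z * cnj h) \<le> L * (cmod h)^2"
proof -
  from u obtain p1 q2 where
    1: "\<And>z. wirtinger u (p z) (q z) z" "\<And>z. wirtinger p (p1 z) (s z) z"
       "\<And>z. wirtinger q (s z) (q2 z) z" "continuous_on UNIV p1" "continuous_on UNIV s" "continuous_on UNIV q2"
    unfolding C2w_def by blast
  have cl: "closed K" using K by (simp add: compact_imp_closed)
  have p0: "p z = 0" "q z = 0" if "z \<notin> K" for z
    using wirtinger_vanishing[OF 1(1) cl K(2) that] by auto
  have s0: "p1 z = 0" "s z = 0" if "z \<notin> K" for z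
    using wirtinger_vanishing[OF 1(2) cl p0(1) that] by auto
  have q0: "q2 z = 0" if "z \<notin> K" for z
    using wirtinger_vanishing[OF 1(3) cl p0(2) that] by auto
  obtain B1 where B1: "B1 \<ge> 0" "\<And>z. cmod (p1 z) \<le> B1"
    using bounded_continuous_compact_support[OF 1(4) K(1) s0(1)] by blast
  obtain B2 where B2: "B2 \<ge> 0" "\<And>z. cmod (s z) \<le> B2"
    using bounded_continuous_compact_support[OF 1(5) K(1) s0(2)] by blast
  obtain B3 where B3: "B3 \<ge> 0" "\<And>z. cmod (q2 z) \<le> B3"
    using bounded_continuous_compact_support[OF 1(6) K(1) q0] by blast
  have Lp: "cmod (p x - p y) \<le> (B1 + B2) * cmod (x - y)" for x y
    by (rule norm_wirtinger_diff_le[of UNIV p p1 s]) (use 1 B1 B2 in auto)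
  have Lq: "cmod (q x - q y) \<le> (B2 + B3) * cmod (x - y)" for x y
    by (rule norm_wirtinger_diff_le[of UNIV q s q2]) (use 1 B2 B3 in auto)
  show ?thesis
  proof (rule that[of "(B1 + B2) + (B2 + B3)"])
    fix z h
    define v where "v x = u x - (p z * x + q z * cnj x)" for x
    have v: "wirtinger v (p x - p z) (q x - q z) x" for x
      unfolding v_def
      by (rule wirtinger_cong[OF wirtinger_diff[OF 1(1) wirtinger_add[OF wirtinger_mult[OF wirtinger_const wirtinger_ident] wirtinger_mult[OF wirtinger_const wirtinger_cnj[OF wirtinger_ident]]]]]) auto
    have "cmod (v (z + h) - v z) \<le> ((B1 + B2) * cmod h + (B2 + B3) * cmod h) * cmod ((z + h) - z)"
    proof (rule norm_wirtinger_diff_le[of "cball z (cmod h)"])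
      fix x assume "x \<in> cball z (cmod h)"
      then have x: "cmod (x - z) \<le> cmod h" by (simp add: dist_norm norm_minus_commute)
      show "wirtinger v (p x - p z) (q x - q z) x" by (rule v)
      show "cmod (p x - p z) \<le> (B1 + B2) * cmod h"
        using Lp[of x z] mult_left_mono[OF x, of "B1 + B2"] B1 B2 by linarith
      show "cmod (q x - q z) \<le> (B2 + B3) * cmod h"
        using Lq[of x z] mult_left_mono[OF x, of "B2 + B3"] B3 B2 by linarith
    qed (auto simp: dist_norm)
    then show "cmod (u (z + h) - u z - p z * h - q z * cnj h) \<le> (B1 + B2 + (B2 + B3)) * (cmod h)^2"
      by (simp add: v_def algebra_simps power2_eq_square)
  qed (use B1 B2 B3 in auto)
qed

text \<open>With \<open>t\<close> a squared distance and \<open>v > 0\<close>, the parameter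
  \<open>v\<close> is the inverse square of the support radius. Such powers differentiate into one
  another, and by symmetry in \<open>v\<close> and \<open>t\<close> the same rule serves for
  derivatives in \<open>v\<close>.\<close>

definition bump :: "nat \<Rightarrow> real \<Rightarrow> real \<Rightarrow> real" where
  "bump n v t = max 0 (1 - v * t) ^ n"

lemma bump_nonneg: "bump n v t \<ge> 0"
  by (simp add: bump_def)

lemma bump_eq_0: "n > 0 \<Longrightarrow> v * t \<ge> 1 \<Longrightarrow> bump n v t = 0"
  by (simp add: bump_def)

lemma bump_le_1: "v \<ge> 0 \<Longrightarrow> t \<ge> 0 \<Longrightarrow> bump n v t \<le> 1"
  unfolding bump_def by (rule power_le_one) auto

lemma bump_commute: "bump n v t = bump n t v"
  by (simp add: bump_def mult.commute)

lemma bump_0 [simp]: "bump n v 0 = 1"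
  by (simp add: bump_def)

lemma bump_has_derivative:
  assumes "n \<ge> 1"
  shows "(bump (Suc n) v has_real_derivative (- v * real (Suc n)) * bump n v t) (at t)"
proof -
  have "((\<lambda>t. 1 - v * t) has_real_derivative - v) (at t)"
    by (auto intro!: derivative_eq_intros)
  from DERIV_chain2[OF has_real_derivative_max_0_power[OF assms] this]
  show ?thesis unfolding bump_def[abs_def] by (simp add: mult_ac)
qed

lemma continuous_on_bump: "continuous_on A (bump n v)"
  unfolding bump_def[abs_def] by (intro continuous_intros)

text \<open>Two differentiations lower the exponent by two, and \<open>n \<ge> 3\<close> leaves a
  positive exponent, hence a continuous second derivative. The dbar derivative is given explicitly
  because the functional will be evaluated on it.\<close>

lemma C2w_bump:
  assumes "n \<ge> 3"
  obtains p s where "C2w UNIV (\<lambda>z. of_real (c * bump n v ((cmod (z - a))^2))) p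
    (\<lambda>z. of_real (- c * v * real n * bump (n - 1) v ((cmod (z - a))^2)) * (z - a)) s"
proof -
  obtain k where k: "n = Suc (Suc k)" "k \<ge> 1" using assms by (metis Suc_le_D numeral_3_eq_3 Suc_le_mono One_nat_def)
  have d1: "((\<lambda>t. c * bump n v t) has_real_derivative (- c * v * real n * bump (n - 1) v t)) (at t)" for t
    using DERIV_cmult[OF bump_has_derivative[of "n - 1" v t], of c] k by (simp add: mult_ac)
  have d2: "((\<lambda>t. - c * v * real n * bump (n - 1) v t) has_real_derivative 
     (- c * v * real n) * ((- v * real (Suc k)) * bump k v t)) (at t)" for t
    using DERIV_cmult[OF bump_has_derivative[of k v t], of "- c * v * real n"] k by (simp add: mult_ac)
  show ?thesis
    by (rule that, rule C2w_radial[OF d1 d2]) (intro continuous_intros continuous_on_bump)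
qed

definition dbar_space :: "complex set \<Rightarrow> (complex \<Rightarrow> complex) set" where
  "dbar_space S = {q. \<exists>\<beta> p s. C2w UNIV \<beta> p q s \<and> compact_support S \<beta>}"

lemma dbar_space_subset_Cc: "dbar_space S \<subseteq> Cc S"
proof
  fix q assume "q \<in> dbar_space S"
  then obtain \<beta> p s where \<beta>: "C2w UNIV \<beta> p q s" "compact_support S \<beta>"
    unfolding dbar_space_def by blast
  then obtain K where K: "compact K" "K \<subseteq> S" "\<And>z. z \<notin> K \<Longrightarrow> \<beta> z = 0"
    unfolding compact_support_def by blast
  have "q z = 0" if "z \<notin> K" for z
    by (rule wirtinger_vanishing(2)[of \<beta> p q K]) (use C2w_wirtinger[OF \<beta>(1)] K that in \<open>auto intro: compact_imp_closed\<close>)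
  then show "q \<in> Cc S"
    using K C2w_continuous_on[OF \<beta>(1)] unfolding Cc_def compact_support_def by blast
qed

lemma dbar_space_nonempty: "dbar_space S \<noteq> {}"
proof -
  have "(\<lambda>_. 0) \<in> dbar_space S"
    unfolding dbar_space_def compact_support_def using C2w_const[of UNIV 0] by force
  then show ?thesis by blast
qed

lemma dbar_space_combination:
  assumes "q \<in> dbar_space S" "q' \<in> dbar_space S"
  shows "(\<lambda>z. q z + c * q' z) \<in> dbar_space S"
proof -
  from assms(1) obtain \<beta> p s where 1: "C2w UNIV \<beta> p q s" "compact_support S \<beta>"
    unfolding dbar_space_def by blast
  from assms(2) obtain \<beta>' p' s' where 2: "C2w UNIV \<beta>' p' q' s'" "compact_support S \<beta>'"
    unfolding dbar_space_def by blast
  have "C2w UNIV (\<lambda>z. \<beta> z + c * \<beta>' z) (\<lambda>z. p z + (0 * \<beta>' z + c * p' z)) (\<lambda>z. q z + (0 * \<beta>' z + c * q' z))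
     (\<lambda>z. s z + (0 * \<beta>' z + 0 * q' z + 0 * p' z + c * s' z))"
    by (intro C2w_add C2w_mult C2w_const 1 2)
  then show ?thesis
    unfolding dbar_space_def using compact_support_combination[OF 1(2) 2(2), of c] by auto
qed

text \<open>Minus the dbar derivative of \<open>bump 5 v ((cmod (z - a))^2)\<close>, divided by
  \<open>z - a\<close>. The mass is \<open>pi\<close> for every \<open>v > 0\<close>, so integration
  against a holomorphic function gives \<open>pi\<close> times its value at \<open>a\<close>. The
  exponent 4 makes the kernel twice continuously differentiable and, up to a factor, the square of
  \<open>bump 2\<close>.\<close>

definition kernel :: "real \<Rightarrow> complex \<Rightarrow> complex \<Rightarrow> complex" where
  "kernel v a z = of_real (5 * v * bump 4 v ((cmod (z - a))^2))"

lemma bump_outside: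
  assumes "r > 0" "v * r^2 \<ge> 1" "z \<notin> cball a r" "n > 0"
  shows "bump n v ((cmod (z - a))^2) = 0"
proof (rule bump_eq_0)
  have s: "v > 0" using assms by (smt (verit) mult_nonneg_nonneg mult_nonpos_nonneg zero_le_power2)
  have "r \<le> cmod (z - a)" using assms(3) by (simp add: dist_norm norm_minus_commute)
  then have "r\<^sup>2 \<le> (cmod (z - a))\<^sup>2" using assms(1) by (intro power_mono) auto
  then have "v * r^2 \<le> v * (cmod (z - a))^2" using s by (intro mult_left_mono) auto
  then show "1 \<le> v * (cmod (z - a))^2" using assms(2) by linarith
qed fact

lemma compact_support_bump:
  assumes "r > 0" "v * r^2 \<ge> 1" "cball a r \<subseteq> S" "n > 0" 
  shows "compact_support S (\<lambda>z. f z * of_real (c * bump n v ((cmod (z - a))^2)))"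
  unfolding compact_support_def
  by (rule exI[of _ "cball a r"]) (use assms bump_outside[OF assms(1,2) _ assms(4)] in auto)

lemma kernel_in_Cc:
  assumes "r > 0" "v * r^2 \<ge> 1" "cball a r \<subseteq> S"
  shows "kernel v a \<in> Cc S"
proof -
  have "continuous_on UNIV (kernel v a)"
    unfolding kernel_def[abs_def] by (intro continuous_intros continuous_on_compose2[OF continuous_on_bump[of UNIV]]) auto
  moreover have "compact_support S (kernel v a)"
    using compact_support_bump[OF assms, of 4 "\<lambda>_. 1" "5 * v"] by (simp add: kernel_def[abs_def])
  ultimately show ?thesis by (simp add: Cc_def)
qed

lemma quadratic_remainder_bound:
  fixes f f' f'' :: "real \<Rightarrow> real"
  assumes "\<And>x. x \<in> {a..b} \<Longrightarrow> (f has_real_derivative f' x) (at x)"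
    "\<And>x. x \<in> {a..b} \<Longrightarrow> (f' has_real_derivative f'' x) (at x)" "\<And>x. x \<in> {a..b} \<Longrightarrow> \<bar>f'' x\<bar> \<le> L"
    "x \<in> {a..b}" "y \<in> {a..b}"
  shows "\<bar>f y - f x - (y - x) * f' x\<bar> \<le> L * (y - x)^2"
proof -
  have Lip: "norm (f' u - f' v) \<le> L * norm (u - v)" if "u \<in> {a..b}" "v \<in> {a..b}" for u v
    by (rule field_differentiable_bound[of "{a..b}" f' f''])
       (use assms(2,3) that in \<open>auto intro: has_field_derivative_at_within\<close>)
  have L0: "L \<ge> 0" using assms(3,4) by fastforce
  define v where "v u = f u - u * f' x" for u
  have sub: "closed_segment x y \<subseteq> {a..b}" using assms(4,5) by (simp add: closed_segment_subset)
  have "norm (v y - v x) \<le> (L * \<bar>y - x\<bar>) * norm (y - x)"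
  proof (rule field_differentiable_bound[of "closed_segment x y" v "\<lambda>u. f' u - f' x"])
    fix u assume u: "u \<in> closed_segment x y"
    have "(v has_real_derivative f' u - f' x) (at u)"
      unfolding v_def[abs_def] using assms(1)[of u] u sub by (auto intro!: derivative_eq_intros)
    then show "(v has_real_derivative f' u - f' x) (at u within closed_segment x y)"
      by (rule has_field_derivative_at_within)
    have "\<bar>u - x\<bar> \<le> \<bar>y - x\<bar>" using u by (auto simp: closed_segment_eq_real_ivl split: if_splits)
    then have "L * \<bar>u - x\<bar> \<le> L * \<bar>y - x\<bar>" using L0 by (rule mult_left_mono)
    moreover have "norm (f' u - f' x) \<le> L * \<bar>u - x\<bar>" using Lip[of u x] u sub assms(4) by auto
    ultimately show "norm (f' u - f' x) \<le> L * \<bar>y - x\<bar>" by linarith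
  qed auto
  moreover have "v y - v x = f y - f x - (y - x) * f' x" by (simp add: v_def algebra_simps)
  ultimately show ?thesis by (simp add: power2_eq_square mult.assoc flip: abs_mult)
qed

lemma quadratic_imp_constant:
  fixes f :: "real \<Rightarrow> complex"
  assumes "\<And>x y. x \<in> {a..b} \<Longrightarrow> y \<in> {a..b} \<Longrightarrow> cmod (f y - f x) \<le> C * (y - x)^2" and "a \<le> b"
  shows "f a = f b"
proof -
  have "\<exists>c. \<forall>x\<in>{a..b}. f x = c"
  proof (rule has_derivative_zero_constant)
    fix x assume x: "x \<in> {a..b}"
    show "(f has_derivative (\<lambda>h. 0)) (at x within {a..b})"
    proof (rule has_derivativeI_sandwich[of 1 _ _ _ _ "\<lambda>y. C * \<bar>y - x\<bar>"])
      show "norm (f y - f x - 0) / norm (y - x) \<le> C * \<bar>y - x\<bar>" 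
        if "y \<in> {a..b}" "y \<noteq> x" for y
      proof -
        have "(y - x)^2 = \<bar>y - x\<bar> * \<bar>y - x\<bar>" by (simp add: power2_eq_square)
        then show ?thesis using assms(1)[OF x that(1)] that(2) by (simp add: divide_le_eq mult.assoc)
      qed
      have "((\<lambda>y. C * \<bar>y - x\<bar>) \<longlongrightarrow> C * \<bar>x - x\<bar>) (at x within {a..b})" by (intro tendsto_intros)
      then show "((\<lambda>y. C * \<bar>y - x\<bar>) \<longlongrightarrow> 0) (at x within {a..b})" by simp
    qed auto
  qed auto
  then show ?thesis using assms(2) by force
qed

lemma quadratic_imp_field_derivative:
  fixes f :: "complex \<Rightarrow> complex"
  assumes "r > 0" "\<And>h. cmod h < r \<Longrightarrow> cmod (f (a + h) - f a - D * h) \<le> C * (cmod h)^2"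
  shows "(f has_field_derivative D) (at a)"
  unfolding has_field_derivative_def
proof (rule has_derivativeI_sandwich[of r _ _ _ _ "\<lambda>y. C * cmod (y - a)"])
  show "norm (f y - f a - D * (y - a)) / norm (y - a) \<le> C * cmod (y - a)" 
    if "y \<noteq> a" "dist y a < r" for y
  proof -
    have "cmod (f (a + (y - a)) - f a - D * (y - a)) \<le> C * (cmod (y - a))^2"
      using that by (intro assms(2)) (simp add: dist_norm)
    then show ?thesis using that(1) by (simp add: divide_le_eq power2_eq_square mult.assoc)
  qed
  have "((\<lambda>y. C * cmod (y - a)) \<longlongrightarrow> C * cmod (a - a)) (at a)" by (intro tendsto_intros)
  then show "((\<lambda>y. C * cmod (y - a)) \<longlongrightarrow> 0) (at a)" by simp
qed (use assms bounded_linear_mult_right in auto)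

section \<open>Weyl's lemma for a functional that annihilates dbar derivatives\<close>

locale dbar_annihilator = weighted_space +
  fixes \<Lambda> :: "(complex \<Rightarrow> complex) \<Rightarrow> complex" and \<gamma> :: "nat \<Rightarrow> complex \<Rightarrow> complex" and m :: real
  assumes \<gamma>_Cc: "\<And>j. \<gamma> j \<in> Cc S" and sq_norm_\<gamma>: "(\<lambda>j. sq_norm (\<gamma> j)) \<longlonglongrightarrow> m"
    and \<Lambda>_lim: "\<And>g. g \<in> Cc S \<Longrightarrow> (\<lambda>j. ip g (\<gamma> j)) \<longlonglongrightarrow> \<Lambda> g"
    and \<Lambda>_dbar: "\<And>n. n \<in> dbar_space S \<Longrightarrow> \<Lambda> n = 0"
begin

lemma m_nonneg: "m \<ge> 0"
  using LIMSEQ_le_const[OF sq_norm_\<gamma>] sq_norm_nonneg[OF \<gamma>_Cc] by blast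

lemma \<Lambda>_combination:
  assumes "u \<in> Cc S" "v \<in> Cc S"
  shows "\<Lambda> (\<lambda>z. u z + c * v z) = \<Lambda> u + c * \<Lambda> v"
proof -
  have "(\<lambda>j. ip u (\<gamma> j) + c * ip v (\<gamma> j)) \<longlonglongrightarrow> \<Lambda> u + c * \<Lambda> v"
    by (intro tendsto_intros \<Lambda>_lim assms)
  also have "(\<lambda>j. ip u (\<gamma> j) + c * ip v (\<gamma> j)) = (\<lambda>j. ip (\<lambda>z. u z + c * v z) (\<gamma> j))"
    using ip_combination_left[OF assms \<gamma>_Cc] by simp
  finally show ?thesis using LIMSEQ_unique[OF \<Lambda>_lim[OF Cc_combination[OF assms]]] by blast
qed

lemma \<Lambda>_bound:
  assumes "u \<in> Cc S"
  shows "(cmod (\<Lambda> u))^2 \<le> sq_norm u * m"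
proof (rule LIMSEQ_le)
  show "(\<lambda>j. (cmod (ip u (\<gamma> j)))\<^sup>2) \<longlonglongrightarrow> (cmod (\<Lambda> u))\<^sup>2" by (intro tendsto_intros \<Lambda>_lim assms)
  show "(\<lambda>j. sq_norm u * sq_norm (\<gamma> j)) \<longlonglongrightarrow> sq_norm u * m" by (intro tendsto_intros sq_norm_\<gamma>)
qed (use ip_Cauchy_Schwarz[OF assms \<gamma>_Cc] in auto)

definition weight_norm :: "complex set \<Rightarrow> real" where
  "weight_norm K = sqrt ((LINT z|lborel. indicator K z * W z) * m)"

text \<open>A uniform remainder estimate on one fixed compact set becomes an estimate for
  \<open>\<Lambda>\<close>. This is how \<open>\<Lambda>\<close> of a kernel is differentiated with
  respect to the centre and to \<open>v\<close>.\<close>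

lemma \<Lambda>_uniform_bound:
  assumes u: "u \<in> Cc S" and K: "compact K" "K \<subseteq> S" "\<And>z. z \<notin> K \<Longrightarrow> u z = 0" and B: "\<And>z. cmod (u z) \<le> B"
  shows "cmod (\<Lambda> u) \<le> B * weight_norm K"
proof -
  have B0: "B \<ge> 0" using B[of 0] norm_ge_zero order_trans by blast
  have intW: "integrable lborel (\<lambda>z. indicator K z * W z)"
    using K by (intro integrable_indicator_mult continuous_on_subset[OF cont_W])
  have "sq_norm u \<le> (LINT z|lborel. B\<^sup>2 * (indicator K z * W z))"
    unfolding sq_norm_def
  proof (rule integral_mono[OF sq_norm_integrable[OF u]])
    show "integrable lborel (\<lambda>z. B\<^sup>2 * (indicator K z * W z))" using intW by simp
    show "(cmod (u z))^2 * W z \<le> B^2 * (indicator K z * W z)" for z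
    proof (cases "z \<in> K")
      case True
      then have "W z > 0" using K W_pos by auto
      moreover have "(cmod (u z))^2 \<le> B^2" using B by (intro power_mono) auto
      ultimately show ?thesis using True by simp
    qed (use K in simp)
  qed
  then have "sq_norm u \<le> B^2 * (LINT z|lborel. indicator K z * W z)" by simp
  then have "sq_norm u * m \<le> B^2 * (LINT z|lborel. indicator K z * W z) * m"
    using m_nonneg by (rule mult_right_mono)
  then have "(cmod (\<Lambda> u))^2 \<le> B^2 * ((LINT z|lborel. indicator K z * W z) * m)"
    using \<Lambda>_bound[OF u] by (simp add: mult.assoc)
  from real_sqrt_le_mono[OF this] show ?thesis using B0 by (simp add: weight_norm_def real_sqrt_mult)
qed

text \<open>Moving the centre by \<open>h\<close> changes the kernel by
  \<open>- h * pa z - cnj h * qa z\<close> up to a quadratic error. Here \<open>qa\<close> is the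
  dbar derivative of the kernel, itself a test function, so \<open>\<Lambda>\<close> annihilates it
  and only the complex linear term survives: these are the Cauchy-Riemann equations.\<close>

lemma \<Lambda>_kernel_field_differentiable:
  assumes r: "r > 0" "v * r^2 \<ge> 1" "cball a (2 * r) \<subseteq> S"
  shows "(\<lambda>z. \<Lambda> (kernel v z)) field_differentiable (at a)"
proof -
  have "\<exists>p q s. C2w UNIV (kernel v 0) p q s"
    unfolding kernel_def[abs_def] by (rule C2w_bump[of 4 "5 * v" v 0]) (simp, blast)
  then obtain p q s where u: "C2w UNIV (kernel v 0) p q s" by blast
  have u0: "kernel v 0 z = 0" if "z \<notin> cball 0 r" for z
    using bump_outside[OF r(1,2) that, of 4] by (simp add: kernel_def)
  obtain L where L: "L \<ge> 0" "\<And>z h. cmod (kernel v 0 (z + h) - kernel v 0 z - p z * h - q z * cnj h) \<le> L * (cmod h)^2"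
    using C2w_second_order[OF u compact_cball u0] by blast
  define pa where "pa z = p (z - a)" for z
  define qa where "qa z = q (z - a)" for z
  have ua: "C2w UNIV (\<lambda>z. kernel v 0 (z - a)) pa qa (\<lambda>z. s (z - a))"
    using C2w_translate[OF u, of "- a"] by (simp add: pa_def[abs_def] qa_def[abs_def])
  have ua0: "kernel v 0 (z - a) = 0" if "z \<notin> cball a r" for z
    using u0[of "z - a"] that by (simp add: dist_norm norm_minus_commute)
  have pq0: "pa z = 0" "qa z = 0" if "z \<notin> cball a r" for z
    using wirtinger_vanishing[of "\<lambda>z. kernel v 0 (z - a)" pa qa "cball a r", OF _ _ ua0 that] C2w_wirtinger[OF ua] by auto
  have sub: "cball a r \<subseteq> S" using r by (auto intro: subset_trans[OF subset_cball])
  have "compact_support S (\<lambda>z. kernel v 0 (z - a))"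
    unfolding compact_support_def by (rule exI[of _ "cball a r"]) (use sub ua0 in auto)
  then have qN: "qa \<in> dbar_space S"
    unfolding dbar_space_def mem_Collect_eq using ua by blast
  then have qC: "qa \<in> Cc S" using dbar_space_subset_Cc by auto
  have "compact_support S pa"
    unfolding compact_support_def by (rule exI[of _ "cball a r"]) (use sub pq0 in auto)
  then have pC: "pa \<in> Cc S"
    unfolding Cc_def using C2w_continuous_on(2)[OF ua] by simp
  have "((\<lambda>z. \<Lambda> (kernel v z)) has_field_derivative (- \<Lambda> pa)) (at a)"
  proof (rule quadratic_imp_field_derivative[OF r(1)])
    fix h assume h: "cmod h < r"
    \<comment> \<open>Twice the radius, so that all kernels centred at \<open>a + h\<close> live on
      one compact set and the error constant does not depend on \<open>h\<close>.\<close>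
    define K where "K = cball a (2 * r)"
    have subh: "cball (a + h) r \<subseteq> K"
    proof
      fix x assume "x \<in> cball (a + h) r"
      moreover have "dist a x \<le> dist a (a + h) + dist (a + h) x" by (rule dist_triangle)
      ultimately show "x \<in> K" using h by (simp add: K_def dist_norm)
    qed
    have kC: "kernel v (a + h) \<in> Cc S" "kernel v a \<in> Cc S"
      using r sub subh by (auto intro!: kernel_in_Cc[of r] simp: K_def)
    define A where "A = (\<lambda>z. kernel v (a + h) z + (-1) * kernel v a z)"
    define A' where "A' = (\<lambda>z. A z + h * pa z)"
    define R where "R = (\<lambda>z. A' z + cnj h * qa z)"
    have AC: "A \<in> Cc S" "A' \<in> Cc S" "R \<in> Cc S"
      unfolding R_def A'_def A_def by (intro Cc_combination kC pC qC)+
    have "\<Lambda> R = \<Lambda> A' + cnj h * \<Lambda> qa" unfolding R_def by (rule \<Lambda>_combination[OF AC(2) qC])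
    also have "\<Lambda> A' = \<Lambda> A + h * \<Lambda> pa" unfolding A'_def by (rule \<Lambda>_combination[OF AC(1) pC])
    also have "\<Lambda> A = \<Lambda> (kernel v (a + h)) + (-1) * \<Lambda> (kernel v a)" unfolding A_def by (rule \<Lambda>_combination[OF kC])
    also have "\<Lambda> qa = 0" by (rule \<Lambda>_dbar[OF qN])
    finally have eq: "\<Lambda> R = \<Lambda> (kernel v (a + h)) - \<Lambda> (kernel v a) - (- \<Lambda> pa) * h" by simp
    have kt: "kernel v b z = kernel v 0 (z - b)" for b z by (simp add: kernel_def)
    have "cmod (\<Lambda> R) \<le> (L * (cmod h)^2) * weight_norm K"
    proof (rule \<Lambda>_uniform_bound[OF AC(3)])
      show "compact K" "K \<subseteq> S" using r by (auto simp: K_def)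
      show "R z = 0" if "z \<notin> K" for z
      proof -
        have "z \<notin> cball a r" "z \<notin> cball (a + h) r" using that subh r by (auto simp: K_def)
        then show ?thesis using pq0[of z] bump_outside[OF r(1,2), of z _ 4]
          by (simp add: R_def A'_def A_def kernel_def)
      qed
      show "cmod (R z) \<le> L * (cmod h)^2" for z
      proof -
        have "R z = kernel v 0 ((z - a) + (- h)) - kernel v 0 (z - a) - p (z - a) * (- h) - q (z - a) * cnj (- h)"
          by (simp add: R_def A'_def A_def kt[of "a + h"] kt[of a] pa_def qa_def algebra_simps)
        also have "cmod \<dots> \<le> L * (cmod (- h))^2" by (rule L)
        finally show ?thesis by simp
      qed
    qed
    then show "cmod (\<Lambda> (kernel v (a + h)) - \<Lambda> (kernel v a) - (- \<Lambda> pa) * h) \<le> (L * weight_norm K) * (cmod h)^2"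
      unfolding eq by (simp add: mult_ac)
  qed
  then show ?thesis by (auto simp: field_differentiable_def)
qed

text \<open>The derivative of the kernel with respect to \<open>v\<close> is a \<open>\<partial>\<close>-bar derivative of a test function.\<close>
lemma \<Lambda>_kernel_independent:
  assumes r: "r > 0" "v1 * r^2 \<ge> 1" "cball a r \<subseteq> S" and "v1 \<le> v2"
  shows "\<Lambda> (kernel v1 a) = \<Lambda> (kernel v2 a)"
proof (rule quadratic_imp_constant[OF _ \<open>v1 \<le> v2\<close>])
  fix v v' assume v: "v \<in> {v1..v2}" and v': "v' \<in> {v1..v2}"
  have s1: "v1 > 0" using r by (smt (verit) mult_nonneg_nonneg mult_nonpos_nonneg zero_le_power2)
  have ge: "1 \<le> x * r^2" if "x \<in> {v1..v2}" for x
    using that r(2) by (smt (verit) atLeastAtMost_iff mult_right_mono zero_le_power2)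
  define K where "K = cball a r"
  define d where "d z = complex_of_real (5 * bump 4 v ((cmod (z - a))^2) - 20 * v * (cmod (z - a))^2 * bump 3 v ((cmod (z - a))^2))" for z
  \<comment> \<open>The test function is \<open>cnj (z - a)\<close> times
    \<open>5 * bump 4 v ((cmod (z - a))^2)\<close>. Its dbar derivative \<open>d\<close> agrees with
    the derivative of \<open>5 * v * bump 4 v t\<close> in \<open>v\<close> at
    \<open>t = (cmod (z - a))^2\<close>.\<close>
  have dN: "d \<in> dbar_space S"
  proof -
    obtain p s where u: "C2w UNIV (\<lambda>z. of_real (5 * bump 4 v ((cmod (z - a))^2))) p
       (\<lambda>z. of_real (- 5 * v * real 4 * bump (4 - 1) v ((cmod (z - a))^2)) * (z - a)) s" (is "C2w UNIV ?u p ?q s")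
      by (rule C2w_bump[of 4 5 v a, OF _ that]) simp
    have c: "C2w UNIV (\<lambda>z. cnj z + (- cnj a)) (\<lambda>_. 0 + 0) (\<lambda>_. 1 + 0) (\<lambda>_. 0 + 0)"
      by (intro C2w_add C2w_cnj_ident C2w_const)
    have "compact_support S (\<lambda>z. (cnj z + (- cnj a)) * ?u z)"
      using compact_support_bump[OF r(1) ge[OF v] r(3), of 4 "\<lambda>z. cnj z + (- cnj a)" 5] by simp
    moreover have "(\<lambda>z. (1 + 0) * ?u z + (cnj z + (- cnj a)) * ?q z) = d"
    proof
      fix z
      have "(cnj z + (- cnj a)) * (z - a) = of_real ((cmod (z - a))^2)"
        unfolding complex_norm_square by (simp add: mult.commute)
      then have "(cnj z + (- cnj a)) * ?q z = of_real (- 20 * v * bump 3 v ((cmod (z - a))^2)) * of_real ((cmod (z - a))^2)"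
        by (simp add: mult.left_commute[of "cnj z + (- cnj a)"] mult.commute[of "of_real ((cmod (z - a))^2)"])
      then show "(1 + 0) * ?u z + (cnj z + (- cnj a)) * ?q z = d z"
        by (simp add: d_def mult_ac)
    qed
    ultimately show ?thesis unfolding dbar_space_def using C2w_mult[OF c u] by auto
  qed
  then have dC: "d \<in> Cc S" using dbar_space_subset_Cc by auto
  have kC: "kernel v a \<in> Cc S" "kernel v' a \<in> Cc S"
    using r v v' ge by (auto intro!: kernel_in_Cc[of r])
  define A where "A = (\<lambda>z. kernel v' a z + (-1) * kernel v a z)"
  define R where "R = (\<lambda>z. A z + (- of_real (v' - v)) * d z)"
  have AC: "A \<in> Cc S" "R \<in> Cc S"
    unfolding R_def A_def by (intro Cc_combination kC dC)+
  have "\<Lambda> R = \<Lambda> A + (- of_real (v' - v)) * \<Lambda> d" unfolding R_def by (rule \<Lambda>_combination[OF AC(1) dC])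
  also have "\<Lambda> d = 0" by (rule \<Lambda>_dbar[OF dN])
  also have "\<Lambda> A = \<Lambda> (kernel v' a) + (-1) * \<Lambda> (kernel v a)" unfolding A_def by (rule \<Lambda>_combination[OF kC(2,1)])
  finally have eq: "\<Lambda> R = \<Lambda> (kernel v' a) - \<Lambda> (kernel v a)" by simp
  \<comment> \<open>A bound for the second derivative in \<open>v\<close>, which is
    \<open>- 40 * t * bump 3 t v + 60 * v * t^2 * bump 2 t v\<close>, over
    \<open>t \<le> r^2\<close> and \<open>v \<le> v2\<close>.\<close>
  define L where "L = 40 * r^2 + 60 * v2 * (r^2)^2"
  have "cmod (\<Lambda> R) \<le> (L * (v' - v)^2) * weight_norm K"
  proof (rule \<Lambda>_uniform_bound[OF AC(2)])
    show "compact K" "K \<subseteq> S" using r by (auto simp: K_def)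
    have off: "R z = 0" if "z \<notin> K" for z
      using bump_outside[OF r(1) ge[OF v], of z a] bump_outside[OF r(1) ge[OF v'], of z a] that
      by (simp add: R_def A_def kernel_def d_def K_def)
    then show "R z = 0" if "z \<notin> K" for z using that .
    show "cmod (R z) \<le> L * (v' - v)^2" for z
    proof (cases "z \<in> K")
      case True
      define t where "t = (cmod (z - a))^2"
      have t: "0 \<le> t" "t \<le> r^2" using True r by (auto simp: t_def K_def dist_norm norm_minus_commute intro: power_mono)
      have dn: "(bump (Suc n) t has_real_derivative (- t * real (Suc n)) * bump n t x) (at x)" if "n \<ge> 1" for n x
        using that by (rule bump_has_derivative)
      have d4: "(bump 4 t has_real_derivative (- 4 * t) * bump 3 t x) (at x)" for x
        using dn[of 3 x] by (simp add: numeral_eq_Suc algebra_simps)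
      have d3: "(bump 3 t has_real_derivative (- 3 * t) * bump 2 t x) (at x)" for x
        using dn[of 2 x] by (simp add: numeral_eq_Suc algebra_simps)
      have "\<bar>5 * v' * bump 4 t v' - 5 * v * bump 4 t v - (v' - v) * (5 * bump 4 t v - 20 * v * t * bump 3 t v)\<bar>
          \<le> L * (v' - v)^2"
      proof (rule quadratic_remainder_bound[OF _ _ _ v v'])
        fix x assume x: "x \<in> {v1..v2}"
        show "((\<lambda>x. 5 * x * bump 4 t x) has_real_derivative (5 * bump 4 t x - 20 * x * t * bump 3 t x)) (at x)"
          by (auto intro!: derivative_eq_intros d4 simp: algebra_simps)
        show "((\<lambda>x. 5 * bump 4 t x - 20 * x * t * bump 3 t x) has_real_derivative
           (- 40 * t * bump 3 t x + 60 * x * t^2 * bump 2 t x)) (at x)"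
          by (auto intro!: derivative_eq_intros d4 d3 simp: algebra_simps power2_eq_square)
        have x0: "0 \<le> x" "x \<le> v2" using x s1 by auto
        have b: "bump 3 t x \<le> 1" "bump 2 t x \<le> 1" "bump 3 t x \<ge> 0" "bump 2 t x \<ge> 0"
          using t x0 by (auto intro!: bump_le_1 bump_nonneg)
        have "\<bar>- 40 * t * bump 3 t x + 60 * x * t^2 * bump 2 t x\<bar> \<le> 40 * t * bump 3 t x + 60 * x * t^2 * bump 2 t x"
          using t x0 b by (simp add: abs_le_iff)
        also have "\<dots> \<le> 40 * r^2 * 1 + 60 * v2 * (r^2)^2 * 1"
          using t x0 b by (intro add_mono mult_mono power_mono) auto
        finally show "\<bar>- 40 * t * bump 3 t x + 60 * x * t^2 * bump 2 t x\<bar> \<le> L" by (simp add: L_def)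
      qed
      moreover have "R z = of_real (5 * v' * bump 4 t v' - 5 * v * bump 4 t v - (v' - v) * (5 * bump 4 t v - 20 * v * t * bump 3 t v))"
        unfolding R_def A_def kernel_def d_def t_def[symmetric] bump_commute[of 4 t] bump_commute[of 3 t]
        by (simp add: algebra_simps)
      ultimately show ?thesis by (simp only: norm_of_real)
    next
      case False
      have "L \<ge> 0" using s1 assms(4) by (simp add: L_def)
      then show ?thesis using off[OF False] by simp
    qed
  qed
  then show "cmod (\<Lambda> (kernel v' a) - \<Lambda> (kernel v a)) \<le> (L * weight_norm K) * (v' - v)^2"
    unfolding eq by (simp add: mult_ac)
qed

end

section \<open>The holomorphic representative and its weighted square integral\<close>

context dbar_annihilator
begin

definition admissible :: "complex \<Rightarrow> real \<Rightarrow> bool" where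
  "admissible a v \<longleftrightarrow> (\<exists>r>0. cball a r \<subseteq> S \<and> v * r^2 \<ge> 1)"

text \<open>By Weyl's lemma \<open>\<Lambda>\<close> is represented by a holomorphic function.\<close>
definition rep :: "complex \<Rightarrow> complex" where
  "rep a = \<Lambda> (kernel (SOME v. admissible a v) a)"

lemma rep_eq:
  assumes "r > 0" "cball a r \<subseteq> S" "v * r^2 \<ge> 1"
  shows "rep a = \<Lambda> (kernel v a)"
proof -
  \<comment> \<open>Two admissible parameters are comparable, and admissibility of the smaller one
    suffices to join them; hence the choice made in \<open>rep\<close> is immaterial.\<close>
  have ind: "\<Lambda> (kernel v1 a) = \<Lambda> (kernel v2 a)" if "admissible a v1" "v1 \<le> v2" for v1 v2
    using that \<Lambda>_kernel_independent unfolding admissible_def by blast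
  have g: "admissible a v" using assms by (auto simp: admissible_def)
  then have g': "admissible a (SOME v. admissible a v)" by (rule someI)
  show ?thesis unfolding rep_def using ind[OF g] ind[OF g'] by (metis linear)
qed

lemma rep_holomorphic: "rep holomorphic_on S"
proof -
  have "rep field_differentiable (at a)" if a: "a \<in> S" for a
  proof -
    obtain e where e: "e > 0" "cball a e \<subseteq> S" using open_S a open_contains_cball by blast
    define r where "r = e / 2"
    have r: "r > 0" "cball a (2 * r) \<subseteq> S" using e by (auto simp: r_def)
    define v where "v = 1 / r^2"
    have v: "v * r^2 \<ge> 1" using r by (simp add: v_def)
    obtain D where D: "((\<lambda>z. \<Lambda> (kernel v z)) has_field_derivative D) (at a)"
      using \<Lambda>_kernel_field_differentiable[OF r(1) v r(2)] unfolding field_differentiable_def by blast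
    have "(rep has_field_derivative D) (at a)"
    proof (rule has_field_derivative_transform_within_open[OF D, of "ball a r"])
      fix x assume x: "x \<in> ball a r"
      have "cball x r \<subseteq> S"
      proof
        fix y assume "y \<in> cball x r"
        moreover have "dist a y \<le> dist a x + dist x y" by (rule dist_triangle)
        ultimately have "y \<in> cball a (2 * r)" using x by simp
        then show "y \<in> S" using r by auto
      qed
      then show "\<Lambda> (kernel v x) = rep x" using rep_eq[OF r(1) _ v] by simp
    qed (use r in auto)
    then show ?thesis by (auto simp: field_differentiable_def)
  qed
  then show ?thesis unfolding holomorphic_on_def using field_differentiable_at_within by blast
qed

lemma sq_norm_nn_integral:
  assumes "u \<in> Cc S"
  shows "(\<integral>\<^sup>+z. ennreal ((cmod (u z))^2 * W z) \<partial>lborel) = ennreal (sq_norm u)"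
  unfolding sq_norm_def
proof (rule nn_integral_eq_integral[OF sq_norm_integrable[OF assms]])
  have "0 \<le> (cmod (u z))\<^sup>2 * W z" for z
  proof -
    have "u z = 0 \<or> z \<in> S" using assms unfolding Cc_def compact_support_def by blast
    then show ?thesis using W_pos[of z] by auto
  qed
  then show "AE z in lborel. 0 \<le> (cmod (u z))\<^sup>2 * W z" by simp
qed

text \<open>Splitting the kernel as the square of \<open>k\<close> and applying Cauchy-Schwarz to
  \<open>k\<close> and \<open>k * g\<close> keeps the mass of \<open>g\<close> localised near
  \<open>a\<close>, so that the bound can afterwards be integrated over \<open>a\<close>. The
  constant is the product of \<open>5 * v\<close> (bound for the square of \<open>k\<close>),
  \<open>2 * W a\<close> and the area \<open>pi * r^2\<close>, with
  \<open>v * r^2 = 1\<close>.\<close>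

lemma pair_kernel_bound:
  assumes r: "r > 0" "cball a r \<subseteq> S" "v * r^2 = 1" and W: "\<And>z. z \<in> cball a r \<Longrightarrow> W z \<le> 2 * W a" and g: "g \<in> Cc S"
  shows "ennreal ((cmod (ip (kernel v a) g))^2 / W a) \<le> 
     ennreal (10 * pi) * (\<integral>\<^sup>+z. ennreal (5 * v * bump 4 v ((cmod (z - a))^2)) * ennreal ((cmod (g z))^2 * W z) \<partial>lborel)"
proof -
  have v: "v > 0" using r by (metis less_numeral_extra(1) zero_less_mult_pos2 zero_less_power)
  have aS: "a \<in> S" using r by auto
  note Wa = W_pos[OF aS]
  define k where "k z = complex_of_real (sqrt (5 * v) * bump 2 v ((cmod (z - a))^2))" for z
  have kc: "continuous_on UNIV k"
    unfolding k_def[abs_def] by (intro continuous_intros continuous_on_compose2[OF continuous_on_bump[of UNIV]]) auto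
  have "compact_support S k"
    using compact_support_bump[of r v a S 2 "\<lambda>_. 1" "sqrt (5 * v)"] r by (simp add: k_def[abs_def])
  then have kC: "k \<in> Cc S" using kc by (simp add: Cc_def)
  have kgC: "(\<lambda>z. k z * g z) \<in> Cc S" by (rule Cc_mult[OF kc g])
  have b4: "bump 4 v t = bump 2 v t * bump 2 v t" for t by (simp add: bump_def flip: power_add)
  have sq: "sqrt (5 * v) * sqrt (5 * v) = 5 * v" using v by simp
  have kk: "k z * cnj (k z * w) = kernel v a z * cnj w" for z w
  proof -
    have "k z * cnj (k z * w) = of_real ((sqrt (5 * v) * sqrt (5 * v)) * (bump 2 v ((cmod (z - a))^2) * bump 2 v ((cmod (z - a))^2))) * cnj w"
      by (simp only: k_def complex_cnj_mult complex_cnj_complex_of_real of_real_mult mult_ac)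
    then show ?thesis unfolding sq b4[symmetric] by (simp add: kernel_def)
  qed
  have ksq: "(cmod (k z))^2 = 5 * v * bump 4 v ((cmod (z - a))^2)" for z
  proof -
    have "(cmod (k z))^2 = (sqrt (5 * v) * sqrt (5 * v)) * (bump 2 v ((cmod (z - a))^2) * bump 2 v ((cmod (z - a))^2))"
      unfolding k_def norm_of_real power2_abs by (simp add: power2_eq_square mult_ac)
    then show ?thesis unfolding sq b4[symmetric] .
  qed
  have "ip (kernel v a) g = ip k (\<lambda>z. k z * g z)"
    unfolding ip_def kk ..
  then have "(cmod (ip (kernel v a) g))^2 \<le> sq_norm k * sq_norm (\<lambda>z. k z * g z)"
    using ip_Cauchy_Schwarz[OF kC kgC] by simp
  also have "sq_norm k \<le> 10 * pi * W a"
  proof -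
    have "sq_norm k \<le> (LINT z|lborel. indicator (cball a r) z * (10 * v * W a))"
      unfolding sq_norm_def
    proof (rule integral_mono[OF sq_norm_integrable[OF kC]])
      show "integrable lborel (\<lambda>z. indicator (cball a r) z * (10 * v * W a))"
        by (intro integrable_indicator_mult continuous_intros) auto
      fix z
      show "(cmod (k z))^2 * W z \<le> indicator (cball a r) z * (10 * v * W a)"
      proof (cases "z \<in> cball a r")
        case True
        then have "0 < W z" using r W_pos by auto
        have "(cmod (k z))^2 \<le> 5 * v * 1"
          unfolding ksq using v by (intro mult_left_mono bump_le_1) auto
        then have "(cmod (k z))^2 * W z \<le> (5 * v * 1) * (2 * W a)"
          using W[OF True] \<open>0 < W z\<close> v by (intro mult_mono) auto
        then show ?thesis using True by simp
      next
        case False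
        then show ?thesis unfolding ksq using bump_outside[OF r(1) _ False, of v 4] r by simp
      qed
    qed
    also have "\<dots> = pi * r^2 * (10 * v * W a)"
      using r by (simp add: content_cball unit_ball_vol_2)
    also have "\<dots> = 10 * pi * W a * (v * r^2)" by (simp add: mult_ac)
    finally show ?thesis using r by simp
  qed
  then have "sq_norm k * sq_norm (\<lambda>z. k z * g z) \<le> 10 * pi * W a * sq_norm (\<lambda>z. k z * g z)"
    using sq_norm_nonneg[OF kgC] by (rule mult_right_mono)
  finally have "(cmod (ip (kernel v a) g))^2 / W a \<le> 10 * pi * sq_norm (\<lambda>z. k z * g z)"
    using Wa by (simp add: divide_le_eq mult_ac)
  then have "ennreal ((cmod (ip (kernel v a) g))^2 / W a) \<le> ennreal (10 * pi) * ennreal (sq_norm (\<lambda>z. k z * g z))"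
    by (simp add: ennreal_leI flip: ennreal_mult')
  also have "ennreal (sq_norm (\<lambda>z. k z * g z)) = 
     (\<integral>\<^sup>+z. ennreal (5 * v * bump 4 v ((cmod (z - a))^2)) * ennreal ((cmod (g z))^2 * W z) \<partial>lborel)"
    unfolding sq_norm_nn_integral[OF kgC, symmetric]
    by (intro nn_integral_cong) 
       (use v in \<open>simp add: norm_mult power_mult_distrib ksq bump_nonneg mult.assoc flip: ennreal_mult'\<close>)
  finally show ?thesis .
qed

text \<open>Formally \<open>rep\<close> is \<open>pi\<close> times the conjugate of the minimiser
  times \<open>W\<close>, which would give \<open>pi^2 * m\<close>. The factor 50 is lost in two
  places: \<open>10 * pi\<close> comes from the local Cauchy-Schwarz bound, and
  \<open>5 * pi\<close> from estimating the mass of the kernel by its maximum times the area of its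
  support. Fatou's lemma carries the bound from \<open>\<gamma> j\<close> to the limit.\<close>

lemma rep_nn_integral_compact:
  assumes K: "compact K" "K \<subseteq> S"
  shows "(\<integral>\<^sup>+z. indicator K z * ennreal ((cmod (rep z))^2 / W z) \<partial>lborel) \<le> ennreal (50 * pi^2 * m)"
proof (cases "K = {}")
  case False
  obtain r0 where r0: "r0 > 0" "(\<Union>x\<in>K. cball x r0) \<subseteq> S"
    using compact_subset_open_imp_cball_epsilon_subset[OF K(1) open_S K(2)] by metis
  define K' where "K' = (\<Union>x\<in>K. cball x r0)"
  have K': "compact K'" "K' \<subseteq> S" "K' \<noteq> {}" "K \<subseteq> K'"
    using compact_minkowski_sum_cball[OF K(1)] r0 False by (auto simp: K'_def)
  have cW: "continuous_on K' W" using cont_W K' continuous_on_subset by blast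
  obtain x0 where x0: "x0 \<in> K'" "\<And>x. x \<in> K' \<Longrightarrow> W x0 \<le> W x"
    using continuous_attains_inf[OF K'(1,3) cW] by blast
  have w0: "W x0 > 0" using x0 K' W_pos by auto
  \<comment> \<open>\<open>W x0\<close> is the minimum on the enlarged compact set, so an
    oscillation below \<open>W x0\<close> means that \<open>W\<close> at most doubles.\<close>
  obtain d where d: "d > 0" "\<And>x x'. x \<in> K' \<Longrightarrow> x' \<in> K' \<Longrightarrow> dist x' x < d \<Longrightarrow> dist (W x') (W x) < W x0"
    using compact_uniformly_continuous[OF cW K'(1)] w0 unfolding uniformly_continuous_on_def by metis
  define r where "r = min r0 (d / 2)"
  have r: "r > 0" "r \<le> r0" "r < d" using r0 d by (auto simp: r_def)
  have sub: "cball z r \<subseteq> K'" if "z \<in> K" for z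
    using that r subset_cball[of r r0 z] by (auto simp: K'_def)
  have W2: "W x \<le> 2 * W z" if "z \<in> K" "x \<in> cball z r" for x z
  proof -
    have "dist (W x) (W z) < W x0" 
    proof (rule d(2))
      show "z \<in> K'" "x \<in> K'" using sub[OF that(1)] that K' by auto
      show "dist x z < d" using that r by (simp add: dist_commute)
    qed
    then show ?thesis using x0(2)[of z] that K' by (auto simp: dist_real_def)
  qed
  define v where "v = 1 / r^2"
  have v: "v * r^2 = 1" "v > 0" using r by (auto simp: v_def)
  define b where "b z x = 5 * v * bump 4 v ((cmod (x - z))^2)" for z x
  define h where "h j z = (cmod (ip (kernel v z) (\<gamma> j)))^2 / W z" for j z
  have [measurable]: "(\<lambda>z. (cmod (\<gamma> j z))\<^sup>2 * W z) \<in> borel_measurable borel" for j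
    using borel_measurable_integrable[OF sq_norm_integrable[OF \<gamma>_Cc]] by simp
  have bm: "(\<lambda>(z, x). b z x) \<in> borel_measurable (borel \<Otimes>\<^sub>M borel)"
    unfolding b_def bump_def by measurable
  \<comment> \<open>Fatou is applied to this majorant of \<open>h j\<close>, whose measurability
    comes from that of the double integrand.\<close>
  define H where "H j z = indicator K z * (ennreal (10 * pi) * (\<integral>\<^sup>+x. ennreal (b z x) * ennreal ((cmod (\<gamma> j x))^2 * W x) \<partial>lborel))" for j z
  have [measurable]: "K \<in> sets borel" using K by (simp add: compact_imp_closed)
  have Hm: "H j \<in> borel_measurable lborel" for j
    unfolding H_def[abs_def] b_def bump_def by measurable
  have lim: "(\<lambda>j. h j z) \<longlonglongrightarrow> (cmod (rep z))\<^sup>2 / W z" if "z \<in> K" for z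
  proof -
    have zS: "cball z r \<subseteq> S" using sub that K' by blast
    have "rep z = \<Lambda> (kernel v z)" using rep_eq[OF r(1) zS] v by simp
    moreover have "kernel v z \<in> Cc S" using kernel_in_Cc[OF r(1) _ zS] v by simp
    ultimately show ?thesis unfolding h_def using W_pos[of z] that K 
      by (intro tendsto_intros) (auto intro: \<Lambda>_lim)
  qed
  have hH: "indicator K z * ennreal (h j z) \<le> H j z" for j z
  proof (cases "z \<in> K")
    case True
    have zS: "cball z r \<subseteq> S" using sub[OF True] K' by auto
    have "ennreal (h j z) \<le> H j z"
      unfolding h_def H_def b_def using pair_kernel_bound[OF r(1) zS v(1) W2[OF True] \<gamma>_Cc] True by simp
    then show ?thesis using True by simp
  qed simp
  have int: "(\<integral>\<^sup>+z. H j z \<partial>lborel) \<le> ennreal (50 * pi^2 * sq_norm (\<gamma> j))" for j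
  proof -
    have "(\<integral>\<^sup>+z. H j z \<partial>lborel) \<le> (\<integral>\<^sup>+z. ennreal (10 * pi) * (\<integral>\<^sup>+x. ennreal (b z x) * ennreal ((cmod (\<gamma> j x))^2 * W x) \<partial>lborel) \<partial>lborel)"
      unfolding H_def by (intro nn_integral_mono) (auto simp: indicator_def)
    also have "\<dots> = ennreal (10 * pi) * (\<integral>\<^sup>+z. (\<integral>\<^sup>+x. ennreal (b z x) * ennreal ((cmod (\<gamma> j x))^2 * W x) \<partial>lborel) \<partial>lborel)"
      unfolding b_def bump_def by (rule nn_integral_cmult) measurable
    also have "(\<integral>\<^sup>+z. (\<integral>\<^sup>+x. ennreal (b z x) * ennreal ((cmod (\<gamma> j x))^2 * W x) \<partial>lborel) \<partial>lborel) =
       (\<integral>\<^sup>+x. (\<integral>\<^sup>+z. ennreal (b z x) * ennreal ((cmod (\<gamma> j x))^2 * W x) \<partial>lborel) \<partial>lborel)"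
      unfolding b_def bump_def by (rule lborel_pair.Fubini') measurable
    also have "\<dots> \<le> (\<integral>\<^sup>+x. ennreal (5 * pi) * ennreal ((cmod (\<gamma> j x))^2 * W x) \<partial>lborel)"
    proof (rule nn_integral_mono)
      fix x :: complex
      have "(\<integral>\<^sup>+z. ennreal (b z x) * ennreal ((cmod (\<gamma> j x))^2 * W x) \<partial>lborel) = 
         (\<integral>\<^sup>+z. ennreal (b z x) \<partial>lborel) * ennreal ((cmod (\<gamma> j x))^2 * W x)"
        unfolding b_def bump_def by (rule nn_integral_multc) measurable
      also have "(\<integral>\<^sup>+z. ennreal (b z x) \<partial>lborel) \<le> (\<integral>\<^sup>+z. ennreal (5 * v) * indicator (cball x r) z \<partial>lborel)"
      proof (rule nn_integral_mono)
        fix z :: complex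
        show "ennreal (b z x) \<le> ennreal (5 * v) * indicator (cball x r) z"
        proof (cases "z \<in> cball x r")
          case True
          have "b z x \<le> 5 * v * 1" unfolding b_def using v by (intro mult_left_mono bump_le_1) auto
          then show ?thesis using True by (simp add: ennreal_leI)
        next
          case False
          then have "x \<notin> cball z r" by (simp add: dist_commute)
          then show ?thesis using bump_outside[OF r(1), of v x z 4] v by (simp add: b_def)
        qed
      qed
      also have "\<dots> = ennreal (5 * v) * emeasure lborel (cball x r)"
        by (subst nn_integral_cmult_indicator) auto
      also have "emeasure lborel (cball x r) = ennreal (pi * r^2)"
        using r by (simp add: emeasure_cball unit_ball_vol_2)
      also have "ennreal (5 * v) * ennreal (pi * r^2) = ennreal (5 * pi * (v * r^2))"
        using v by (simp add: mult_ac flip: ennreal_mult')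
      finally show "(\<integral>\<^sup>+z. ennreal (b z x) * ennreal ((cmod (\<gamma> j x))^2 * W x) \<partial>lborel) \<le> ennreal (5 * pi) * ennreal ((cmod (\<gamma> j x))^2 * W x)"
        using v by (simp add: mult_right_mono)
    qed
    also have "\<dots> = ennreal (5 * pi) * ennreal (sq_norm (\<gamma> j))"
      by (subst nn_integral_cmult) (auto simp: sq_norm_nn_integral[OF \<gamma>_Cc])
    also have "ennreal (10 * pi) * (ennreal (5 * pi) * ennreal (sq_norm (\<gamma> j))) = ennreal (50 * pi^2 * sq_norm (\<gamma> j))"
      using sq_norm_nonneg[OF \<gamma>_Cc, of j] by (simp add: power2_eq_square mult_ac flip: ennreal_mult')
    finally show ?thesis by (simp add: mult_left_mono)
  qed
  have "(\<integral>\<^sup>+z. indicator K z * ennreal ((cmod (rep z))^2 / W z) \<partial>lborel) \<le> (\<integral>\<^sup>+z. liminf (\<lambda>j. H j z) \<partial>lborel)"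
  proof (rule nn_integral_mono)
    fix z :: complex
    show "indicator K z * ennreal ((cmod (rep z))^2 / W z) \<le> liminf (\<lambda>j. H j z)"
    proof (cases "z \<in> K")
      case True
      have "(\<lambda>j. ennreal (h j z)) \<longlonglongrightarrow> ennreal ((cmod (rep z))^2 / W z)"
        by (intro tendsto_ennrealI lim True)
      then have "ennreal ((cmod (rep z))^2 / W z) = liminf (\<lambda>j. ennreal (h j z))"
        by (intro lim_imp_Liminf[symmetric] sequentially_bot)
      also have "\<dots> \<le> liminf (\<lambda>j. H j z)"
        using hH[of z] True by (intro Liminf_mono) simp
      finally show ?thesis using True by simp
    qed simp
  qed
  also have "\<dots> \<le> liminf (\<lambda>j. \<integral>\<^sup>+z. H j z \<partial>lborel)"
    by (rule nn_integral_liminf[OF Hm])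
  also have "\<dots> \<le> liminf (\<lambda>j. ennreal (50 * pi^2 * sq_norm (\<gamma> j)))"
    using int by (intro Liminf_mono) simp
  also have "\<dots> = ennreal (50 * pi^2 * m)"
    by (intro lim_imp_Liminf tendsto_ennrealI tendsto_intros sq_norm_\<gamma> sequentially_bot)
  finally show ?thesis .
qed simp

lemma rep_nn_integral:
  "(\<integral>\<^sup>+z. indicator S z * ennreal ((cmod (rep z))^2 / W z) \<partial>lborel) \<le> ennreal (50 * pi^2 * m)"
proof -
  obtain C where C: "\<And>n. compact (C n)" "\<And>n. C n \<subseteq> S" "\<And>n. C n \<subseteq> interior (C (Suc n))" "\<Union>(range C) = S"
    using open_Union_compact_subsets[OF open_S] by metis
  have inc: "incseq C"
    using C(3) interior_subset by (intro incseq_SucI) blast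
  define f where "f n z = indicator (C n) z * ennreal ((cmod (rep z))^2 / W z)" for n z
  have "(\<integral>\<^sup>+z. indicator S z * ennreal ((cmod (rep z))^2 / W z) \<partial>lborel) = (\<integral>\<^sup>+z. (SUP n. f n z) \<partial>lborel)"
  proof (rule nn_integral_cong)
    fix z :: complex
    show "indicator S z * ennreal ((cmod (rep z))^2 / W z) = (SUP n. f n z)"
    proof (cases "z \<in> S")
      case True
      then obtain n where "z \<in> C n" using C(4) by auto
      then have "f n z = ennreal ((cmod (rep z))^2 / W z)" by (simp add: f_def)
      moreover have "f k z \<le> ennreal ((cmod (rep z))^2 / W z)" for k by (simp add: f_def indicator_def)
      ultimately have "(SUP n. f n z) = ennreal ((cmod (rep z))^2 / W z)"
        by (intro antisym SUP_least) (auto intro: SUP_upper2[of n])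
      then show ?thesis using True by simp
    next
      case False
      then have "f n z = 0" for n using C(2)[of n] by (auto simp: f_def indicator_def)
      then show ?thesis using False by simp
    qed
  qed
  also have "\<dots> = (SUP n. \<integral>\<^sup>+z. f n z \<partial>lborel)"
  proof (rule nn_integral_monotone_convergence_SUP)
    show "incseq f" unfolding f_def using inc
      by (auto simp: incseq_def le_fun_def indicator_def)
    fix n
    have "continuous_on (C n) (\<lambda>z. (cmod (rep z))\<^sup>2 / W z)"
      using C(2)[of n] W_pos by (intro continuous_intros continuous_on_subset[OF cont_W] 
         continuous_on_subset[OF holomorphic_on_imp_continuous_on[OF rep_holomorphic]]) force+
    then have "(\<lambda>z. indicator (C n) z *\<^sub>R ((cmod (rep z))^2 / W z)) \<in> borel_measurable borel"
      using C(1) by (intro borel_measurable_continuous_on_indicator) (auto simp: compact_imp_closed)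
    then have "(\<lambda>z. ennreal (indicator (C n) z *\<^sub>R ((cmod (rep z))^2 / W z))) \<in> borel_measurable lborel" by simp
    also have "(\<lambda>z. ennreal (indicator (C n) z *\<^sub>R ((cmod (rep z))^2 / W z))) = f n"
      by (auto simp: f_def indicator_def)
    finally show "f n \<in> borel_measurable lborel" .
  qed
  also have "\<dots> \<le> ennreal (50 * pi^2 * m)"
    unfolding f_def using rep_nn_integral_compact C by (intro SUP_least) auto
  finally show ?thesis .
qed

end

section \<open>Extremal functions and rescaling\<close>

definition sq_integral :: "complex set \<Rightarrow> (complex \<Rightarrow> real) \<Rightarrow> (complex \<Rightarrow> complex) \<Rightarrow> ennreal" where
  "sq_integral S \<psi> f = (\<integral>\<^sup>+z. indicator S z * ennreal ((cmod (f z))^2 * exp (- 2 * \<psi> z)) \<partial>lborel)"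

text \<open>The function is \<open>rep\<close> for the functional minimising over
  \<open>g0 = kernel s0 0\<close>. It has \<open>rep 0 = m\<close>, while its squared norm is at
  most a multiple of \<open>m\<close>; the quotient of squared norm and squared value is therefore
  of order \<open>1 / m\<close>, and everything rests on the lower bound \<open>c\<close> for
  \<open>m\<close>.\<close>

theorem peak_function:
  fixes C :: real
  assumes C: "C \<ge> 1" and S: "open S" "0 \<in> S"
    and \<psi>: "C2r S \<psi> P \<sigma>" and \<sigma>: "\<And>z. z \<in> S \<Longrightarrow> Re (\<sigma> z) \<ge> 1 / (4 * (1 + C * cmod z)^2)"
  obtains f where "f holomorphic_on S" "f 0 \<noteq> 0"
    "sq_integral S \<psi> f \<le> ennreal (400 * pi * ((6 * C^2 + 3 / 2) * exp (8 * C^2)) * ((cmod (f 0))^2 * exp (- 2 * \<psi> 0)))"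
proof -
  define W where "W z = exp (2 * \<psi> z)" for z
  define B where "B = (6 * C^2 + 3 / 2) * exp (8 * C^2)"
  have B: "B > 0" unfolding B_def by (intro mult_pos_pos add_nonneg_pos) auto
  interpret weighted_space S W
    by unfold_locales (auto simp: W_def S intro!: continuous_intros C2r_continuous_on(1)[OF \<psi>])
  obtain r where r: "r > 0" "cball 0 r \<subseteq> S" using S open_contains_cball by blast
  define s0 where "s0 = 1 / r^2"
  have s0: "s0 * r^2 \<ge> 1" using r by (simp add: s0_def)
  define g0 where "g0 = kernel s0 0"
  have g0: "g0 \<in> Cc S" unfolding g0_def by (rule kernel_in_Cc[OF r(1) s0 r(2)])
  define m where "m = (INF n\<in>dbar_space S. sq_norm (\<lambda>z. g0 z + n z))"
  define c where "c = pi / 8 * exp (2 * \<psi> 0) / B"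
  have c: "c > 0" using B by (simp add: c_def)
  have "c \<le> sq_norm (\<lambda>z. g0 z + n z)" if n: "n \<in> dbar_space S" for n
  proof -
    from n obtain \<beta> p s where \<beta>: "C2w UNIV \<beta> p n s" "compact_support S \<beta>"
      unfolding dbar_space_def by blast
    from \<beta>(2) obtain L where L: "compact L" "L \<subseteq> S" "\<And>z. z \<notin> L \<Longrightarrow> \<beta> z = 0"
      unfolding compact_support_def by blast
    have n0: "n z = 0" if "z \<notin> L" for z
      by (rule wirtinger_vanishing(2)[of \<beta> p n L]) (use C2w_wirtinger[OF \<beta>(1)] L that in \<open>auto intro: compact_imp_closed\<close>)
    obtain p' s' where u: "C2w UNIV (\<lambda>z. of_real (1 * bump 5 s0 ((cmod (z - 0))^2))) p'
       (\<lambda>z. of_real (- 1 * s0 * real 5 * bump (5 - 1) s0 ((cmod (z - 0))^2)) * (z - 0)) s'"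
      by (rule C2w_bump[of 5 1 s0 0, OF _ that]) simp
    \<comment> \<open>The bump has dbar derivative \<open>- z * g0 z\<close>, and the holomorphic
      factor \<open>z\<close> passes through dbar. Hence \<open>b 0 = 1\<close> and the dbar
      derivative of \<open>b\<close> is \<open>z\<close> times \<open>- (g0 z + n z)\<close>, the
      form required for the estimate at the pole.\<close>
    define b where "b z = of_real (1 * bump 5 s0 ((cmod (z - 0))^2)) + (- z) * \<beta> z" for z
    define q where "q z = of_real (- 1 * s0 * real 5 * bump (5 - 1) s0 ((cmod (z - 0))^2)) * (z - 0) + 
       ((0 * z + (-1) * 0) * \<beta> z + ((-1) * z) * n z)" for z
    have "\<exists>p s. C2w UNIV b p q s"
    proof -
      note mi = C2w_mult[OF C2w_const[of UNIV "-1"] C2w_ident]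
      from C2w_add[OF u C2w_mult[OF mi \<beta>(1)]] show ?thesis
        unfolding b_def[abs_def] q_def[abs_def] by auto
    qed
    then obtain pb sb where b: "C2w S b pb q sb" using C2w_subset[OF _ subset_UNIV] by blast
    define K where "K = cball 0 r \<union> L"
    have K: "compact K" "K \<subseteq> S" using r L by (auto simp: K_def intro: compact_Un)
    have off: "b z = 0" "g0 z + n z = 0" if "z \<notin> K" for z
    proof -
      have "z \<notin> cball 0 r" "z \<notin> L" using that by (auto simp: K_def)
      then show "b z = 0" "g0 z + n z = 0"
        using bump_outside[OF r(1) s0, of z 0] L n0 by (auto simp: b_def g0_def kernel_def)
    qed
    have "pi / 8 * ((cmod (b 0))^2 * exp (2 * \<psi> 0)) \<le> (6 * C^2 + 3 / 2) * exp (8 * C^2) *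
       (LINT z|lborel. indicator K z * ((cmod (- (g0 z + n z)))^2 * exp (2 * \<psi> z)))"
    proof (rule pole_estimate[OF C S \<psi> \<sigma> b K])
      show "continuous_on S (\<lambda>z. - (g0 z + n z))"
        using g0 dbar_space_subset_Cc n unfolding Cc_def 
        by (intro continuous_intros) (auto intro: continuous_on_subset)
      show "q z = z * - (g0 z + n z)" for z
        by (simp add: q_def g0_def kernel_def algebra_simps)
    qed (use off in auto)
    also have "(LINT z|lborel. indicator K z * ((cmod (- (g0 z + n z)))^2 * exp (2 * \<psi> z))) = sq_norm (\<lambda>z. g0 z + n z)"
      unfolding sq_norm_def W_def norm_minus_cancel
      by (rule Bochner_Integration.integral_cong) (use off(2) in \<open>auto simp: indicator_def\<close>)
    also have "b 0 = 1" by (simp add: b_def)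
    finally have "pi / 8 * exp (2 * \<psi> 0) \<le> B * sq_norm (\<lambda>z. g0 z + n z)" by (simp add: B_def)
    then show ?thesis using B by (simp add: c_def divide_le_eq mult.commute)
  qed
  then have mc: "c \<le> m" unfolding m_def using dbar_space_nonempty by (intro cINF_greatest)
  obtain \<Lambda> \<gamma> where \<Lambda>: "\<And>j::nat. \<gamma> j \<in> Cc S" "(\<lambda>j. sq_norm (\<gamma> j)) \<longlonglongrightarrow> m" "\<And>g. g \<in> Cc S \<Longrightarrow> (\<lambda>j. ip g (\<gamma> j)) \<longlonglongrightarrow> \<Lambda> g"
    "\<And>n. n \<in> dbar_space S \<Longrightarrow> \<Lambda> n = 0" "\<Lambda> g0 = of_real m"
  proof (rule minimizing_functional[OF dbar_space_subset_Cc dbar_space_nonempty dbar_space_combination g0 m_def])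
    fix \<Lambda> and \<gamma> :: "nat \<Rightarrow> complex \<Rightarrow> complex"
    assume "\<And>j. \<gamma> j \<in> Cc S" "(\<lambda>j. sq_norm (\<gamma> j)) \<longlonglongrightarrow> m" "\<And>g. g \<in> Cc S \<Longrightarrow> (\<lambda>j. ip g (\<gamma> j)) \<longlonglongrightarrow> \<Lambda> g"
      "\<And>n. n \<in> dbar_space S \<Longrightarrow> \<Lambda> n = 0" "\<Lambda> g0 = of_real m"
    then show thesis by (rule that)
  qed
  interpret dbar_annihilator S W \<Lambda> \<gamma> m
    by unfold_locales (use \<Lambda> in auto)
  have F0: "rep 0 = of_real m"
    using rep_eq[OF r s0] \<Lambda>(5) by (simp add: g0_def)
  show ?thesis
  proof (rule that[of rep])
    show "rep holomorphic_on S" by (rule rep_holomorphic)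
    show "rep 0 \<noteq> 0" using F0 mc c by simp
    have "sq_integral S \<psi> rep = (\<integral>\<^sup>+z. indicator S z * ennreal ((cmod (rep z))^2 / W z) \<partial>lborel)"
      by (simp add: sq_integral_def W_def exp_minus divide_inverse)
    also have "\<dots> \<le> ennreal (50 * pi^2 * m)" by (rule rep_nn_integral)
    \<comment> \<open>As \<open>c \<le> m\<close>, inserting the factor \<open>m / c\<close> trades
      the linear bound for one in terms of the square of \<open>rep 0 = m\<close>.\<close>
    also have "50 * pi^2 * m \<le> 50 * pi^2 * (m * (m / c))"
      using mc c by (intro mult_left_mono) (auto simp: field_simps)
    also have "50 * pi^2 * (m * (m / c)) = 400 * pi * B * ((cmod (rep 0))^2 * exp (- 2 * \<psi> 0))"
      using B unfolding F0 c_def by (simp add: exp_minus field_simps power2_eq_square)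
    finally show "sq_integral S \<psi> rep \<le> ennreal (400 * pi * ((6 * C^2 + 3 / 2) * exp (8 * C^2)) * ((cmod (rep 0))^2 * exp (- 2 * \<psi> 0)))"
      unfolding B_def by (simp add: ennreal_leI)
  qed
qed

section \<open>From the class of weights to uniform data on rescaled discs\<close>

lemma C2_on_imp_C2r:
  assumes "C2_on S \<psi>" "open S"
  obtains P \<sigma> where "C2r S \<psi> P \<sigma>" "\<And>z. z \<in> S \<Longrightarrow> Re (\<sigma> z) = laplacian \<psi> z / 4"
proof -
  obtain D1 :: "complex \<Rightarrow> (complex \<Rightarrow>\<^sub>L real)" and D2 :: "complex \<Rightarrow> (complex \<Rightarrow>\<^sub>L (complex \<Rightarrow>\<^sub>L real))" where
    D: "\<And>z. z \<in> S \<Longrightarrow> (\<psi> has_derivative blinfun_apply (D1 z)) (at z)"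
       "\<And>z. z \<in> S \<Longrightarrow> (D1 has_derivative blinfun_apply (D2 z)) (at z)" "continuous_on S D2"
    using assms(1) unfolding C2_on_def by blast
  define P where "P z = (of_real (D1 z 1) - \<i> * of_real (D1 z \<i>)) / 2" for z
  define dd where "dd x y z = complex_of_real (blinfun_apply (blinfun_apply (D2 z) x) y)" for x y z
  define p1 where "p1 z = ((dd 1 1 z - \<i> * dd 1 \<i> z) - \<i> * (dd \<i> 1 z - \<i> * dd \<i> \<i> z)) / 4" for z
  define \<sigma> where "\<sigma> z = ((dd 1 1 z - \<i> * dd 1 \<i> z) + \<i> * (dd \<i> 1 z - \<i> * dd \<i> \<i> z)) / 4" for z
  have h_eq: "h = Re h *\<^sub>R 1 + Im h *\<^sub>R \<i>" for h
    by (simp add: complex_eq_iff)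
  have dD1: "((\<lambda>z. blinfun_apply (D1 z) e) has_derivative (\<lambda>h. blinfun_apply (blinfun_apply (D2 z) h) e)) (at z)"
    if "z \<in> S" for z e
    using bounded_linear.has_derivative[OF blinfun.bounded_linear_left D(2)[OF that], of e] .
  have cdd: "continuous_on S (dd x y)" for x y
  proof -
    have "continuous_on S (\<lambda>z. blinfun_apply (blinfun_apply (D2 z) x) y)"
      by (intro bounded_linear.continuous_on[OF blinfun.bounded_linear_left] D(3))
    then show ?thesis unfolding dd_def[abs_def] by (rule continuous_on_of_real)
  qed
  have 1: "wirtinger (\<lambda>z. of_real (\<psi> z)) (P z) (cnj (P z)) z" if "z \<in> S" for z
  proof -
    have "((\<lambda>z. complex_of_real (\<psi> z)) has_derivative (\<lambda>h. complex_of_real (D1 z h))) (at z)"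
      by (rule has_derivative_of_real[OF D(1)[OF that]])
    moreover have "complex_of_real (D1 z h) = P z * h + cnj (P z) * cnj h" for h
    proof -
      have "D1 z h = Re h * D1 z 1 + Im h * D1 z \<i>"
        by (subst h_eq) (simp add: blinfun.add_right blinfun.scaleR_right)
      then show ?thesis by (simp add: P_def complex_eq_iff field_simps)
    qed
    ultimately show ?thesis by (simp add: wirtinger_def)
  qed
  have 2: "wirtinger P (p1 z) (\<sigma> z) z" if "z \<in> S" for z
  proof -
    have "(P has_derivative (\<lambda>h. (of_real (blinfun_apply (D2 z h) 1) - \<i> * of_real (blinfun_apply (D2 z h) \<i>)) / 2)) (at z)"
      using has_derivative_mult_right[OF has_derivative_diff[OF has_derivative_of_real[OF dD1[OF that]]
          has_derivative_mult_right[OF has_derivative_of_real[OF dD1[OF that]], of \<i>]], of "1 / 2" 1 \<i>]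
      by (simp add: P_def[abs_def])
    moreover have "(of_real (blinfun_apply (D2 z h) 1) - \<i> * of_real (blinfun_apply (D2 z h) \<i>)) / 2 = p1 z * h + \<sigma> z * cnj h" for h
    proof -
      have "blinfun_apply (D2 z h) e = Re h * blinfun_apply (D2 z 1) e + Im h * blinfun_apply (D2 z \<i>) e" for e
        by (subst h_eq) (simp add: blinfun.add_right blinfun.scaleR_right blinfun.add_left blinfun.scaleR_left)
      then show ?thesis by (simp add: p1_def \<sigma>_def dd_def complex_eq_iff field_simps)
    qed
    ultimately show ?thesis by (simp add: wirtinger_def)
  qed
  have line: "((\<lambda>t. u (z + of_real t * d)) has_real_derivative u' d) (at 0)"
    if "(u has_derivative u') (at z)" for u :: "complex \<Rightarrow> real" and u' z d
  proof -
    have "((\<lambda>t. z + of_real t * d) has_derivative (\<lambda>t. of_real t * d)) (at (0::real))"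
      by (auto intro!: derivative_eq_intros)
    from has_derivative_compose[OF this, of u u'] that 
    have "((\<lambda>t. u (z + of_real t * d)) has_derivative (\<lambda>t. u' (of_real t * d))) (at 0)" by simp
    moreover have "(\<lambda>t. u' (of_real t * d)) = (*) (u' d)"
    proof
      fix t
      have "u' (t *\<^sub>R d) = t *\<^sub>R u' d" by (rule linear_cmul[OF has_derivative_linear[OF that]])
      then show "u' (of_real t * d) = u' d * t" by (simp only: scaleR_conv_of_real) simp
    qed
    ultimately show ?thesis by (simp add: has_field_derivative_def)
  qed
  have dx: "dx \<psi> z = D1 z 1" "dy \<psi> z = D1 z \<i>" if "z \<in> S" for z
    using DERIV_imp_deriv[OF line[OF D(1)[OF that], of 1]] DERIV_imp_deriv[OF line[OF D(1)[OF that], of \<i>]]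
    by (simp_all add: dx_def dy_def mult.commute)
  have near: "deriv (\<lambda>t::real. u (z + of_real t * d)) 0 = blinfun_apply (D2 z d) e"
    if "z \<in> S" "\<And>y. y \<in> S \<Longrightarrow> u y = blinfun_apply (D1 y) e" for u :: "complex \<Rightarrow> real" and z d e
  proof (rule DERIV_imp_deriv)
    have "(u has_derivative (\<lambda>h. blinfun_apply (D2 z h) e)) (at z)"
      by (rule has_derivative_transform_within_open[OF dD1[OF that(1)] assms(2) that(1)]) (simp add: that(2))
    from line[OF this, of d] show "((\<lambda>t. u (z + of_real t * d)) has_real_derivative blinfun_apply (D2 z d) e) (at 0)" .
  qed
  have "Re (\<sigma> z) = laplacian \<psi> z / 4" if "z \<in> S" for z
    using near[OF that dx(1), of 1] near[OF that dx(2), of \<i>]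
    by (simp add: laplacian_def dx_def[of "dx \<psi>"] dy_def[of "dy \<psi>"] \<sigma>_def dd_def mult.commute add_divide_distrib)
  moreover have "C2r S \<psi> P \<sigma>"
    unfolding C2r_def using 1 2
    by (intro exI[of _ p1]) (auto simp: p1_def[abs_def] \<sigma>_def[abs_def] intro!: continuous_intros cdd)
  ultimately show ?thesis using that by blast
qed

lemma wirtinger_affine:
  assumes "wirtinger u p q (w + of_real t * z)"
  shows "wirtinger (\<lambda>z. u (w + of_real t * z)) (of_real t * p) (of_real t * q) z"
proof -
  have "((\<lambda>z. w + of_real t * z) has_derivative (\<lambda>h. of_real t * h)) (at z)"
    by (auto intro!: derivative_eq_intros)
  from has_derivative_compose[OF this assms[unfolded wirtinger_def]] show ?thesis
    by (simp add: wirtinger_def algebra_simps)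
qed

lemma C2r_affine:
  assumes "C2r S u p s"
  shows "C2r {z. w + of_real t * z \<in> S} (\<lambda>z. u (w + of_real t * z)) (\<lambda>z. of_real t * p (w + of_real t * z))
     (\<lambda>z. of_real (t^2) * s (w + of_real t * z))" (is "C2r ?S _ _ _")
proof -
  from assms obtain p1 where
    1: "\<And>z. z \<in> S \<Longrightarrow> wirtinger (\<lambda>z. of_real (u z)) (p z) (cnj (p z)) z" "\<And>z. z \<in> S \<Longrightarrow> wirtinger p (p1 z) (s z) z"
       "continuous_on S p1" "continuous_on S s"
    unfolding C2r_def by blast
  have "wirtinger (\<lambda>z. of_real (u (w + of_real t * z))) (of_real t * p (w + of_real t * z)) (cnj (of_real t * p (w + of_real t * z))) z"
    if "z \<in> ?S" for z
    using wirtinger_affine[OF 1(1)] that by simp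
  moreover have "wirtinger (\<lambda>z. of_real t * p (w + of_real t * z)) (of_real (t^2) * p1 (w + of_real t * z)) (of_real (t^2) * s (w + of_real t * z)) z"
    if "z \<in> ?S" for z
    using wirtinger_mult[OF wirtinger_const wirtinger_affine[OF 1(2)], of w t z "of_real t"] that by (simp add: power2_eq_square mult.assoc)
  moreover have "continuous_on ?S (\<lambda>z. of_real (t^2) * p1 (w + of_real t * z))" "continuous_on ?S (\<lambda>z. of_real (t^2) * s (w + of_real t * z))"
    by (intro continuous_intros continuous_on_compose2[OF 1(3)] continuous_on_compose2[OF 1(4)]; auto)+
  ultimately show ?thesis unfolding C2r_def by (intro exI[of _ "\<lambda>z. of_real (t^2) * p1 (w + of_real t * z)"]) blast
qed

lemma nn_integral_affine:
  fixes G :: "complex \<Rightarrow> ennreal"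
  assumes [measurable]: "G \<in> borel_measurable borel" and "t > 0"
  shows "(\<integral>\<^sup>+z. G z \<partial>lborel) = ennreal (t^2) * (\<integral>\<^sup>+z. G (w + of_real t * z) \<partial>lborel)"
proof -
  have "(\<integral>\<^sup>+z. G z \<partial>lborel) = (\<integral>\<^sup>+z. G z \<partial>density (distr lborel borel (\<lambda>x. w + t *\<^sub>R x)) (\<lambda>_. \<bar>t\<bar> ^ DIM(complex)))"
    using lborel_affine[of t w] assms(2) by simp
  also have "\<dots> = (\<integral>\<^sup>+z. ennreal (t^2) * G (w + t *\<^sub>R z) \<partial>lborel)"
    using assms(2) by (subst nn_integral_density) (auto simp: nn_integral_distr)
  also have "\<dots> = ennreal (t^2) * (\<integral>\<^sup>+z. G (w + t *\<^sub>R z) \<partial>lborel)"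
    by (rule nn_integral_cmult) measurable
  finally show ?thesis by (simp add: scaleR_conv_of_real)
qed

definition rescaled_disk :: "(complex \<Rightarrow> real) \<Rightarrow> complex \<Rightarrow> complex set" where
  "rescaled_disk \<psi> w = {z. w + of_real (tau \<psi> w) * z \<in> unit_disk}"

text \<open>What both point estimates use once \<open>w\<close> is moved to the origin and
  \<open>tau \<psi> w\<close> is the unit of length, with \<open>C\<close> and
  \<open>\<delta>\<close> common to all \<open>w\<close>. \<open>Re \<sigma>\<close> is a quarter of
  the Laplacian of the rescaled weight, hence 1/4 at the origin.\<close>

definition uniformly_rescaled :: "(complex \<Rightarrow> real) \<Rightarrow> real \<Rightarrow> real \<Rightarrow> bool" where
  "uniformly_rescaled \<psi> C \<delta> \<longleftrightarrow> C \<ge> 1 \<and> \<delta> > 0 \<and>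
    (\<forall>w\<in>unit_disk. tau \<psi> w > 0 \<and> cball 0 \<delta> \<subseteq> rescaled_disk \<psi> w \<and>
      (\<exists>P \<sigma>. C2r (rescaled_disk \<psi> w) (\<lambda>z. \<psi> (w + of_real (tau \<psi> w) * z)) P \<sigma> \<and>
        (\<forall>z\<in>rescaled_disk \<psi> w. 1 / (4 * (1 + C * cmod z)^2) \<le> Re (\<sigma> z)) \<and>
        (\<forall>z\<in>cball 0 \<delta>. Re (\<sigma> z) \<le> 1)))"

text \<open>A quarter of the rescaled Laplacian is the square of \<open>tau \<psi> w\<close> over
  \<open>tau\<close> at the moved point, divided by 4. By the Lipschitz condition \<open>tau\<close>
  grows at most by the factor \<open>1 + C * cmod z\<close>, whence the lower bound; near the origin
  it drops at most to half, whence the upper bound.\<close>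

lemma class_D_uniformly_rescaled:
  assumes "class_D \<psi>"
  shows "\<exists>C \<delta>. uniformly_rescaled \<psi> C \<delta>"
proof -
  from assms obtain C1 C2 where 
    C2: "C2_on unit_disk \<psi>" and lap: "\<And>z. z \<in> unit_disk \<Longrightarrow> laplacian \<psi> z > 0" and "C1 > 0" "C2 > 0"
    and C1: "\<And>z \<xi>. z \<in> unit_disk \<Longrightarrow> \<xi> \<in> unit_disk \<Longrightarrow> \<bar>tau \<psi> z - tau \<psi> \<xi>\<bar> \<le> C1 * cmod (z - \<xi>)"
    and Cb: "\<And>z. z \<in> unit_disk \<Longrightarrow> tau \<psi> z \<le> C2 * (1 - cmod z)"
    unfolding class_D_def by metis
  have tau: "tau \<psi> w > 0 \<and> laplacian \<psi> w = 1 / (tau \<psi> w)^2" if "w \<in> unit_disk" for w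
    using lap[OF that] by (simp add: tau_def power_divide)
  define C where "C = max 1 C1"
  \<comment> \<open>\<open>C1 * \<delta> \<le> 1 / 2\<close> limits the variation of
    \<open>tau\<close> to half its central value; \<open>C2 * \<delta> \<le> 1 / 2\<close> keeps the
    disc within half the distance from \<open>w\<close> to the unit circle.\<close>
  define \<delta> where "\<delta> = 1 / (2 * (C1 + C2))"
  have \<delta>: "\<delta> > 0" using \<open>C1 > 0\<close> \<open>C2 > 0\<close> by (simp add: \<delta>_def)
  have \<delta>1: "C1 * \<delta> \<le> 1 / 2" "C2 * \<delta> \<le> 1 / 2"
    using \<open>C1 > 0\<close> \<open>C2 > 0\<close> by (simp_all add: \<delta>_def field_simps)
  obtain P \<sigma> where P: "C2r unit_disk \<psi> P \<sigma>" "\<And>z. z \<in> unit_disk \<Longrightarrow> Re (\<sigma> z) = laplacian \<psi> z / 4"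
    using C2_on_imp_C2r[OF C2 open_ball] by blast
  have "uniformly_rescaled \<psi> C \<delta>"
    unfolding uniformly_rescaled_def
  proof (intro conjI ballI)
    show "C \<ge> 1" by (simp add: C_def)
    show "\<delta> > 0" by fact
    fix w :: complex assume w: "w \<in> unit_disk"
    show "tau \<psi> w > 0" using tau[OF w] by simp
    define t where "t = tau \<psi> w"
    have t: "t > 0" using tau[OF w] by (simp add: t_def)
    define S where "S = {z. w + of_real t * z \<in> unit_disk}"
    have S_rescaled: "S = rescaled_disk \<psi> w" by (simp add: S_def rescaled_disk_def t_def)
    have sub: "z \<in> S" if "z \<in> cball 0 \<delta>" for z
    proof -
      have "cmod (w + of_real t * z) \<le> cmod w + t * cmod z"
        using norm_triangle_ineq[of w "of_real t * z"] t by (simp add: norm_mult)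
      also have "t * cmod z \<le> (C2 * (1 - cmod w)) * \<delta>"
        using Cb[OF w] t that \<open>C2 > 0\<close> w by (intro mult_mono) (auto simp: t_def)
      also have "\<dots> = (C2 * \<delta>) * (1 - cmod w)" by simp
      also have "\<dots> \<le> 1 / 2 * (1 - cmod w)" using \<delta>1 w by (intro mult_right_mono) auto
      finally have "cmod (w + of_real t * z) \<le> cmod w + 1 / 2 * (1 - cmod w)" by simp
      also have "\<dots> < 1" using w by (simp add: field_simps)
      finally show ?thesis by (simp add: S_def)
    qed
    define \<sigma>' where "\<sigma>' z = complex_of_real (t^2) * \<sigma> (w + of_real t * z)" for z
    have c: "C2r S (\<lambda>z. \<psi> (w + of_real t * z)) (\<lambda>z. of_real t * P (w + of_real t * z)) \<sigma>'"
      unfolding S_def \<sigma>'_def by (rule C2r_affine[OF P(1)])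
    have re: "Re (\<sigma>' z) = (t / tau \<psi> (w + of_real t * z))^2 / 4" if "z \<in> S" for z
      using P(2)[of "w + of_real t * z"] tau[of "w + of_real t * z"] that
      by (simp add: \<sigma>'_def S_def power_divide)
    have Lip: "\<bar>tau \<psi> (w + of_real t * z) - t\<bar> \<le> C1 * (t * cmod z)" if "z \<in> S" for z
      using C1[of "w + of_real t * z" w] that w t by (simp add: S_def t_def norm_mult)
    have lower: "1 / (4 * (1 + C * cmod z)^2) \<le> Re (\<sigma>' z)" if z: "z \<in> S" for z
    proof -
      define u where "u = tau \<psi> (w + of_real t * z)"
      have u: "u > 0" using tau z by (simp add: u_def S_def)
      have "u \<le> t + C1 * (t * cmod z)" using Lip[OF z] by (simp add: u_def)
      also have "\<dots> \<le> t + C * (t * cmod z)" using t by (intro add_left_mono mult_right_mono) (auto simp: C_def)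
      finally have "u \<le> t * (1 + C * cmod z)" by (simp add: algebra_simps)
      moreover have pos: "1 + C * cmod z > 0" by (intro add_pos_nonneg) (auto simp: C_def)
      ultimately have "1 / (1 + C * cmod z) \<le> t / u" using u t by (simp add: field_simps)
      then have "(1 / (1 + C * cmod z))^2 \<le> (t / u)\<^sup>2" using pos by (intro power_mono) auto
      then show ?thesis unfolding re[OF z] u_def[symmetric] by (simp add: power_divide)
    qed
    have upper: "Re (\<sigma>' z) \<le> 1" if z: "z \<in> cball 0 \<delta>" for z
    proof -
      define u where "u = tau \<psi> (w + of_real t * z)"
      have u: "u > 0" using tau sub[OF z] by (simp add: u_def S_def)
      have "C1 * (t * cmod z) \<le> C1 * (t * \<delta>)" using z t \<open>C1 > 0\<close> by (intro mult_left_mono) auto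
      also have "\<dots> = (C1 * \<delta>) * t" by simp
      also have "\<dots> \<le> 1 / 2 * t" using \<delta>1 t by (intro mult_right_mono) auto
      finally have "t / 2 \<le> u" using Lip[OF sub[OF z]] by (simp add: u_def)
      then have "t / u \<le> 2" using u by (simp add: field_simps)
      then have "(t / u)^2 \<le> 2^2" using t u by (intro power_mono) auto
      then show ?thesis unfolding re[OF sub[OF z]] u_def[symmetric] by simp
    qed
    show "cball 0 \<delta> \<subseteq> rescaled_disk \<psi> w" using sub by (auto simp: S_rescaled)
    show "\<exists>P \<sigma>. C2r (rescaled_disk \<psi> w) (\<lambda>z. \<psi> (w + of_real (tau \<psi> w) * z)) P \<sigma> \<and>
        (\<forall>z\<in>rescaled_disk \<psi> w. 1 / (4 * (1 + C * cmod z)^2) \<le> Re (\<sigma> z)) \<and>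
        (\<forall>z\<in>cball 0 \<delta>. Re (\<sigma> z) \<le> 1)"
      unfolding S_rescaled[symmetric] t_def[symmetric] using c lower upper by blast
  qed
  then show ?thesis by blast
qed

lemma weighted_nn_integral_affine:
  assumes "f holomorphic_on unit_disk" "continuous_on unit_disk \<psi>" "t > 0"
  shows "sq_integral unit_disk \<psi> f =
    ennreal (t^2) * sq_integral {z. w + of_real t * z \<in> unit_disk} (\<lambda>z. \<psi> (w + of_real t * z)) (\<lambda>z. f (w + of_real t * z))"
proof -
  define G where "G z = indicator unit_disk z * ennreal ((cmod (f z))^2 * exp (- 2 * \<psi> z))" for z
  have "(\<lambda>z. indicator unit_disk z *\<^sub>R ((cmod (f z))^2 * exp (- 2 * \<psi> z))) \<in> borel_measurable borel"
    using assms by (intro borel_measurable_continuous_on_indicator continuous_intros holomorphic_on_imp_continuous_on) auto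
  then have "(\<lambda>z. ennreal (indicator unit_disk z *\<^sub>R ((cmod (f z))^2 * exp (- 2 * \<psi> z)))) \<in> borel_measurable borel" 
    by simp
  also have "(\<lambda>z. ennreal (indicator unit_disk z *\<^sub>R ((cmod (f z))^2 * exp (- 2 * \<psi> z)))) = G"
    by (auto simp: G_def indicator_def)
  finally have "G \<in> borel_measurable borel" .
  from nn_integral_affine[OF this assms(3), of w] show ?thesis
    by (simp add: sq_integral_def G_def indicator_def)
qed

lemma class_D_continuous:
  assumes "class_D \<psi>"
  shows "continuous_on unit_disk \<psi>"
proof -
  have "C2_on unit_disk \<psi>" using assms by (simp add: class_D_def)
  then show ?thesis using C2_on_imp_C2r[OF _ open_ball] C2r_continuous_on(1) by metis
qed

text \<open>The mean value estimate is used on the disc of radius \<open>\<delta>\<close> with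
  \<open>M = 1\<close>, and the Jacobian of the rescaling supplies \<open>(tau \<psi> w)^2\<close>.
  As \<open>\<delta>\<close> is common to all points, so is \<open>A\<close>.\<close>

lemma point_evaluation_bound:
  assumes "class_D \<psi>"
  shows "\<exists>A>0. \<forall>f w. f holomorphic_on unit_disk \<longrightarrow> w \<in> unit_disk \<longrightarrow>
    ennreal ((tau \<psi> w)^2 * ((cmod (f w))^2 * exp (- 2 * \<psi> w))) \<le> ennreal A * 
    sq_integral unit_disk \<psi> f"
proof -
  obtain C \<delta> where resc: "uniformly_rescaled \<psi> C \<delta>"
    using class_D_uniformly_rescaled[OF assms] by blast
  then have C: "C \<ge> 1" "\<delta> > 0" by (auto simp: uniformly_rescaled_def)
  define A where "A = 8 / pi * (2 / \<delta>^2 * exp (2 * \<bar>1\<bar> * \<delta>^2))"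
  have A: "A > 0" using C by (simp add: A_def)
  show ?thesis
  proof (intro exI[of _ A] conjI A allI impI)
    fix f and w :: complex assume f: "f holomorphic_on unit_disk" and w: "w \<in> unit_disk"
    define t where "t = tau \<psi> w"
    have t: "t > 0" using resc w by (simp add: t_def uniformly_rescaled_def)
    define S where "S = {z. w + of_real t * z \<in> unit_disk}"
    define h where "h z = f (w + of_real t * z)" for z
    define u where "u z = \<psi> (w + of_real t * z)" for z
    obtain P \<sigma> where P: "C2r S u P \<sigma>" "\<And>z. z \<in> cball 0 \<delta> \<Longrightarrow> Re (\<sigma> z) \<le> 1" and sub: "cball 0 \<delta> \<subseteq> S"
      using resc w unfolding S_def t_def u_def rescaled_disk_def uniformly_rescaled_def by metis
    have S: "open S"
    proof -
      have "S = (\<lambda>z. w + of_real t * z) -` unit_disk" by (auto simp: S_def)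
      then show ?thesis by (auto intro!: open_vimage continuous_intros)
    qed
    have h: "h holomorphic_on S"
      unfolding h_def[abs_def] S_def
      by (rule holomorphic_on_compose_gen[OF _ f, unfolded o_def]) (auto intro!: holomorphic_intros)
    define g where "g z = (cmod (h z))^2 * exp (- 2 * u z)" for z
    have gn: "g z \<ge> 0" for z by (simp add: g_def)
    have int: "integrable lborel (\<lambda>z. indicator (cball 0 \<delta>) z * g z)"
      unfolding g_def[abs_def] using sub
      by (intro integrable_indicator_mult continuous_intros continuous_on_subset[OF holomorphic_on_imp_continuous_on[OF h]]
         continuous_on_subset[OF C2r_continuous_on(1)[OF P(1)]]) auto
    have "pi / 8 * g 0 \<le> 2 / \<delta>^2 * exp (2 * \<bar>1\<bar> * \<delta>^2) * (LINT z|lborel. indicator (cball 0 \<delta>) z * g z)"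
      unfolding g_def by (rule weighted_mean_value[OF S sub C(2) h P])
    have "g 0 \<le> A * (LINT z|lborel. indicator (cball 0 \<delta>) z * g z)"
    proof -
      have "x \<le> 8 / pi * c * y" if "pi / 8 * x \<le> c * y" for x c y :: real
        using that by (simp add: field_simps)
      then show ?thesis using \<open>pi / 8 * g 0 \<le> _\<close> unfolding A_def by blast
    qed
    then have "ennreal (g 0) \<le> ennreal A * ennreal (LINT z|lborel. indicator (cball 0 \<delta>) z * g z)"
      using A by (simp add: ennreal_leI flip: ennreal_mult')
    also have "ennreal (LINT z|lborel. indicator (cball 0 \<delta>) z * g z) = (\<integral>\<^sup>+z. ennreal (indicator (cball 0 \<delta>) z * g z) \<partial>lborel)"
      using gn by (intro nn_integral_eq_integral[symmetric, OF int]) simp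
    also have "\<dots> \<le> sq_integral S u h"
      unfolding sq_integral_def g_def using sub by (intro nn_integral_mono) (auto simp: indicator_def)
    finally have 1: "ennreal (g 0) \<le> ennreal A * sq_integral S u h"
      by (simp add: mult_left_mono)
    have "ennreal (t^2 * g 0) = ennreal (t^2) * ennreal (g 0)" by (simp add: ennreal_mult')
    also have "\<dots> \<le> ennreal (t^2) * (ennreal A * sq_integral S u h)"
      using 1 by (rule mult_left_mono) simp
    also have "\<dots> = ennreal A * (ennreal (t^2) * sq_integral S u h)"
      by (simp add: mult.left_commute)
    also have "ennreal (t^2) * sq_integral S u h = sq_integral unit_disk \<psi> f"
      unfolding h_def u_def S_def by (rule weighted_nn_integral_affine[OF f class_D_continuous[OF assms] t, symmetric])
    finally show "ennreal ((tau \<psi> w)^2 * ((cmod (f w))^2 * exp (- 2 * \<psi> w))) \<le> ennreal A * 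
      sq_integral unit_disk \<psi> f"
      by (simp add: g_def h_def u_def t_def)
  qed
qed

text \<open>The constant in \<open>peak_function\<close> depends on \<open>C\<close> alone, so
  undoing the rescaling costs only the Jacobian. Together with \<open>point_evaluation_bound\<close>
  this determines the norm of evaluation at \<open>w\<close> up to constants.\<close>

lemma class_D_peak_function:
  assumes "class_D \<psi>"
  shows "\<exists>A>0. \<forall>w\<in>unit_disk. \<exists>f. f holomorphic_on unit_disk \<and> f w \<noteq> 0 \<and>
    sq_integral unit_disk \<psi> f \<le>
     ennreal (A * ((tau \<psi> w)^2 * ((cmod (f w))^2 * exp (- 2 * \<psi> w))))"
proof -
  obtain C \<delta> where resc: "uniformly_rescaled \<psi> C \<delta>"
    using class_D_uniformly_rescaled[OF assms] by blast
  then have C: "C \<ge> 1" "\<delta> > 0" by (auto simp: uniformly_rescaled_def)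
  define A where "A = 400 * pi * ((6 * C^2 + 3 / 2) * exp (8 * C^2))"
  have A: "A > 0" unfolding A_def by (intro mult_pos_pos add_nonneg_pos) auto
  show ?thesis
  proof (intro exI[of _ A] conjI A ballI)
    fix w :: complex assume w: "w \<in> unit_disk"
    define t where "t = tau \<psi> w"
    have t: "t > 0" using resc w by (simp add: t_def uniformly_rescaled_def)
    define S where "S = {z. w + of_real t * z \<in> unit_disk}"
    define u where "u z = \<psi> (w + of_real t * z)" for z
    obtain P \<sigma> where P: "C2r S u P \<sigma>" "\<And>z. z \<in> S \<Longrightarrow> Re (\<sigma> z) \<ge> 1 / (4 * (1 + C * cmod z)^2)"
      using resc w unfolding S_def t_def u_def rescaled_disk_def uniformly_rescaled_def by metis
    have S: "open S" "0 \<in> S"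
    proof -
      have "S = (\<lambda>z. w + of_real t * z) -` unit_disk" by (auto simp: S_def)
      then show "open S" by (auto intro!: open_vimage continuous_intros)
      show "0 \<in> S" using w by (simp add: S_def)
    qed
    obtain h where h: "h holomorphic_on S" "h 0 \<noteq> 0"
      "sq_integral S u h \<le>
       ennreal (A * ((cmod (h 0))^2 * exp (- 2 * u 0)))"
      using peak_function[OF C(1) S P] unfolding A_def by blast
    define f where "f z = h ((z - w) / of_real t)" for z
    have f: "f holomorphic_on unit_disk"
      unfolding f_def[abs_def] using t
      by (intro holomorphic_on_compose_gen[OF _ h(1), unfolded o_def]) (auto intro!: holomorphic_intros simp: S_def)
    have fh: "f (w + of_real t * z) = h z" for z using t by (simp add: f_def)
    have "sq_integral unit_disk \<psi> f =
        ennreal (t^2) * sq_integral S u h"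
      unfolding weighted_nn_integral_affine[OF f class_D_continuous[OF assms] t, of w] fh S_def u_def[abs_def] ..
    also have "\<dots> \<le> ennreal (t^2) * ennreal (A * ((cmod (h 0))^2 * exp (- 2 * u 0)))"
      using h(3) by (rule mult_left_mono) simp
    also have "\<dots> = ennreal (A * ((tau \<psi> w)^2 * ((cmod (f w))^2 * exp (- 2 * \<psi> w))))"
      using fh[of 0] by (simp add: u_def t_def mult_ac flip: ennreal_mult')
    finally show "\<exists>f. f holomorphic_on unit_disk \<and> f w \<noteq> 0 \<and>
      sq_integral unit_disk \<psi> f \<le>
       ennreal (A * ((tau \<psi> w)^2 * ((cmod (f w))^2 * exp (- 2 * \<psi> w))))"
      using f h(2) fh[of 0] by auto
  qed
qed

section \<open>The Volterra-composition operator and the boundedness criterion\<close>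

lemma volterra_comp_derivative:
  assumes "f holomorphic_on unit_disk" "\<phi> holomorphic_on unit_disk" "\<phi> ` unit_disk \<subseteq> unit_disk"
    "g holomorphic_on unit_disk"
  shows "volterra_comp \<phi> g f holomorphic_on unit_disk" "volterra_comp \<phi> g f 0 = 0"
    "\<And>z. z \<in> unit_disk \<Longrightarrow> deriv (volterra_comp \<phi> g f) z = f (\<phi> z) * deriv g z"
proof -
  define k where "k z = f (\<phi> z) * deriv g z" for z
  have k: "k holomorphic_on unit_disk"
    unfolding k_def[abs_def]
    by (intro holomorphic_intros holomorphic_on_compose_gen[OF assms(2,1,3), unfolded o_def] holomorphic_deriv assms open_ball)
  obtain G where G: "\<And>x. x \<in> unit_disk \<Longrightarrow> (G has_field_derivative k x) (at x within unit_disk)"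
  proof (rule holomorphic_convex_primitive[of unit_disk "{}" k])
    show "continuous_on unit_disk k" using k by (rule holomorphic_on_imp_continuous_on)
    show "k field_differentiable at x" if "x \<in> interior unit_disk - {}" for x
      using k that by (auto intro: holomorphic_on_imp_differentiable_at)
  qed (use that in auto)
  have V: "volterra_comp \<phi> g f z = G z - G 0" if "z \<in> unit_disk" for z
  proof -
    have "(k has_contour_integral (G (pathfinish (linepath 0 z)) - G (pathstart (linepath 0 z)))) (linepath 0 z)"
    proof (rule contour_integral_primitive[OF G])
      show "path_image (linepath 0 z) \<subseteq> unit_disk"
        unfolding path_image_linepath using that by (intro closed_segment_subset) auto
    qed auto
    then show ?thesis unfolding volterra_comp_def k_def[symmetric] by (simp add: contour_integral_unique)
  qed
  show "volterra_comp \<phi> g f 0 = 0" using V[of 0] by simp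
  have der: "(volterra_comp \<phi> g f has_field_derivative k z) (at z)" if "z \<in> unit_disk" for z
  proof (rule has_field_derivative_transform_within_open[where f = "\<lambda>z. G z - G 0" and S = unit_disk])
    have "(G has_field_derivative k z) (at z)"
      using G[OF that] that by (metis at_within_open open_ball)
    then show "((\<lambda>z. G z - G 0) has_field_derivative k z) (at z)"
      by (auto intro!: derivative_eq_intros)
  qed (use that V in auto)
  show "volterra_comp \<phi> g f holomorphic_on unit_disk"
    unfolding holomorphic_on_open[OF open_ball] using der by blast
  show "deriv (volterra_comp \<phi> g f) z = f (\<phi> z) * deriv g z" if "z \<in> unit_disk" for z
    using DERIV_imp_deriv[OF der[OF that]] by (simp add: k_def)
qed

theorem theorem3p1:
  fixes \<psi> :: "complex \<Rightarrow> real" and \<phi> g :: "complex \<Rightarrow> complex"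
  assumes "class_D \<psi>"
    and "standing_density \<psi>"
    and "\<phi> holomorphic_on unit_disk" and "\<phi> ` unit_disk \<subseteq> unit_disk"
    and "g holomorphic_on unit_disk"
  shows "bounded_AL2_Bloch \<psi> (volterra_comp \<phi> g) \<longleftrightarrow>
         bdd_above ((\<lambda>z. exp (\<psi> (\<phi> z) - 2 * \<psi> z) * sqrt (laplacian \<psi> (\<phi> z)) * cmod (deriv g z))
                    ` unit_disk)"
proof -
  define V where "V = volterra_comp \<phi> g"
  define I where "I = sq_integral unit_disk \<psi>"
  have V: "V f holomorphic_on unit_disk" "V f 0 = 0" "\<And>z. z \<in> unit_disk \<Longrightarrow> deriv (V f) z = f (\<phi> z) * deriv g z"
    if "f holomorphic_on unit_disk" for f
    using volterra_comp_derivative[OF that assms(3-5)] unfolding V_def by auto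
  have \<phi>: "\<phi> z \<in> unit_disk" if "z \<in> unit_disk" for z using assms(4) that by blast
  have tau: "tau \<psi> w > 0 \<and> sqrt (laplacian \<psi> w) = 1 / tau \<psi> w" if "w \<in> unit_disk" for w
    using assms(1) that by (simp add: class_D_def tau_def)
  have norm_sq: "(L2_norm \<psi> f)^2 = enn2real (I f) / pi" "L2_norm \<psi> f \<ge> 0" for f
    by (simp_all add: L2_norm_def L2_int_def I_def sq_integral_def enn2real_mult)
  have AL2: "f \<in> AL2 \<psi> \<longleftrightarrow> f holomorphic_on unit_disk \<and> I f < \<infinity>" for f
    by (auto simp: AL2_def L2_int_def I_def sq_integral_def ennreal_mult_less_top ennreal_mult_eq_top_iff less_top)
  have expsq: "(cmod x)^2 * exp (- 2 * y) = (cmod x * exp (- y))^2" for x y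
    by (simp add: power_mult_distrib flip: exp_double)
  let ?F = "\<lambda>z. exp (\<psi> (\<phi> z) - 2 * \<psi> z) * sqrt (laplacian \<psi> (\<phi> z)) * cmod (deriv g z)"
  show ?thesis unfolding V_def[symmetric]
  proof
    assume "bounded_AL2_Bloch \<psi> V"
    then obtain C where C: "\<And>f. f \<in> AL2 \<psi> \<Longrightarrow> V f \<in> Bloch \<psi> \<and> Bloch_norm \<psi> (V f) \<le> C * L2_norm \<psi> f"
      unfolding bounded_AL2_Bloch_def by blast
    obtain A where A: "A > 0" "\<forall>w\<in>unit_disk. \<exists>f. f holomorphic_on unit_disk \<and> f w \<noteq> 0 \<and>
       I f \<le> ennreal (A * ((tau \<psi> w)^2 * ((cmod (f w))^2 * exp (- 2 * \<psi> w))))"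
      using class_D_peak_function[OF assms(1), folded I_def] by (elim exE conjE) (rule that)
    show "bdd_above (?F ` unit_disk)"
    proof (rule bdd_aboveI2)
      fix z :: complex assume z: "z \<in> unit_disk"
      define w where "w = \<phi> z"
      define t where "t = tau \<psi> w"
      have w: "w \<in> unit_disk" using \<phi>[OF z] by (simp add: w_def)
      have t: "t > 0" using tau[OF w] by (simp add: t_def)
      \<comment> \<open>Testing the operator on a function peaked at \<open>\<phi> z\<close> turns
        the norm inequality into a pointwise one at \<open>z\<close>. The function is left
        unnormalised: its size \<open>y\<close> appears on both sides and cancels.\<close>
      obtain f where f: "f holomorphic_on unit_disk" "f w \<noteq> 0"
        "I f \<le> ennreal (A * (t^2 * ((cmod (f w))^2 * exp (- 2 * \<psi> w))))"
        using bspec[OF A(2) w] unfolding t_def by blast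
      have fA: "f \<in> AL2 \<psi>" using f unfolding AL2 by (auto intro: order_le_less_trans)
      define N where "N = L2_norm \<psi> f"
      define y where "y = cmod (f w) * exp (- \<psi> w)"
      have y: "y > 0" using f by (simp add: y_def)
      have "N\<^sup>2 \<le> A / pi * (t * y)^2"
      proof -
        have "enn2real (I f) \<le> A * (t^2 * ((cmod (f w))^2 * exp (- 2 * \<psi> w)))"
          using enn2real_mono[OF f(3)] A by simp
        also have "\<dots> = A * (t * y)^2" unfolding expsq y_def by (simp add: power_mult_distrib)
        finally show ?thesis unfolding N_def norm_sq by (simp add: divide_right_mono)
      qed
      from real_sqrt_le_mono[OF this, unfolded real_sqrt_mult real_sqrt_abs]
      have N: "N \<le> sqrt (A / pi) * (t * y)" "N \<ge> 0"
        using y t norm_sq(2)[of f] by (auto simp: N_def abs_of_pos)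
      \<comment> \<open>A supremum of reals dominates its members only when the set is bounded
        above; membership of \<open>V f\<close> in \<open>Bloch\<close> provides this.\<close>
      have "bdd_above ((\<lambda>z. exp (- 2 * \<psi> z) * cmod (deriv (V f) z)) ` unit_disk)"
        using C[OF fA] by (auto simp: Bloch_def intro: bounded_imp_bdd_above)
      then have "exp (- 2 * \<psi> z) * cmod (deriv (V f) z) \<le> (SUP z\<in>unit_disk. exp (- 2 * \<psi> z) * cmod (deriv (V f) z))"
        using z by (intro cSUP_upper)
      also have "\<dots> = Bloch_norm \<psi> (V f)" using V(2)[OF f(1)] by (simp add: Bloch_norm_def)
      also have "\<dots> \<le> C * N" using C[OF fA] by (simp add: N_def)
      also have "\<dots> \<le> \<bar>C\<bar> * N" using N(2) by (intro mult_right_mono) auto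
      also have "\<dots> \<le> \<bar>C\<bar> * (sqrt (A / pi) * (t * y))" using N(1) by (intro mult_left_mono) auto
      finally have "exp (- 2 * \<psi> z) * (cmod (f w) * cmod (deriv g z)) \<le> \<bar>C\<bar> * (sqrt (A / pi) * (t * y))"
        using V(3)[OF f(1) z] by (simp add: norm_mult w_def)
      moreover have "exp (- 2 * \<psi> z) * (cmod (f w) * cmod (deriv g z)) = (exp (\<psi> w - 2 * \<psi> z) * cmod (deriv g z)) * y"
        unfolding y_def by (simp add: exp_diff exp_minus field_simps)
      ultimately have "(exp (\<psi> w - 2 * \<psi> z) * cmod (deriv g z)) * y \<le> \<bar>C\<bar> * (sqrt (A / pi) * (t * y))"
        by linarith
      also have "\<dots> = (\<bar>C\<bar> * sqrt (A / pi) * t) * y" by (simp only: mult.assoc)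
      finally have "exp (\<psi> w - 2 * \<psi> z) * cmod (deriv g z) \<le> \<bar>C\<bar> * sqrt (A / pi) * t"
        using y by (rule mult_right_le_imp_le)
      then have "exp (\<psi> w - 2 * \<psi> z) * cmod (deriv g z) / t \<le> \<bar>C\<bar> * sqrt (A / pi)"
        using t by (simp add: divide_le_eq)
      then show "?F z \<le> \<bar>C\<bar> * sqrt (A / pi)"
        using tau[OF w] by (simp add: w_def[symmetric] t_def)
    qed
  next
    assume "bdd_above (?F ` unit_disk)"
    then obtain B where B: "\<And>z. z \<in> unit_disk \<Longrightarrow> ?F z \<le> B" unfolding bdd_above_def by blast
    obtain A where A: "A > 0" "\<forall>f w. f holomorphic_on unit_disk \<longrightarrow> w \<in> unit_disk \<longrightarrow>
      ennreal ((tau \<psi> w)^2 * ((cmod (f w))^2 * exp (- 2 * \<psi> w))) \<le> ennreal A * I f"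
      using point_evaluation_bound[OF assms(1), folded I_def] by (elim exE conjE) (rule that)
    show "bounded_AL2_Bloch \<psi> V"
      unfolding bounded_AL2_Bloch_def
    \<comment> \<open>\<open>sqrt A\<close> is the cost of evaluation at \<open>\<phi> z\<close>,
      and \<open>sqrt pi\<close> undoes the normalisation of area measure in
      \<open>L2_norm\<close>.\<close>
    proof (intro exI[of _ "B * sqrt (A * pi)"] ballI)
      fix f assume fA: "f \<in> AL2 \<psi>"
      then have f: "f holomorphic_on unit_disk" "I f < \<infinity>" using AL2 by auto
      define N where "N = L2_norm \<psi> f"
      have le: "exp (- 2 * \<psi> z) * cmod (deriv (V f) z) \<le> B * sqrt (A * pi) * N" if z: "z \<in> unit_disk" for z
      proof -
        define w where "w = \<phi> z"
        define t where "t = tau \<psi> w"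
        have w: "w \<in> unit_disk" using \<phi>[OF z] by (simp add: w_def)
        have t: "t > 0" using tau[OF w] by (simp add: t_def)
        define y where "y = cmod (f w) * exp (- \<psi> w)"
        have "ennreal ((t * y)^2) \<le> ennreal A * I f"
          using A(2)[rule_format, OF f(1) w] unfolding expsq t_def y_def by (simp add: power_mult_distrib)
        \<comment> \<open>Finiteness of \<open>I f\<close> is essential, since
          \<open>enn2real\<close> sends infinity to 0.\<close>
        also have "ennreal A * I f = ennreal (A * enn2real (I f))"
          using f(2) A by (simp add: ennreal_mult' less_top)
        finally have "(t * y)^2 \<le> A * enn2real (I f)"
          using A by (subst (asm) ennreal_le_iff) auto
        also have "\<dots> = (A * pi) * N^2" unfolding N_def norm_sq by simp
        finally have "sqrt ((t * y)^2) \<le> sqrt ((A * pi) * N^2)" by (rule real_sqrt_le_mono)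
        then have ty: "t * y \<le> sqrt (A * pi) * N"
          using t norm_sq(2)[of f] by (simp add: real_sqrt_mult N_def y_def)
        \<comment> \<open>The factor \<open>sqrt (laplacian \<psi> (\<phi> z))\<close> is
          \<open>1 / t\<close> and cancels against \<open>t\<close>, while
          \<open>exp (\<psi> w)\<close> cancels against the exponential in \<open>y\<close>.\<close>
        have "exp (- 2 * \<psi> z) * cmod (deriv (V f) z) = ?F z * (t * y)"
          using V(3)[OF f(1) z] tau[OF w] t
          by (simp add: norm_mult w_def[symmetric] t_def[symmetric] y_def exp_diff exp_minus field_simps)
        also have "\<dots> \<le> B * (t * y)" using B[OF z] t by (intro mult_right_mono) (auto simp: y_def)
        also have "\<dots> \<le> B * (sqrt (A * pi) * N)"
        proof (intro mult_left_mono ty)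
          have "0 \<le> ?F z" using tau[OF w] t by (simp add: w_def)
          then show "0 \<le> B" using B[OF z] by linarith
        qed
        finally show ?thesis by (simp add: mult.assoc)
      qed
      have "bounded ((\<lambda>z. exp (- 2 * \<psi> z) * cmod (deriv (V f) z)) ` unit_disk)"
        unfolding bounded_iff using le by (intro exI[of _ "B * sqrt (A * pi) * N"]) auto
      then have "V f \<in> Bloch \<psi>" using V(1)[OF f(1)] by (simp add: Bloch_def)
      moreover have "Bloch_norm \<psi> (V f) \<le> B * sqrt (A * pi) * N"
        unfolding Bloch_norm_def V(2)[OF f(1)] using le by (simp, intro cSUP_least) auto
      ultimately show "V f \<in> Bloch \<psi> \<and> Bloch_norm \<psi> (V f) \<le> B * sqrt (A * pi) * L2_norm \<psi> f"
        by (simp add: N_def)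
    qed
  qed
qed

end
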